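(* Let $M=\mathbb{R}^m\times\mathbb{T}^n$ with $m+n=4$ and $n\le2$. Then there are $\delta>0$ and $C<\infty$ such that for all $1\le\mu\le\lambda$, all $R\in\mathcal{R}(\mu,\lambda)$ and all $u_0\in L^2(M)$, $$\|P_Re^{it\Delta}u_0\|_{L^4(\mathbb{R}\times M)}\le C\,\lambda^{\frac12}\Big(\frac{\mu}{\lambda}\Big)^{\delta}\|P_Ru_0\|_{L^2(M)}.$$
   Context: $\mathbb{T}=\mathbb{R}/2\pi\mathbb{Z}$ (for $n=0$, $M=\mathbb{R}^4$), $\widehat M=\mathbb{R}^m\times\mathbb{Z}^n$ is the frequency space of $M$, and $\Delta$ is the Laplacian on $M$. In $L^4(\mathbb{R}\times M)$ the factor $\mathbb{R}$ is the time variable $t$. For $1\le\mu\le\lambda$, $\mathcal{R}(\mu,\lambda)$ is the collection of all sets $$R=\{\xi\in\widehat M:\ \xi-\xi_0\in[-\lambda,\lambda]^4,\ |a\cdot\xi-c|\le\mu\}$$ with $\xi_0,a\in\mathbb{R}^4$, $|a|=1$, $c\in\mathbb{R}$. $P_R$ is the Fourier multiplier whose symbol is the characteristic function of $R$, where the Fourier transform is $\hat f(\xi)=(2\pi)^{-2}\int_{\mathbb{R}^m\times[0,2\pi]^n}e^{-ix\cdot\xi}f(x)\,dx$, $\xi\in\widehat M$. *)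

theory Defs
  imports "HOL-Analysis.Analysis"
begin

text \<open>
  A function on \<open>M = R^m \<times> T^n\<close>, \<open>m + n = 4\<close>, is represented by a function on \<open>real^4\<close> that is
  \<open>2\<pi>\<close>-periodic in the last \<open>n\<close> coordinates. The elements of the index type \<open>4\<close> are \<open>0, 1, 2, 3\<close>,
  so these are the coordinates \<open>m, \<dots>, 3\<close>. Below, \<open>J\<close> is always the set of periodic coordinates.
\<close>

definition torus_coords :: "nat \<Rightarrow> nat \<Rightarrow> 4 set" where
  "torus_coords m n = of_nat ` {m..<m + n}"

text \<open>Integration over \<open>M\<close> is integration over the fundamental domain \<open>R^m \<times> [0,2\<pi>]^n\<close>.\<close>

definition M_measure :: "4 set \<Rightarrow> (real^4) measure" where
  "M_measure J = restrict_space lborel {x. \<forall>i\<in>J. x $ i \<in> {0..2 * pi}}"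

definition freq_space :: "4 set \<Rightarrow> (real^4) set" where
  "freq_space J = {\<xi>. \<forall>i\<in>J. \<xi> $ i \<in> \<int>}"

text \<open>
  Lebesgue measure on \<open>R^m\<close> times counting measure on \<open>Z^n\<close>, as a Borel measure on \<open>real^4\<close>
  that is concentrated on \<open>freq_space J\<close>.
\<close>

definition freq_measure :: "4 set \<Rightarrow> (real^4) measure" where
  "freq_measure J =
     distr (PiM UNIV (\<lambda>i. if i \<in> J then distr (count_space UNIV) borel real_of_int else lborel))
       borel vec_lambda"

definition eLp_norm :: "real \<Rightarrow> 'a measure \<Rightarrow> ('a \<Rightarrow> complex) \<Rightarrow> ennreal" where
  "eLp_norm p N f =
     (let I = (\<integral>\<^sup>+ x. ennreal (norm (f x) powr p) \<partial>N)
      in if I = \<infinity> then \<infinity> else ennreal (enn2real I powr (1 / p)))"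

definition L2 :: "'a measure \<Rightarrow> ('a \<Rightarrow> complex) set" where
  "L2 N = {f \<in> borel_measurable N. eLp_norm 2 N f < \<infinity>}"

definition L2_M :: "4 set \<Rightarrow> (real^4 \<Rightarrow> complex) set" where
  "L2_M J = {f \<in> borel_measurable borel.
     (\<forall>i\<in>J. \<forall>x. f (x + axis i (2 * pi)) = f x) \<and> f \<in> L2 (M_measure J)}"

definition fourier :: "4 set \<Rightarrow> (real^4 \<Rightarrow> complex) \<Rightarrow> real^4 \<Rightarrow> complex" where
  "fourier J f \<xi> = (1 / (2 * pi)^2) *\<^sub>R (LINT x|M_measure J. cis (- (x \<bullet> \<xi>)) * f x)"

definition inv_fourier :: "4 set \<Rightarrow> (real^4 \<Rightarrow> complex) \<Rightarrow> real^4 \<Rightarrow> complex" where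
  "inv_fourier J g x = (1 / (2 * pi)^2) *\<^sub>R (LINT \<xi>|freq_measure J. cis (x \<bullet> \<xi>) * g \<xi>)"

text \<open>
  The extension of the Fourier transform to \<open>L\<^sup>2\<close>: an (almost everywhere unique) function \<open>g\<close> that is
  the \<open>L\<^sup>2\<close>-limit of the integrals over \<open>|x| \<le> k\<close>.
\<close>

definition fourier_L2 :: "4 set \<Rightarrow> (real^4 \<Rightarrow> complex) \<Rightarrow> real^4 \<Rightarrow> complex" where
  "fourier_L2 J f = (SOME g. g \<in> L2 (freq_measure J) \<and>
     (\<lambda>k::nat. eLp_norm 2 (freq_measure J)
        (\<lambda>\<xi>. g \<xi> - fourier J (\<lambda>x. indicator (cball 0 (real k)) x * f x) \<xi>)) \<longlonglongrightarrow> 0)"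

text \<open>
  The solution \<open>exp(i t \<Delta>) f\<close> of the Schroedinger equation, i.e. the Fourier multiplier with symbol
  \<open>exp(- i t |\<xi>|\<^sup>2)\<close>; it is determined up to null sets.
\<close>

definition schroedinger :: "4 set \<Rightarrow> real \<Rightarrow> (real^4 \<Rightarrow> complex) \<Rightarrow> real^4 \<Rightarrow> complex" where
  "schroedinger J t f = (SOME g. g \<in> L2_M J \<and>
     (AE \<xi> in freq_measure J. fourier_L2 J g \<xi> = cis (- t * (norm \<xi>)\<^sup>2) * fourier_L2 J f \<xi>))"

definition slabs :: "4 set \<Rightarrow> real \<Rightarrow> real \<Rightarrow> (real^4) set set" where
  "slabs J mu lam = {R. \<exists>\<xi>\<^sub>0 a :: real^4. \<exists>c :: real. norm a = 1 \<and>
     R = {\<xi> \<in> freq_space J. (\<forall>i. (\<xi> - \<xi>\<^sub>0) $ i \<in> {- lam..lam}) \<and> \<bar>a \<bullet> \<xi> - c\<bar> \<le> mu}}"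

text \<open>
  The Fourier multiplier whose symbol is the characteristic function of \<open>R\<close>. Only bounded \<open>R\<close> is
  relevant; then the symbol times the transform of \<open>f\<close> is integrable, and the inversion integral
  gives the continuous representative, which does not depend on the choices of representatives in
  \<^const>\<open>fourier_L2\<close> and \<^const>\<open>schroedinger\<close>. In particular \<open>P J R (schroedinger J t f) x\<close> is a
  well-defined jointly continuous function of \<open>(t, x)\<close>.
\<close>

definition P :: "4 set \<Rightarrow> (real^4) set \<Rightarrow> (real^4 \<Rightarrow> complex) \<Rightarrow> real^4 \<Rightarrow> complex" where
  "P J R f = inv_fourier J (\<lambda>\<xi>. indicator R \<xi> * fourier_L2 J f \<xi>)"

end

theory Submission
  imports Defs "HOL-Probability.Sinc_Integral" "HOL-Real_Asymp.Real_Asymp"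
begin

text \<open>
  Squaring turns the \<open>L\<^sup>4\<close> norm of the solution into the \<open>L\<^sup>2\<close> norm of its square. In space-time this is an
  oscillatory integral of \<open>g(\<xi>\<^sub>1) g(\<xi>\<^sub>2)\<close> with phase \<open>x \<bullet> (\<xi>\<^sub>1 + \<xi>\<^sub>2) - t (|\<xi>\<^sub>1|\<^sup>2 + |\<xi>\<^sub>2|\<^sup>2)\<close>. With
  Fejer weights in \<open>t\<close> and in the non-compact coordinates of \<open>x\<close> the kernel of the associated
  quadratic form is nonnegative and compactly supported, and Schur's test bounds the form by the
  measure of \<open>{\<xi> \<in> R. ||\<xi> - \<sigma>|\<^sup>2 - \<rho>| \<le> \<epsilon>}\<close>, where \<open>\<sigma> = (\<xi>\<^sub>1 + \<xi>\<^sub>2)/2\<close>. Since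
  \<open>\<sigma>\<close> is a midpoint of two points of \<open>R\<close>, this set lies in a slab of width \<open>\<approx> \<mu>\<close> and a cube of size
  \<open>\<approx> \<lambda>\<close> centred at \<open>\<sigma>\<close>, and its measure is \<open>O(\<epsilon> \<lambda>\<^sup>2 (\<mu>/\<lambda>)\<^bsup>1/6\<^esup>)\<close>: dilating the two real
  coordinates that \<open>n \<le> 2\<close> provides by factors in \<open>[1, 1 + \<mu>/\<lambda>]\<close> thickens the sphere from \<open>\<epsilon>\<close>
  to \<open>\<mu> \<lambda>\<close>, and a shell of that thickness meets the slab in a set that is easily measured,
  in real and integer coordinates alike.

  The same Schur test, applied to the inversion integral itself, gives the boundedness of the
  inverse Fourier transform on \<open>L\<^sup>2\<close>. The Fourier transform is its adjoint, hence bounded, and it is a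
  left inverse because Fejer kernels form an approximate identity. This is all the Plancherel theory
  that the statement needs; completeness of the exponentials on the torus does not enter.
\<close>

subsection \<open>Schur's test for oscillatory integrals\<close>

text \<open>The exponent comes from a balance. Let \<open>h = mu / lam\<close>. For fixed
  \<open>(c, d)\<close>, the other two coordinates, the shell cuts a circle of squared radius about
  \<open>r\<close> in the plane of the two real coordinates. Dilating it by factors up to
  \<open>1 + h\<close> gains \<open>\<epsilon> / (h r)\<close>, which is useless for small
  \<open>r\<close>. Circles with \<open>r \<le> K\<close> are therefore kept as they are: each has
  area \<open>O(\<epsilon>)\<close>, and \<open>(c, d)\<close> ranges over a set of measure
  \<open>O(lam sqrt K)\<close>. The others contribute \<open>O(\<epsilon> / (h K))\<close> times the
  thick shell, whose measure is \<open>O(lam^2 mu sqrt (mu lam))\<close>. Equating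
  \<open>lam sqrt K\<close> with \<open>lam^4 sqrt h / K\<close> gives
  \<open>sqrt K = lam h^(1/6)\<close>, and the fourth root in the L^4 norm turns \<open>1/6\<close>
  into \<open>\<delta> = 1/24\<close>. The factor \<open>\<epsilon>\<close> is essential, because it
  cancels the height \<open>1 / \<epsilon>\<close> of the time kernel when the weights are removed
  by Fatou as \<open>\<epsilon> \<rightarrow> 0\<close>. Counting integers costs an additive 1 per
  coordinate, so this factor is drawn from the real plane alone. The weight in \<open>x\<close> is
  chosen wider than the one in \<open>t\<close>, by a factor that depends on the position of
  \<open>R\<close>; the final bound does not see it.\<close>

lemma norm_integral_le_nn_integral:
  fixes f :: "'a \<Rightarrow> complex"
  shows "ennreal (norm (LINT x|M. f x)) \<le> (\<integral>\<^sup>+ x. ennreal (norm (f x)) \<partial>M)"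
proof (cases "integrable M f")
  case True
  then show ?thesis by (rule integral_norm_bound_ennreal)
\<comment> \<open>Otherwise the Bochner integral is 0 by convention, so no integrability has to be
  checked when the bound is applied.\<close>
qed (simp add: not_integrable_integral_eq)

lemma borel_measurable_cnj[measurable]: "cnj \<in> borel_measurable borel"
  by (intro borel_measurable_continuous_onI continuous_intros)

text \<open>The majorant depends on \<open>\<xi>\<close> alone and is integrable over the product
  because \<open>\<rho>\<close> is finite.\<close>

lemma integrable_pair_bound:
  fixes F :: "'x \<Rightarrow> 'a \<Rightarrow> complex"
  assumes "finite_measure \<rho>" and "sigma_finite_measure N"
    and [measurable]: "(\<lambda>(x, \<xi>). F x \<xi>) \<in> borel_measurable (\<rho> \<Otimes>\<^sub>M N)"
    and g: "integrable N (g :: 'a \<Rightarrow> complex)"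
    and bd: "\<And>x \<xi>. norm (F x \<xi>) \<le> C * norm (g \<xi>)"
  shows "integrable (\<rho> \<Otimes>\<^sub>M N) (\<lambda>(x, \<xi>). F x \<xi>)"
proof -
  interpret r: finite_measure \<rho> by fact
  interpret N: sigma_finite_measure N by fact
  interpret pair_sigma_finite \<rho> N ..
  note [measurable] = borel_measurable_integrable[OF g]
  have "integrable (\<rho> \<Otimes>\<^sub>M N) (\<lambda>(x, \<xi>). C * norm (g \<xi>))"
    by (rule Fubini_integrable) (auto simp: case_prod_beta g)
  then show ?thesis
  proof (rule Bochner_Integration.integrable_bound)
    show "AE x in \<rho> \<Otimes>\<^sub>M N. norm (case x of (x, \<xi>) \<Rightarrow> F x \<xi>) \<le> norm (case x of (x, \<xi>) \<Rightarrow> C * norm (g \<xi>))"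
      using bd by (intro AE_I2) (force simp: case_prod_beta intro: order_trans[OF _ abs_ge_self])
  qed measurable
qed

text \<open>Covers both oscillatory integrals of the proof: the inversion integral on M, with phase
  \<open>x \<bullet> \<xi>\<close>, and its bilinear space-time version \<open>bilin_phase\<close>.
  The weights are part of \<open>\<rho>\<close> and make it finite, so Fubini needs no decay of
  \<open>\<Phi>\<close>.\<close>

locale bounded_phase =
  fixes \<rho> :: "'x measure" and N :: "'a measure" and \<Phi> :: "'x \<Rightarrow> 'a \<Rightarrow> complex"
  assumes finite_\<rho>: "finite_measure \<rho>" and sigma_finite_N: "sigma_finite_measure N"
    and meas_\<Phi>[measurable]: "(\<lambda>(x, \<xi>). \<Phi> x \<xi>) \<in> borel_measurable (\<rho> \<Otimes>\<^sub>M N)"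
    and norm_\<Phi>: "\<And>x \<xi>. norm (\<Phi> x \<xi>) \<le> 1"
begin

sublocale \<rho>: finite_measure \<rho> by (rule finite_\<rho>)
sublocale N: sigma_finite_measure N by (rule sigma_finite_N)
sublocale pair_sigma_finite \<rho> N ..

definition transf :: "('a \<Rightarrow> complex) \<Rightarrow> 'x \<Rightarrow> complex" where
  "transf g x = (LINT \<xi>|N. \<Phi> x \<xi> * g \<xi>)"

text \<open>Integral kernel, up to conjugation, of \<open>transf\<close> followed by its
  adjoint.\<close>

definition ker :: "'a \<Rightarrow> 'a \<Rightarrow> complex" where
  "ker \<xi> \<eta> = (LINT x|\<rho>. \<Phi> x \<xi> * cnj (\<Phi> x \<eta>))"

lemma borel_measurable_transf[measurable]:
  assumes [measurable]: "g \<in> borel_measurable N"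
  shows "transf g \<in> borel_measurable \<rho>"
  unfolding transf_def[abs_def] by measurable

lemma norm_transf: "integrable N g \<Longrightarrow> norm (transf g x) \<le> (LINT \<xi>|N. norm (g \<xi>))"
  unfolding transf_def
  by (rule order_trans[OF integral_norm_bound], rule integral_mono_AE')
    (auto simp: norm_mult intro!: mult_left_le_one_le norm_\<Phi>)

lemma integral_transf_cnj:
  assumes g: "integrable N g" and h: "integrable N h"
  shows "(LINT x|\<rho>. transf g x * cnj (transf h x)) = (LINT \<xi>|N. LINT \<eta>|N. g \<xi> * cnj (h \<eta>) * ker \<xi> \<eta>)"
proof -
  note [measurable] = borel_measurable_integrable[OF g] borel_measurable_integrable[OF h]
  \<comment> \<open>When \<open>transf g\<close> is unfolded, \<open>transf h\<close> remains as a
    bounded factor and \<open>g\<close> supplies the majorant; in \<open>i2\<close> the majorant is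
    \<open>h\<close>.\<close>
  have i1: "integrable (\<rho> \<Otimes>\<^sub>M N) (\<lambda>(x, \<xi>). \<Phi> x \<xi> * g \<xi> * cnj (transf h x))"
  proof (rule integrable_pair_bound[OF finite_\<rho> sigma_finite_N _ g, where C="LINT \<xi>|N. norm (h \<xi>)"])
    show "(\<lambda>(x, \<xi>). \<Phi> x \<xi> * g \<xi> * cnj (transf h x)) \<in> borel_measurable (\<rho> \<Otimes>\<^sub>M N)"
      by measurable
    show "norm (\<Phi> x \<xi> * g \<xi> * cnj (transf h x)) \<le> (LINT \<xi>|N. norm (h \<xi>)) * norm (g \<xi>)" for x \<xi>
    proof -
      have "norm (\<Phi> x \<xi>) * norm (transf h x) \<le> 1 * (LINT \<xi>|N. norm (h \<xi>))"
        by (intro mult_mono norm_\<Phi> norm_transf h) auto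
      then have "norm (\<Phi> x \<xi>) * norm (transf h x) * norm (g \<xi>) \<le> 1 * (LINT \<xi>|N. norm (h \<xi>)) * norm (g \<xi>)"
        by (intro mult_right_mono) auto
      then show ?thesis by (simp add: norm_mult mult_ac)
    qed
  qed
  have i2: "integrable (\<rho> \<Otimes>\<^sub>M N) (\<lambda>(x, \<eta>). g \<xi> * \<Phi> x \<xi> * cnj (\<Phi> x \<eta> * h \<eta>))" if "\<xi> \<in> space N" for \<xi>
  proof (rule integrable_pair_bound[OF finite_\<rho> sigma_finite_N _ h, where C="norm (g \<xi>)"])
    have [measurable]: "(\<lambda>x. \<Phi> x \<xi>) \<in> borel_measurable \<rho>"
      using measurable_compose[OF measurable_Pair2'[OF that] meas_\<Phi>] by simp
    show "(\<lambda>(x, \<eta>). g \<xi> * \<Phi> x \<xi> * cnj (\<Phi> x \<eta> * h \<eta>)) \<in> borel_measurable (\<rho> \<Otimes>\<^sub>M N)"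
      by measurable
    show "norm (g \<xi> * \<Phi> x \<xi> * cnj (\<Phi> x \<eta> * h \<eta>)) \<le> norm (g \<xi>) * norm (h \<eta>)" for x \<eta>
    proof -
      have "norm (\<Phi> x \<xi>) * norm (\<Phi> x \<eta>) \<le> 1"
        by (intro mult_le_one norm_\<Phi>) auto
      then have "norm (g \<xi>) * norm (h \<eta>) * (norm (\<Phi> x \<xi>) * norm (\<Phi> x \<eta>)) \<le> norm (g \<xi>) * norm (h \<eta>) * 1"
        by (intro mult_left_mono) auto
      then show ?thesis by (simp add: norm_mult mult_ac)
    qed
  qed
  have "(LINT x|\<rho>. transf g x * cnj (transf h x)) = (LINT x|\<rho>. LINT \<xi>|N. \<Phi> x \<xi> * g \<xi> * cnj (transf h x))"
    by (simp add: transf_def)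
  also have "\<dots> = (LINT \<xi>|N. LINT x|\<rho>. \<Phi> x \<xi> * g \<xi> * cnj (transf h x))"
    by (rule Fubini_integral[OF i1, symmetric])
  also have "\<dots> = (LINT \<xi>|N. LINT x|\<rho>. LINT \<eta>|N. g \<xi> * \<Phi> x \<xi> * cnj (\<Phi> x \<eta> * h \<eta>))"
  proof -
    have *: "\<Phi> x \<xi> * g \<xi> * cnj (transf h x) = (LINT \<eta>|N. g \<xi> * \<Phi> x \<xi> * cnj (\<Phi> x \<eta> * h \<eta>))" for x \<xi>
      using Bochner_Integration.integral_cnj[of N "\<lambda>\<eta>. \<Phi> x \<eta> * h \<eta>"]
      by (simp del: complex_cnj_mult add: transf_def)
    show ?thesis by (simp only: *)
  qed
  also have "\<dots> = (LINT \<xi>|N. LINT \<eta>|N. LINT x|\<rho>. g \<xi> * \<Phi> x \<xi> * cnj (\<Phi> x \<eta> * h \<eta>))"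
    by (intro Bochner_Integration.integral_cong refl Fubini_integral[symmetric] i2)
  also have "\<dots> = (LINT \<xi>|N. LINT \<eta>|N. LINT x|\<rho>. (g \<xi> * cnj (h \<eta>)) * (\<Phi> x \<xi> * cnj (\<Phi> x \<eta>)))"
    by (simp add: mult_ac)
  finally show ?thesis
    by (simp add: ker_def)
qed

text \<open>By AM-GM, the product of \<open>norm (g \<xi>)\<close> and
  \<open>norm (g \<eta>)\<close> is at most half the sum of their squares. Symmetry of
  \<open>\<kappa>\<close> makes the two halves equal, and a row integral over \<open>S\<close>
  leaves the factor \<open>A\<close>. Kernel and rows are controlled on \<open>S\<close> only, where
  \<open>g\<close> lives.\<close>

lemma schur_bound:
  fixes \<kappa> :: "'a \<Rightarrow> 'a \<Rightarrow> ennreal"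
  assumes g: "integrable N g" and [measurable]: "S \<in> sets N"
    and supp: "\<And>\<xi>. \<xi> \<notin> S \<Longrightarrow> g \<xi> = 0"
    and [measurable]: "(\<lambda>(\<xi>, \<eta>). \<kappa> \<xi> \<eta>) \<in> borel_measurable (N \<Otimes>\<^sub>M N)"
    and ker_le: "\<And>\<xi> \<eta>. \<xi> \<in> S \<Longrightarrow> \<eta> \<in> S \<Longrightarrow> ennreal (norm (ker \<xi> \<eta>)) \<le> \<kappa> \<xi> \<eta>"
    and sym: "\<And>\<xi> \<eta>. \<kappa> \<xi> \<eta> = \<kappa> \<eta> \<xi>"
    and A: "\<And>\<xi>. \<xi> \<in> S \<Longrightarrow> (\<integral>\<^sup>+ \<eta>. \<kappa> \<xi> \<eta> * indicator S \<eta> \<partial>N) \<le> A"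
  shows "(\<integral>\<^sup>+ x. ennreal ((norm (transf g x))\<^sup>2) \<partial>\<rho>) \<le> A * (\<integral>\<^sup>+ \<xi>. ennreal ((norm (g \<xi>))\<^sup>2) \<partial>N)"
proof -
  note [measurable] = borel_measurable_integrable[OF g]
  interpret NN: pair_sigma_finite N N ..
  define B where "B = (LINT \<xi>|N. norm (g \<xi>))"
  have B: "(norm (transf g x))\<^sup>2 \<le> B\<^sup>2" for x
    unfolding B_def by (intro power_mono norm_transf g) auto
  \<comment> \<open>Lets the nonnegative integral be read as a Bochner integral, for which the
    kernel identity holds.\<close>
  have int: "integrable \<rho> (\<lambda>x. (norm (transf g x))\<^sup>2)"
    by (rule \<rho>.integrable_const_bound[where B="B\<^sup>2"]) (use B in auto)
  have "(\<integral>\<^sup>+ x. ennreal ((norm (transf g x))\<^sup>2) \<partial>\<rho>) = ennreal (LINT x|\<rho>. (norm (transf g x))\<^sup>2)"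
    by (rule nn_integral_eq_integral[OF int]) auto
  also have "(LINT x|\<rho>. (norm (transf g x))\<^sup>2) = norm (complex_of_real (LINT x|\<rho>. (norm (transf g x))\<^sup>2))"
    by (simp add: integral_nonneg_AE)
  also have "complex_of_real (LINT x|\<rho>. (norm (transf g x))\<^sup>2) = (LINT x|\<rho>. transf g x * cnj (transf g x))"
    by (simp add: complex_norm_square flip: integral_complex_of_real of_real_power)
  also have "\<dots> = (LINT \<xi>|N. LINT \<eta>|N. g \<xi> * cnj (g \<eta>) * ker \<xi> \<eta>)"
    by (rule integral_transf_cnj[OF g g])
  also have "ennreal (norm \<dots>) \<le> (\<integral>\<^sup>+ \<xi>. ennreal (norm (LINT \<eta>|N. g \<xi> * cnj (g \<eta>) * ker \<xi> \<eta>)) \<partial>N)"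
    by (rule norm_integral_le_nn_integral)
  also have "\<dots> \<le> (\<integral>\<^sup>+ \<xi>. \<integral>\<^sup>+ \<eta>. ennreal (norm (g \<xi> * cnj (g \<eta>) * ker \<xi> \<eta>)) \<partial>N \<partial>N)"
    by (intro nn_integral_mono norm_integral_le_nn_integral)
  also have "\<dots> \<le> (\<integral>\<^sup>+ \<xi>. \<integral>\<^sup>+ \<eta>. (ennreal (1/2) * ennreal ((norm (g \<xi>))\<^sup>2)) * (\<kappa> \<xi> \<eta> * indicator S \<eta>)
        + ennreal (1/2) * ennreal ((norm (g \<eta>))\<^sup>2) * (\<kappa> \<eta> \<xi> * indicator S \<xi>) \<partial>N \<partial>N)"
    (is "_ \<le> ?L")
  proof (intro nn_integral_mono)
    fix \<xi> \<eta>
    show "ennreal (norm (g \<xi> * cnj (g \<eta>) * ker \<xi> \<eta>)) \<le>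
      (ennreal (1/2) * ennreal ((norm (g \<xi>))\<^sup>2)) * (\<kappa> \<xi> \<eta> * indicator S \<eta>)
        + ennreal (1/2) * ennreal ((norm (g \<eta>))\<^sup>2) * (\<kappa> \<eta> \<xi> * indicator S \<xi>)"
    proof (cases "\<xi> \<in> S \<and> \<eta> \<in> S")
      case True
      have amgm: "norm (g \<xi>) * norm (g \<eta>) \<le> (1/2) * (norm (g \<xi>))\<^sup>2 + (1/2) * (norm (g \<eta>))\<^sup>2"
        using sum_squares_bound[of "norm (g \<xi>)" "norm (g \<eta>)"] by (simp add: field_simps)
      have "ennreal (norm (g \<xi> * cnj (g \<eta>) * ker \<xi> \<eta>)) = ennreal (norm (g \<xi>) * norm (g \<eta>)) * ennreal (norm (ker \<xi> \<eta>))"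
        by (simp add: norm_mult ennreal_mult)
      also have "\<dots> \<le> (ennreal (1/2) * ennreal ((norm (g \<xi>))\<^sup>2) + ennreal (1/2) * ennreal ((norm (g \<eta>))\<^sup>2)) * \<kappa> \<xi> \<eta>"
      proof (intro mult_mono ker_le)
        show "ennreal (norm (g \<xi>) * norm (g \<eta>)) \<le> ennreal (1/2) * ennreal ((norm (g \<xi>))\<^sup>2) + ennreal (1/2) * ennreal ((norm (g \<eta>))\<^sup>2)"
          using ennreal_leI[OF amgm]
          by (simp add: ennreal_mult[symmetric] ennreal_plus[symmetric] del: ennreal_half ennreal_plus)
      qed (use True in auto)
      finally show ?thesis
        using True by (simp add: sym[of \<eta> \<xi>] distrib_right)
    next
      case False
      then have "g \<xi> * cnj (g \<eta>) = 0" using supp by auto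
      then show ?thesis by (simp only: mult_zero_left norm_zero) simp
    qed
  qed
  also have "\<dots> = (\<integral>\<^sup>+ \<xi>. \<integral>\<^sup>+ \<eta>. (ennreal (1/2) * ennreal ((norm (g \<xi>))\<^sup>2)) * (\<kappa> \<xi> \<eta> * indicator S \<eta>) \<partial>N \<partial>N)
      + (\<integral>\<^sup>+ \<xi>. \<integral>\<^sup>+ \<eta>. ennreal (1/2) * ennreal ((norm (g \<eta>))\<^sup>2) * (\<kappa> \<eta> \<xi> * indicator S \<xi>) \<partial>N \<partial>N)"
    (is "_ = ?I1 + ?I2")
  proof -
    have "?L = (\<integral>\<^sup>+ \<xi>. (\<integral>\<^sup>+ \<eta>. (ennreal (1/2) * ennreal ((norm (g \<xi>))\<^sup>2)) * (\<kappa> \<xi> \<eta> * indicator S \<eta>) \<partial>N) + (\<integral>\<^sup>+ \<eta>. ennreal (1/2) * ennreal ((norm (g \<eta>))\<^sup>2) * (\<kappa> \<eta> \<xi> * indicator S \<xi>) \<partial>N) \<partial>N)"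
      by (intro nn_integral_cong nn_integral_add) measurable
    also have "\<dots> = ?I1 + ?I2"
      by (rule nn_integral_add) measurable
    finally show ?thesis .
  qed
  \<comment> \<open>Exchanging the two variables turns the second half into the first.\<close>
  also have "(\<integral>\<^sup>+ \<xi>. \<integral>\<^sup>+ \<eta>. ennreal (1/2) * ennreal ((norm (g \<eta>))\<^sup>2) * (\<kappa> \<eta> \<xi> * indicator S \<xi>) \<partial>N \<partial>N)
     = (\<integral>\<^sup>+ \<xi>. \<integral>\<^sup>+ \<eta>. (ennreal (1/2) * ennreal ((norm (g \<xi>))\<^sup>2)) * (\<kappa> \<xi> \<eta> * indicator S \<eta>) \<partial>N \<partial>N)"
    by (rule NN.Fubini') measurable
  also have "(\<integral>\<^sup>+ \<xi>. \<integral>\<^sup>+ \<eta>. (ennreal (1/2) * ennreal ((norm (g \<xi>))\<^sup>2)) * (\<kappa> \<xi> \<eta> * indicator S \<eta>) \<partial>N \<partial>N)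
     \<le> (\<integral>\<^sup>+ \<xi>. (ennreal (1/2) * ennreal ((norm (g \<xi>))\<^sup>2)) * A \<partial>N)"
  proof (intro nn_integral_mono)
    fix \<xi> assume \<xi>: "\<xi> \<in> space N"
    have "(\<integral>\<^sup>+ \<eta>. (ennreal (1/2) * ennreal ((norm (g \<xi>))\<^sup>2)) * (\<kappa> \<xi> \<eta> * indicator S \<eta>) \<partial>N)
      = (ennreal (1/2) * ennreal ((norm (g \<xi>))\<^sup>2)) * (\<integral>\<^sup>+ \<eta>. \<kappa> \<xi> \<eta> * indicator S \<eta> \<partial>N)"
      using \<xi> by (intro nn_integral_cmult) measurable
    also have "\<dots> \<le> (ennreal (1/2) * ennreal ((norm (g \<xi>))\<^sup>2)) * A"
      using A[of \<xi>] supp[of \<xi>] by (cases "\<xi> \<in> S") (auto intro!: mult_left_mono)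
    finally show "(\<integral>\<^sup>+ \<eta>. (ennreal (1/2) * ennreal ((norm (g \<xi>))\<^sup>2)) * (\<kappa> \<xi> \<eta> * indicator S \<eta>) \<partial>N)
      \<le> (ennreal (1/2) * ennreal ((norm (g \<xi>))\<^sup>2)) * A" .
  qed
  also have "(\<integral>\<^sup>+ \<xi>. (ennreal (1/2) * ennreal ((norm (g \<xi>))\<^sup>2)) * A \<partial>N) = ennreal (1/2) * (A * (\<integral>\<^sup>+ \<xi>. ennreal ((norm (g \<xi>))\<^sup>2) \<partial>N))"
    by (subst nn_integral_multc; (subst nn_integral_cmult)?) (auto simp: mult_ac)
  finally have "(\<integral>\<^sup>+ x. ennreal ((norm (transf g x))\<^sup>2) \<partial>\<rho>) \<le>
    ennreal (1/2) * (A * (\<integral>\<^sup>+ \<xi>. ennreal ((norm (g \<xi>))\<^sup>2) \<partial>N)) + ennreal (1/2) * (A * (\<integral>\<^sup>+ \<xi>. ennreal ((norm (g \<xi>))\<^sup>2) \<partial>N))"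
    by (meson add_mono order_trans order_refl)
  moreover have "ennreal (1/2) + ennreal (1/2) = 1"
    by (subst ennreal_plus[symmetric]) auto
  ultimately show ?thesis
    by (simp only: distrib_right[symmetric] mult_1)
qed

end

subsection \<open>The Fejer kernel\<close>

text \<open>An antiderivative is \<open>Si x - (1 - cos x) / x\<close>, which is 0 at 0 and tends to
  \<open>pi / 2\<close> at infinity; the integrand is even.\<close>

lemma has_bochner_integral_one_minus_cos:
  "has_bochner_integral lborel (\<lambda>x::real. (1 - cos x) / x\<^sup>2) pi"
proof -
  \<comment> \<open>The removable singularity is filled in; division by zero would put the value 0
    there, which is not the derivative.\<close>
  define f :: "real \<Rightarrow> real" where "f = (\<lambda>x. if x = 0 then 1/2 else (1 - cos x) / x\<^sup>2)"
  have [measurable]: "f \<in> borel_measurable borel" unfolding f_def by measurable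
  have f_nonneg: "0 \<le> f x" for x unfolding f_def by auto
  have D: "((\<lambda>x. Si x - (1 - cos x) / x) has_real_derivative f x) (at x)" for x
  proof (cases "x = 0")
    case False
    then have "((\<lambda>x. Si x - (1 - cos x) / x) has_real_derivative sin x / x - (sin x * x - (1 - cos x) * 1) / (x * x)) (at x)"
      using DERIV_Si[of x] by (intro derivative_eq_intros) (auto intro!: derivative_eq_intros)
    also have "sin x / x - (sin x * x - (1 - cos x) * 1) / (x * x) = f x"
      using False by (simp add: f_def field_simps power2_eq_square)
    finally show ?thesis .
  next
    case True
    \<comment> \<open>At 0 the quotient \<open>(1 - cos x) / x\<close> is 0 by convention, so this
      is its difference quotient.\<close>
    have "((\<lambda>h::real. (1 - cos h) / h / h) \<longlongrightarrow> 1/2) (at 0)"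
      by real_asymp
    then have "((\<lambda>x. (1 - cos x) / x) has_real_derivative 1/2) (at 0)"
      by (simp add: DERIV_def)
    then have "((\<lambda>x. Si x - (1 - cos x) / x) has_real_derivative 1 - 1/2) (at 0)"
      using DERIV_Si[of 0] by (intro derivative_intros) auto
    then show ?thesis using True by (simp add: f_def)
  qed
  have "((\<lambda>x::real. (1 - cos x) / x) \<longlongrightarrow> 0) at_top"
  proof (rule tendsto_sandwich[of "\<lambda>_. 0" _ _ "\<lambda>x. 2 / x"])
    show "\<forall>\<^sub>F x in at_top. 0 \<le> (1 - cos x) / (x::real)"
      using eventually_gt_at_top[of 0] by eventually_elim auto
    show "\<forall>\<^sub>F x in at_top. (1 - cos x) / (x::real) \<le> 2 / x"
      using eventually_gt_at_top[of 0]
    proof eventually_elim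
      case (elim x)
      have "1 - cos x \<le> 2" using cos_ge_minus_one[of x] by linarith
      then show ?case using elim by (intro divide_right_mono) auto
    qed
  qed real_asymp+
  then have lim: "((\<lambda>x. Si x - (1 - cos x) / x) \<longlongrightarrow> pi / 2) at_top"
    using tendsto_diff[OF Si_at_top] by fastforce
  have "(\<integral>\<^sup>+x. ennreal (f x) * indicator {0 ..} x \<partial>lborel) = pi / 2 - (Si 0 - (1 - cos 0) / 0)"
    by (rule nn_integral_FTC_atLeast[OF _ D f_nonneg lim]) auto
  also have "Si 0 = 0" using Si_neg[of 0] by simp
  finally have "has_bochner_integral lborel (\<lambda>x. indicator {0..} x *\<^sub>R f x) (pi / 2)"
    by (intro has_bochner_integral_nn_integral)
      (auto simp: f_nonneg ennreal_mult ennreal_indicator mult.commute)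
  then have "has_bochner_integral lborel f (2 *\<^sub>R (pi / 2))"
    by (rule has_bochner_integral_even_function) (auto simp: f_def)
  moreover have "AE x in lborel. f x = (1 - cos x) / x\<^sup>2"
    using AE_lborel_singleton[of 0] by eventually_elim (auto simp: f_def)
  ultimately show ?thesis
    by (subst has_bochner_integral_cong_AE[symmetric, where f=f]) auto
qed

lemma has_bochner_integral_one_minus_cos_scaled:
  "has_bochner_integral lborel (\<lambda>x::real. (1 - cos (c * x)) / x\<^sup>2) (pi * \<bar>c\<bar>)"
proof (cases "c = 0")
  case False
  have scale: "has_bochner_integral lborel (\<lambda>x. f (0 + c * x)) (y /\<^sub>R \<bar>c\<bar>)"
    if "has_bochner_integral lborel f y" for f :: "real \<Rightarrow> real" and y
    using iffD1[OF lborel_has_bochner_integral_real_affine_iff[OF False, of f y 0] that] by simp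
  have "has_bochner_integral lborel (\<lambda>x. (1 - cos (0 + c * x)) / (0 + c * x)\<^sup>2) (pi /\<^sub>R \<bar>c\<bar>)"
    using scale[OF has_bochner_integral_one_minus_cos] by simp
  then have "has_bochner_integral lborel (\<lambda>x. c\<^sup>2 * ((1 - cos (0 + c * x)) / (0 + c * x)\<^sup>2)) (c\<^sup>2 * (pi /\<^sub>R \<bar>c\<bar>))"
    by (rule has_bochner_integral_mult_right)
  also have "c\<^sup>2 * (pi /\<^sub>R \<bar>c\<bar>) = pi * \<bar>c\<bar>"
    using False by (simp add: field_simps) (simp add: power2_eq_square abs_if)
  finally show ?thesis
    using False by (simp add: power_mult_distrib)
qed (auto simp: has_bochner_integral_zero)

lemma borel_measurable_cis[measurable]: "cis \<in> borel_measurable borel"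
  by (intro borel_measurable_continuous_onI continuous_intros)

text \<open>The squared sinc, equal to 1 at 0. The parameter \<open>e\<close> is an inverse width,
  so \<open>e \<rightarrow> 0\<close> removes the weight.\<close>

definition fejer :: "real \<Rightarrow> real \<Rightarrow> real" where
  "fejer e x = (if x = 0 then 1 else (sin (e * x / 2) / (e * x / 2))\<^sup>2)"

text \<open>The triangle of base \<open>[-e, e]\<close> and area 1; it is the Fourier transform of
  \<open>fejer e\<close> divided by \<open>2 * pi\<close>.\<close>

definition tri :: "real \<Rightarrow> real \<Rightarrow> real" where
  "tri e z = max 0 (1 - \<bar>z\<bar> / e) / e"

lemma borel_measurable_fejer[measurable]: "fejer e \<in> borel_measurable borel"
  unfolding fejer_def[abs_def] by measurable

lemma borel_measurable_tri[measurable]: "tri e \<in> borel_measurable borel"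
  unfolding tri_def[abs_def] by measurable

lemma fejer_nonneg: "0 \<le> fejer e x"
  by (simp add: fejer_def)

lemma fejer_minus: "fejer e (- x) = fejer e x"
  by (simp add: fejer_def power2_eq_square)

lemma fejer_le_1: "fejer e x \<le> 1"
  using abs_sin_x_le_abs_x[of "e * x / 2"]
  by (cases "e = 0") (auto simp: fejer_def abs_square_le_1 abs_mult)

lemma fejer_tendsto: "(\<lambda>e. fejer e x) \<midarrow>0\<rightarrow> 1"
proof (cases "x = 0")
  case False
  have "((\<lambda>e. (sin (e * x / 2) / (e * x / 2))\<^sup>2) \<longlongrightarrow> 1\<^sup>2) (at 0)"
    using False
    by (intro tendsto_power filterlim_compose[OF sinc_at_0])
      (auto intro!: tendsto_eq_intros simp: filterlim_at eventually_at_filter)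
  then show ?thesis using False by (simp add: fejer_def)
qed (simp add: fejer_def)

text \<open>The integrand is \<open>1 / e^2\<close> times the second difference in \<open>z\<close>,
  with step \<open>e\<close>, of \<open>(1 - cos (z * x)) / x^2\<close>. Its integral is therefore
  \<open>pi / e^2\<close> times the second difference of the absolute value of \<open>z\<close>, a
  triangle.\<close>

lemma has_bochner_integral_fejer_cos:
  assumes "e > 0"
  shows "has_bochner_integral lborel (\<lambda>x. fejer e x * cos (x * z)) (2 * pi * tri e z)"
proof -
  let ?f = "\<lambda>c x::real. (1 - cos (c * x)) / x\<^sup>2"
  have "has_bochner_integral lborel (\<lambda>x. 1 / e\<^sup>2 * (?f (z + e) x + ?f (z - e) x - 2 * ?f z x))
      (1 / e\<^sup>2 * (pi * \<bar>z + e\<bar> + pi * \<bar>z - e\<bar> - 2 * (pi * \<bar>z\<bar>)))"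
    by (intro has_bochner_integral_mult_right has_bochner_integral_diff has_bochner_integral_add
        has_bochner_integral_one_minus_cos_scaled)
  also have "1 / e\<^sup>2 * (pi * \<bar>z + e\<bar> + pi * \<bar>z - e\<bar> - 2 * (pi * \<bar>z\<bar>)) = 2 * pi * tri e z"
  proof -
    have "\<bar>z + e\<bar> + \<bar>z - e\<bar> - 2 * \<bar>z\<bar> = 2 * e * max 0 (1 - \<bar>z\<bar> / e)"
      using assms by (auto simp: max_def field_simps abs_if)
    then have "pi * (\<bar>z + e\<bar> + \<bar>z - e\<bar> - 2 * \<bar>z\<bar>) = pi * (2 * e * max 0 (1 - \<bar>z\<bar> / e))" by simp
    then show ?thesis using assms by (simp add: tri_def field_simps power2_eq_square)
  qed
  finally have *: "has_bochner_integral lborel (\<lambda>x. 1 / e\<^sup>2 * (?f (z + e) x + ?f (z - e) x - 2 * ?f z x)) (2 * pi * tri e z)" .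
  have eq: "1 / e\<^sup>2 * (?f (z + e) x + ?f (z - e) x - 2 * ?f z x) = fejer e x * cos (x * z)" if "x \<noteq> 0" for x
  proof -
    have s: "(sin (e * x / 2))\<^sup>2 = (1 - cos (e * x)) / 2"
      using cos_double_sin[of "e * x / 2"] by simp
    have c: "cos ((z + e) * x) + cos ((z - e) * x) = 2 * cos (z * x) * cos (e * x)"
      by (simp add: distrib_right left_diff_distrib cos_add cos_diff)
    have divide_quarter: "c / 2 / (q / 4) * d = c * 2 * d / q" for c d q :: real
      by (cases "q = 0") (auto simp: divide_simps)
    have "fejer e x = (1 - cos (e * x)) / 2 / (e\<^sup>2 * x\<^sup>2 / 4)"
      using that by (simp add: fejer_def power_divide s power_mult_distrib)
    then have "fejer e x * cos (x * z) = (1 - cos (e * x)) * 2 * cos (z * x) / (e\<^sup>2 * x\<^sup>2)"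
      using divide_quarter[of "1 - cos (e * x)" "e\<^sup>2 * x\<^sup>2" "cos (z * x)"] by (simp only: mult.commute[of x z])
    also have "\<dots> = (2 * cos (z * x) - (cos ((z + e) * x) + cos ((z - e) * x))) / (e\<^sup>2 * x\<^sup>2)"
      unfolding c by (simp add: algebra_simps)
    also have "\<dots> = 1 / e\<^sup>2 * (?f (z + e) x + ?f (z - e) x - 2 * ?f z x)"
      using assms that by (simp add: divide_simps)
    finally show ?thesis by simp
  qed
  have "AE x in lborel. 1 / e\<^sup>2 * (?f (z + e) x + ?f (z - e) x - 2 * ?f z x) = fejer e x * cos (x * z)"
    using AE_lborel_singleton[of 0] by eventually_elim (rule eq)
  with * show ?thesis
    by (subst has_bochner_integral_cong_AE[symmetric, rotated 2]) auto
qed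

lemma integrable_fejer: "e > 0 \<Longrightarrow> integrable lborel (fejer e)"
  using has_bochner_integral_fejer_cos[of e 0] by (auto simp: has_bochner_integral_iff)

lemma integral_fejer_cis:
  assumes "e > 0"
  shows "(LINT x|lborel. complex_of_real (fejer e x) * cis (x * z)) = complex_of_real (2 * pi * tri e z)"
proof (rule complex_eqI)
  have int: "integrable lborel (\<lambda>x. complex_of_real (fejer e x) * cis (x * z))"
    by (rule Bochner_Integration.integrable_bound[OF integrable_fejer[OF assms]])
      (auto simp: norm_mult)
  have "Re (LINT x|lborel. complex_of_real (fejer e x) * cis (x * z)) = (LINT x|lborel. fejer e x * cos (x * z))"
    by (subst Bochner_Integration.integral_Re[OF int, symmetric]) simp
  then show "Re (LINT x|lborel. complex_of_real (fejer e x) * cis (x * z)) = Re (complex_of_real (2 * pi * tri e z))"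
    using has_bochner_integral_fejer_cos[OF assms, of z] by (simp add: has_bochner_integral_iff)
  have "Im (LINT x|lborel. complex_of_real (fejer e x) * cis (x * z)) = (LINT x|lborel. fejer e x * sin (x * z))"
    by (subst Bochner_Integration.integral_Im[OF int, symmetric]) simp
  \<comment> \<open>Reflection in 0: the imaginary part equals its own negative.\<close>
  also have "\<dots> = (LINT x|lborel. - (fejer e x * sin (x * z)))"
    by (subst lborel_integral_real_affine[where c="-1" and t=0]) (auto simp: fejer_minus)
  finally have "Im (LINT x|lborel. complex_of_real (fejer e x) * cis (x * z)) = - Im (LINT x|lborel. complex_of_real (fejer e x) * cis (x * z))"
    using \<open>Im _ = (LINT x|lborel. fejer e x * sin (x * z))\<close> by simp
  then show "Im (LINT x|lborel. complex_of_real (fejer e x) * cis (x * z)) = Im (complex_of_real (2 * pi * tri e z))"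
    by simp
qed

lemma tri_nonneg: "e > 0 \<Longrightarrow> 0 \<le> tri e z"
  by (simp add: tri_def)

lemma tri_eq_0: "e > 0 \<Longrightarrow> e \<le> \<bar>z\<bar> \<Longrightarrow> tri e z = 0"
  by (simp add: tri_def max_def)

lemma tri_le: "e > 0 \<Longrightarrow> tri e z \<le> 1 / e"
  by (simp add: tri_def divide_right_mono)

lemma tri_minus: "tri e (- z) = tri e z"
  by (simp add: tri_def)

lemma nn_integral_tri:
  assumes e: "e > 0"
  shows "(\<integral>\<^sup>+ \<eta>. ennreal (tri e (\<xi> - \<eta>)) \<partial>lborel) = 1"
proof -
  have "(\<integral>\<^sup>+ \<eta>. ennreal (tri e (\<xi> - \<eta>)) \<partial>lborel) = (\<integral>\<^sup>+ \<eta>. ennreal (tri e \<eta>) \<partial>lborel)"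
    using nn_integral_real_affine[of "\<lambda>\<eta>. ennreal (tri e \<eta>)" "-1" \<xi>] by simp
  \<comment> \<open>Both intervals contain 0, where the sum counts twice, so the integrands agree
    only almost everywhere.\<close>
  also have "\<dots> = (\<integral>\<^sup>+ \<eta>. ennreal ((1 + \<eta> / e) / e) * indicator {-e..0} \<eta> + ennreal ((1 - \<eta> / e) / e) * indicator {0..e} \<eta> \<partial>lborel)"
  proof (rule nn_integral_cong_AE, use AE_lborel_singleton[of 0] in eventually_elim)
    fix \<eta> :: real assume "\<eta> \<noteq> 0"
    then show "ennreal (tri e \<eta>) = ennreal ((1 + \<eta> / e) / e) * indicator {-e..0} \<eta> + ennreal ((1 - \<eta> / e) / e) * indicator {0..e} \<eta>"
      using e by (auto simp: tri_def indicator_def max_def field_simps abs_if)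
  qed
  also have "\<dots> = (\<integral>\<^sup>+ \<eta>. ennreal ((1 + \<eta> / e) / e) * indicator {-e..0} \<eta> \<partial>lborel) + (\<integral>\<^sup>+ \<eta>. ennreal ((1 - \<eta> / e) / e) * indicator {0..e} \<eta> \<partial>lborel)"
    by (rule nn_integral_add) auto
  also have "(\<integral>\<^sup>+ \<eta>. ennreal ((1 + \<eta> / e) / e) * indicator {-e..0} \<eta> \<partial>lborel) = ennreal ((0 / e + 0\<^sup>2 / (2 * e\<^sup>2)) - ((-e) / e + (-e)\<^sup>2 / (2 * e\<^sup>2)))"
    using e by (intro nn_integral_FTC_Icc[where F="\<lambda>\<eta>. \<eta> / e + \<eta>\<^sup>2 / (2 * e\<^sup>2)"])
      (auto intro!: derivative_eq_intros simp: field_simps power2_eq_square)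
  also have "(\<integral>\<^sup>+ \<eta>. ennreal ((1 - \<eta> / e) / e) * indicator {0..e} \<eta> \<partial>lborel) = ennreal ((e / e - e\<^sup>2 / (2 * e\<^sup>2)) - (0 / e - 0\<^sup>2 / (2 * e\<^sup>2)))"
    using e by (intro nn_integral_FTC_Icc[where F="\<lambda>\<eta>. \<eta> / e - \<eta>\<^sup>2 / (2 * e\<^sup>2)"])
      (auto intro!: derivative_eq_intros simp: field_simps power2_eq_square)
  finally show ?thesis
    using e by (simp add: ennreal_plus[symmetric] del: ennreal_plus ennreal_half)
qed

lemma integral_period_cis:
  assumes "z \<in> \<int>"
  shows "(LINT x|lborel. indicator {0..2 * pi} x *\<^sub>R cis (x * z)) = (if z = 0 then complex_of_real (2 * pi) else 0)"
proof (cases "z = 0")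
  case False
  obtain k :: int where k: "z = of_int k" using assms by (auto elim: Ints_cases)
  have "has_bochner_integral lborel (\<lambda>x. indicator {0..2 * pi} x *\<^sub>R cis (x * z))
     (cis (2 * pi * z) / (\<i> * z) - cis (0 * z) / (\<i> * z))"
  proof (rule has_bochner_integral_FTC_Icc)
    show "((\<lambda>x. cis (x * z) / (\<i> * z)) has_vector_derivative cis (x * z)) (at x within {0..2 * pi})" for x
      unfolding has_vector_derivative_def
      using False by (auto intro!: derivative_eq_intros simp: scaleR_conv_of_real fun_eq_iff mult.left_commute)
  qed (auto intro!: continuous_intros)
  moreover have "cis (2 * pi * z) = 1"
    using cis_multiple_2pi[of z] assms by (simp add: mult_ac)
  ultimately show ?thesis using False
    by (simp add: has_bochner_integral_iff)
qed (simp add: scaleR_conv_of_real)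

subsection \<open>The frequency space\<close>

definition coord_measure :: "4 set \<Rightarrow> 4 \<Rightarrow> real measure" where
  "coord_measure J i = (if i \<in> J then distr (count_space UNIV) borel real_of_int else lborel)"

lemma sets_coord_measure[measurable_cong, simp]: "sets (coord_measure J i) = sets borel"
  by (simp add: coord_measure_def)

lemma space_coord_measure[simp]: "space (coord_measure J i) = UNIV"
  by (simp add: coord_measure_def)

lemma sigma_finite_coord_measure: "sigma_finite_measure (coord_measure J i)"
proof (cases "i \<in> J")
  case True
  have "\<exists>A::real set set. countable A \<and> A \<subseteq> sets (coord_measure J i) \<and> \<Union> A = space (coord_measure J i)
      \<and> (\<forall>a\<in>A. emeasure (coord_measure J i) a \<noteq> \<infinity>)"
  proof (intro exI conjI ballI)
    \<comment> \<open>The measure lives on the Borel sets of the line, so the non-integers, a null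
      set, have to be covered as well.\<close>
    let ?A = "insert (- \<int>) ((\<lambda>k::int. {real_of_int k}) ` UNIV)"
    show "countable ?A" by auto
    show "?A \<subseteq> sets (coord_measure J i)" by (auto simp: Compl_eq_Diff_UNIV)
    show "\<Union> ?A = space (coord_measure J i)" by (auto simp: Ints_def)
    fix a assume "a \<in> ?A"
    then consider "a = - \<int>" | k where "a = {real_of_int k}" by auto
    then show "emeasure (coord_measure J i) a \<noteq> \<infinity>"
    proof cases
      case 1
      have "real_of_int -` (- \<int>) \<inter> UNIV = {}" by auto
      then show ?thesis using True 1 by (simp add: coord_measure_def emeasure_distr Compl_eq_Diff_UNIV)
    next
      case 2
      have "real_of_int -` {real_of_int k} = {k}" by auto
      then show ?thesis using True 2 by (simp add: coord_measure_def emeasure_distr)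
    qed
  qed
  then show ?thesis by (rule sigma_finite_measure.intro)
qed (auto simp: coord_measure_def sigma_finite_lborel)

interpretation coord: product_sigma_finite "coord_measure J" for J
  by (rule product_sigma_finite.intro) (rule sigma_finite_coord_measure)

lemma freq_measure_eq: "freq_measure J = distr (PiM UNIV (coord_measure J)) borel vec_lambda"
  by (simp add: freq_measure_def coord_measure_def[abs_def])

lemma borel_measurable_vec_lambda:
  fixes f :: "'a \<Rightarrow> 4 \<Rightarrow> real"
  assumes "\<And>i. (\<lambda>x. f x i) \<in> borel_measurable M"
  shows "(\<lambda>x. \<chi> i. f x i) \<in> borel_measurable M"
proof (subst borel_measurable_euclidean_space, intro ballI)
  fix b :: "real^4" assume "b \<in> Basis"
  then obtain i where "b = axis i 1" by (auto simp: Basis_vec_def)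
  then show "(\<lambda>x. (\<chi> i. f x i) \<bullet> b) \<in> borel_measurable M"
    using assms[of i] by (simp add: inner_axis)
qed

lemma measurable_vec_lambda_borel[measurable]:
  "vec_lambda \<in> measurable (PiM UNIV (coord_measure J)) (borel :: (real^4) measure)"
  using borel_measurable_vec_lambda[of "\<lambda>f. f" "PiM UNIV (coord_measure J)"] by simp

lemma sets_freq_measure[measurable_cong, simp]: "sets (freq_measure J) = sets borel"
  by (simp add: freq_measure_def)

lemma space_freq_measure[simp]: "space (freq_measure J) = UNIV"
  by (simp add: freq_measure_def)

lemma nn_integral_freq_measure:
  "f \<in> borel_measurable borel \<Longrightarrow>
    (\<integral>\<^sup>+ \<xi>. f \<xi> \<partial>freq_measure J) = (\<integral>\<^sup>+ x. f (vec_lambda x) \<partial>PiM UNIV (coord_measure J))"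
  by (simp add: freq_measure_eq nn_integral_distr)

lemma nn_integral_freq_measure_prod:
  assumes [measurable]: "\<And>i. f i \<in> borel_measurable borel"
  shows "(\<integral>\<^sup>+ \<xi>. (\<Prod>i\<in>UNIV. f i (\<xi> $ i)) \<partial>freq_measure J) = (\<Prod>i\<in>UNIV. \<integral>\<^sup>+ x. f i x \<partial>coord_measure J i)"
  by (subst nn_integral_freq_measure) (auto intro!: coord.product_nn_integral_prod)

lemma emeasure_freq_measure_prod:
  assumes [measurable]: "\<And>i. A i \<in> sets borel"
  shows "emeasure (freq_measure J) {\<xi>. \<forall>i. \<xi> $ i \<in> A i} = (\<Prod>i\<in>UNIV. emeasure (coord_measure J i) (A i))"
proof -
  have "{\<xi>::real^4. \<forall>i. \<xi> $ i \<in> A i} = {\<xi> \<in> space borel. \<forall>i. \<xi> $ i \<in> A i}" by simp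
  also have "\<dots> \<in> sets borel" by measurable
  finally have "emeasure (freq_measure J) {\<xi>. \<forall>i. \<xi> $ i \<in> A i}
    = (\<integral>\<^sup>+ \<xi>. indicator {\<xi>. \<forall>i. \<xi> $ i \<in> A i} \<xi> \<partial>freq_measure J)"
    by (subst nn_integral_indicator) auto
  also have "\<dots> = (\<integral>\<^sup>+ \<xi>. (\<Prod>i\<in>UNIV. indicator (A i) (\<xi> $ i)) \<partial>freq_measure J)"
  proof (rule nn_integral_cong)
    fix \<xi> :: "real^4"
    show "(indicator {\<xi>. \<forall>i. \<xi> $ i \<in> A i} \<xi> :: ennreal) = (\<Prod>i\<in>UNIV. indicator (A i) (\<xi> $ i))"
      by (cases "\<forall>i. \<xi> $ i \<in> A i") (auto intro!: prod_zero[symmetric] simp: indicator_def)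
  qed
  also have "\<dots> = (\<Prod>i\<in>UNIV. emeasure (coord_measure J i) (A i))"
    by (subst nn_integral_freq_measure_prod) auto
  finally show ?thesis .
qed

text \<open>Transfers the product formulas for \<open>freq_measure\<close> to Lebesgue measure on
  \<open>real^4\<close>.\<close>

lemma freq_measure_empty: "freq_measure {} = lborel"
proof (rule lborel_eqI[symmetric])
  fix l u :: "real^4" assume lu: "\<And>b. b \<in> Basis \<Longrightarrow> l \<bullet> b \<le> u \<bullet> b"
  have lu': "l $ i \<le> u $ i" for i
    using lu[of "axis i 1"] by (simp add: inner_axis)
  have "box l u = {\<xi>. \<forall>i. \<xi> $ i \<in> {l $ i<..<u $ i}}"
    by (auto simp: mem_box_cart)
  then have "emeasure (freq_measure {}) (box l u) = (\<Prod>i\<in>UNIV. ennreal (u $ i - l $ i))"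
    by (simp only:) (subst emeasure_freq_measure_prod, auto simp: coord_measure_def lu')
  also have "\<dots> = ennreal (\<Prod>i\<in>UNIV. u $ i - l $ i)"
    by (rule prod_ennreal) (simp add: lu')
  also have "(\<Prod>i\<in>UNIV. u $ i - l $ i) = (\<Prod>b\<in>Basis. (u - l) \<bullet> b)"
    unfolding Basis_vec_def
    by (simp add: prod.UNION_disjoint inner_axis axis_eq_axis)
  finally show "emeasure (freq_measure {}) (box l u) = ennreal (\<Prod>b\<in>Basis. (u - l) \<bullet> b)" .
qed (simp add: freq_measure_def)

lemma integral_lborel_prod:
  fixes f :: "4 \<Rightarrow> real \<Rightarrow> complex"
  assumes int: "\<And>i. integrable lborel (f i)"
  shows "(LINT x|(lborel :: (real^4) measure). (\<Prod>i\<in>UNIV. f i (x $ i))) = (\<Prod>i\<in>UNIV. LINT x|lborel. f i x)"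
proof -
  note [measurable] = borel_measurable_integrable[OF int]
  have "(LINT x|(lborel :: (real^4) measure). (\<Prod>i\<in>UNIV. f i (x $ i)))
    = (LINT x|PiM UNIV (coord_measure {}). (\<Prod>i\<in>UNIV. f i (x i)))"
    by (subst freq_measure_empty[symmetric], subst freq_measure_eq, subst integral_distr) auto
  also have "\<dots> = (\<Prod>i\<in>UNIV. LINT x|coord_measure {} i. f i x)"
    by (rule coord.product_integral_prod) (auto simp: coord_measure_def int)
  finally show ?thesis by (simp add: coord_measure_def)
qed

lemma integrable_lborel_prod:
  fixes f :: "4 \<Rightarrow> real \<Rightarrow> complex"
  assumes int: "\<And>i. integrable lborel (f i)"
  shows "integrable (lborel :: (real^4) measure) (\<lambda>x. \<Prod>i\<in>UNIV. f i (x $ i))"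
proof -
  note [measurable] = borel_measurable_integrable[OF int]
  have "integrable (PiM UNIV (coord_measure {})) (\<lambda>x. \<Prod>i\<in>UNIV. f i (x i))"
    by (rule coord.product_integrable_prod) (auto simp: coord_measure_def int)
  then show ?thesis
    by (subst freq_measure_empty[symmetric], subst freq_measure_eq, subst integrable_distr_eq) auto
qed

lemma UNIV_4_distinct:
  fixes i j k l :: 4
  assumes "distinct [i, j, k, l]"
  shows "UNIV = {i, j, k, l}"
proof -
  have "card {i, j, k, l} = card (UNIV :: 4 set)" using assms by simp
  then show ?thesis by (metis card_subset_eq finite subset_UNIV)
qed

text \<open>The order of the coordinates is left free: the normal of the slab decides which one is
  solved for, and the planar argument needs the two real ones innermost.\<close>

lemma nn_integral_freq_measure_iterated:
  fixes i j k l :: 4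
  assumes [measurable]: "f \<in> borel_measurable borel"
    and distinct: "distinct [i, j, k, l]"
  shows "(\<integral>\<^sup>+ \<xi>. f \<xi> \<partial>freq_measure J) =
    (\<integral>\<^sup>+ a. \<integral>\<^sup>+ b. \<integral>\<^sup>+ c. \<integral>\<^sup>+ d. f (\<chi> m. if m = i then a else if m = j then b else if m = k then c else d)
      \<partial>coord_measure J l \<partial>coord_measure J k \<partial>coord_measure J j \<partial>coord_measure J i)"
proof -
  note U = UNIV_4_distinct[OF distinct]
  have upd: "vec_lambda (z(l := d, k := c, j := b, i := a))
    = (\<chi> m. if m = i then a else if m = j then b else if m = k then c else d)" for a b c d and z :: "4 \<Rightarrow> real"
  proof (subst vec_lambda_inject[OF UNIV_I UNIV_I], rule ext)
    fix m :: 4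
    have "m = i \<or> m = j \<or> m = k \<or> m = l" using U by blast
    then show "(z(l := d, k := c, j := b, i := a)) m = (if m = i then a else if m = j then b else if m = k then c else d)" by auto
  qed
  \<comment> \<open>Peeling off one coordinate at a time requires measurability of every
    section.\<close>
  have M4: "(\<lambda>x. f (vec_lambda x)) \<in> borel_measurable (PiM {i, j, k, l} (coord_measure J))"
    unfolding U[symmetric] by measurable
  have ext: "(\<lambda>x::4 \<Rightarrow> real. x(i := a)) \<in> measurable (PiM {j, k, l} (coord_measure J)) (PiM {i, j, k, l} (coord_measure J))" for a
    by (rule measurable_fun_upd[where J="{j, k, l}"]) auto
  have M3: "(\<lambda>x. f (vec_lambda (x(i := a)))) \<in> borel_measurable (PiM {j, k, l} (coord_measure J))" for a
    using measurable_compose[OF ext M4] .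
  have ext: "(\<lambda>x::4 \<Rightarrow> real. x(j := a)) \<in> measurable (PiM {k, l} (coord_measure J)) (PiM {j, k, l} (coord_measure J))" for a
    by (rule measurable_fun_upd[where J="{k, l}"]) auto
  have M2: "(\<lambda>x. f (vec_lambda (x(j := b, i := a)))) \<in> borel_measurable (PiM {k, l} (coord_measure J))" for a b
    using measurable_compose[OF ext M3] .
  have ext: "(\<lambda>x::4 \<Rightarrow> real. x(k := a)) \<in> measurable (PiM {l} (coord_measure J)) (PiM {k, l} (coord_measure J))" for a
    by (rule measurable_fun_upd[where J="{l}"]) auto
  have M1: "(\<lambda>x. f (vec_lambda (x(k := c, j := b, i := a)))) \<in> borel_measurable (PiM {l} (coord_measure J))" for a b c
    using measurable_compose[OF ext M2] .
  have ext: "(\<lambda>x::4 \<Rightarrow> real. x(l := a)) \<in> measurable (PiM {} (coord_measure J)) (PiM {l} (coord_measure J))" for a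
    by (rule measurable_fun_upd[where J="{}"]) auto
  have M0: "(\<lambda>x. f (vec_lambda (x(l := d, k := c, j := b, i := a)))) \<in> borel_measurable (PiM {} (coord_measure J))" for a b c d
    using measurable_compose[OF ext M1] .
  have "(\<integral>\<^sup>+ \<xi>. f \<xi> \<partial>freq_measure J) = (\<integral>\<^sup>+ x. f (vec_lambda x) \<partial>PiM {i, j, k, l} (coord_measure J))"
    by (simp add: nn_integral_freq_measure U)
  also have "\<dots> = (\<integral>\<^sup>+ a. \<integral>\<^sup>+ x. f (vec_lambda (x(i := a))) \<partial>PiM {j, k, l} (coord_measure J) \<partial>coord_measure J i)"
    using distinct by (intro coord.product_nn_integral_insert_rev M4) auto
  also have "\<dots> = (\<integral>\<^sup>+ a. \<integral>\<^sup>+ b. \<integral>\<^sup>+ x. f (vec_lambda (x(j := b, i := a))) \<partial>PiM {k, l} (coord_measure J)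
      \<partial>coord_measure J j \<partial>coord_measure J i)"
    using distinct by (intro nn_integral_cong coord.product_nn_integral_insert_rev M3) auto
  also have "\<dots> = (\<integral>\<^sup>+ a. \<integral>\<^sup>+ b. \<integral>\<^sup>+ c. \<integral>\<^sup>+ x. f (vec_lambda (x(k := c, j := b, i := a))) \<partial>PiM {l} (coord_measure J)
      \<partial>coord_measure J k \<partial>coord_measure J j \<partial>coord_measure J i)"
    using distinct by (intro nn_integral_cong coord.product_nn_integral_insert_rev M2) auto
  also have "\<dots> = (\<integral>\<^sup>+ a. \<integral>\<^sup>+ b. \<integral>\<^sup>+ c. \<integral>\<^sup>+ d. \<integral>\<^sup>+ x. f (vec_lambda (x(l := d, k := c, j := b, i := a))) \<partial>PiM {} (coord_measure J)
      \<partial>coord_measure J l \<partial>coord_measure J k \<partial>coord_measure J j \<partial>coord_measure J i)"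
    using distinct by (intro nn_integral_cong coord.product_nn_integral_insert_rev M1) auto
  also have "\<dots> = (\<integral>\<^sup>+ a. \<integral>\<^sup>+ b. \<integral>\<^sup>+ c. \<integral>\<^sup>+ d. f (vec_lambda ((\<lambda>_. undefined)(l := d, k := c, j := b, i := a)))
      \<partial>coord_measure J l \<partial>coord_measure J k \<partial>coord_measure J j \<partial>coord_measure J i)"
    by (intro nn_integral_cong coord.nn_integral_empty) auto
  finally show ?thesis
    by (simp only: upd)
qed

text \<open>The summand 1 is the cost of counting integers; with it one bound serves real and
  integer coordinates.\<close>

lemma emeasure_coord_measure_interval:
  assumes "a \<le> b"
  shows "emeasure (coord_measure J i) {a..b} \<le> ennreal (b - a + 1)"
proof (cases "i \<in> J")
  case True
  have "real_of_int -` {a..b} = {\<lceil>a\<rceil>..\<lfloor>b\<rfloor>}"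
    by (auto simp: ceiling_le_iff le_floor_iff)
  then have "emeasure (coord_measure J i) {a..b} = of_nat (nat (\<lfloor>b\<rfloor> - \<lceil>a\<rceil> + 1))"
    using True by (simp add: coord_measure_def emeasure_distr)
  also have "\<dots> = ennreal (real (nat (\<lfloor>b\<rfloor> - \<lceil>a\<rceil> + 1)))"
    by (simp add: ennreal_of_nat_eq_real_of_nat)
  also have "\<dots> \<le> ennreal (b - a + 1)"
    using assms by (intro ennreal_leI) linarith
  finally show ?thesis .
qed (use assms in \<open>auto simp: coord_measure_def intro!: ennreal_leI\<close>)

definition freq_cube :: "real \<Rightarrow> (real^4) set" where
  "freq_cube k = {\<xi>. \<forall>i. \<bar>\<xi> $ i\<bar> \<le> k}"

lemma freq_cube_sets[measurable]: "freq_cube k \<in> sets borel"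
proof -
  have "freq_cube k = {\<xi> \<in> space borel. \<forall>i. \<bar>\<xi> $ i\<bar> \<le> k}" by (simp add: freq_cube_def)
  then show ?thesis by simp
qed

lemma emeasure_freq_cube: "emeasure (freq_measure J) (freq_cube k) < \<infinity>"
proof -
  have "freq_cube k = {\<xi>. \<forall>i. \<xi> $ i \<in> {-k..k}}"
    by (simp add: freq_cube_def set_eq_iff abs_le_iff conj_commute minus_le_iff)
  then have "emeasure (freq_measure J) (freq_cube k) = (\<Prod>i\<in>UNIV. emeasure (coord_measure J i) {-k..k})"
    by (simp only:) (subst emeasure_freq_measure_prod, auto)
  also have "\<dots> < \<infinity>"
  proof -
    have "emeasure (coord_measure J i) {-k..k} < \<infinity>" for i
    proof -
      have "emeasure (coord_measure J i) {-k..k} \<le> emeasure (coord_measure J i) {-\<bar>k\<bar>..\<bar>k\<bar>}"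
        by (rule emeasure_mono) auto
      also have "\<dots> \<le> ennreal (\<bar>k\<bar> - - \<bar>k\<bar> + 1)" by (rule emeasure_coord_measure_interval) simp
      finally show ?thesis by (rule order.strict_trans1) simp
    qed
    then show ?thesis by (auto simp: less_top[symmetric] ennreal_prod_eq_top)
  qed
  finally show ?thesis .
qed

lemma UN_freq_cube: "(\<Union>k::nat. freq_cube (real k)) = UNIV"
proof (intro equalityI subsetI UNIV_I)
  fix \<xi> :: "real^4"
  obtain k :: nat where "norm \<xi> \<le> real k" using real_arch_simple by blast
  then have "\<bar>\<xi> $ i\<bar> \<le> real k" for i
    using component_le_norm_cart[of \<xi> i] by linarith
  then show "\<xi> \<in> (\<Union>k::nat. freq_cube (real k))" by (auto simp: freq_cube_def)
qed

lemma sigma_finite_freq_measure: "sigma_finite_measure (freq_measure J)"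
proof (rule sigma_finite_measure.intro, intro exI conjI ballI)
  show "countable (range (\<lambda>k::nat. freq_cube (real k)))" by simp
  show "range (\<lambda>k::nat. freq_cube (real k)) \<subseteq> sets (freq_measure J)" by auto
  show "\<Union> (range (\<lambda>k::nat. freq_cube (real k))) = space (freq_measure J)"
    by (simp add: UN_freq_cube)
  show "emeasure (freq_measure J) a \<noteq> \<infinity>" if "a \<in> range (\<lambda>k::nat. freq_cube (real k))" for a
    using that emeasure_freq_cube by (auto simp: less_top)
qed

lemma sets_Collect_not_Ints: "{\<xi>::real^4. \<xi> $ i \<notin> \<int>} \<in> sets borel"
proof -
  have "{\<xi>::real^4. \<xi> $ i \<notin> \<int>} = (\<lambda>\<xi>. \<xi> $ i) -` (- \<int>) \<inter> space borel" by auto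
  also have "\<dots> \<in> sets borel" by (intro measurable_sets[of _ borel borel]) auto
  finally show ?thesis .
qed

lemma freq_space_sets[measurable]: "freq_space J \<in> sets borel"
proof -
  have "freq_space J = space borel - (\<Union>i\<in>J. {\<xi>. \<xi> $ i \<notin> \<int>})" by (auto simp: freq_space_def)
  also have "\<dots> \<in> sets borel"
    by (intro sets.Diff sets.top sets.finite_UN sets_Collect_not_Ints) auto
  finally show ?thesis .
qed

lemma AE_freq_space: "AE \<xi> in freq_measure J. \<xi> \<in> freq_space J"
proof -
  have "AE \<xi> in freq_measure J. \<xi> $ i \<in> \<int>" if "i \<in> J" for i
  proof -
    have "{\<xi>::real^4. \<xi> $ i \<notin> \<int>} = {\<xi>. \<forall>j. \<xi> $ j \<in> (if j = i then - \<int> else UNIV)}"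
      by auto
    then have "emeasure (freq_measure J) {\<xi>. \<xi> $ i \<notin> \<int>}
      = (\<Prod>j\<in>UNIV. emeasure (coord_measure J j) (if j = i then - \<int> else UNIV))"
      by (simp only:) (subst emeasure_freq_measure_prod, auto)
    also have "\<dots> = 0"
    proof (rule prod_zero)
      have "real_of_int -` (- \<int>) = {}" by auto
      then show "\<exists>j\<in>UNIV. emeasure (coord_measure J j) (if j = i then - \<int> else UNIV) = 0"
        using that by (intro bexI[of _ i]) (auto simp: coord_measure_def emeasure_distr Compl_eq_Diff_UNIV)
    qed simp
    finally show ?thesis
      by (intro AE_I[of _ _ "{\<xi>. \<xi> $ i \<notin> \<int>}"]) (auto simp: sets_Collect_not_Ints)
  qed
  then have "AE \<xi> in freq_measure J. \<forall>i\<in>J. \<xi> $ i \<in> \<int>"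
    by (intro AE_finite_allI) auto
  then show ?thesis by (simp add: freq_space_def)
qed

subsection \<open>Frequencies in a shell and a slab\<close>

lemma emeasure_coord_measure_ball:
  assumes "0 \<le> w"
  shows "emeasure (coord_measure J i) {x. \<bar>x - c\<bar> \<le> w} \<le> ennreal (2 * w + 1)"
proof -
  have "{x. \<bar>x - c\<bar> \<le> w} = {c - w..c + w}" by auto
  then show ?thesis using emeasure_coord_measure_interval[of "c - w" "c + w" J i] assms by simp
qed

text \<open>The set lies in two intervals of length
  \<open>sqrt q - sqrt p \<le> sqrt (q - p) \<le> sqrt (2 * D)\<close>. No distance from the
  critical point enters, so \<open>C\<close> may be arbitrary.\<close>

lemma emeasure_coord_measure_quadratic:
  assumes A: "1 \<le> A" and D: "0 \<le> D"
  shows "emeasure (coord_measure J i) {s. \<bar>A * (s - s0)\<^sup>2 + C\<bar> \<le> D} \<le> ennreal (2 * (sqrt (2 * D) + 1))"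
proof -
  \<comment> \<open>Bounds for \<open>(s - s0)^2\<close>; the lower one is cut off at 0 to admit a
    square root.\<close>
  define p where "p = max 0 ((- C - D) / A)"
  define q where "q = (- C + D) / A"
  show ?thesis
  proof (cases "p \<le> q")
    case False
    have "\<not> \<bar>A * (s - s0)\<^sup>2 + C\<bar> \<le> D" for s
    proof
      assume "\<bar>A * (s - s0)\<^sup>2 + C\<bar> \<le> D"
      moreover have "0 \<le> A * (s - s0)\<^sup>2" using A by simp
      ultimately have "0 \<le> - C + D" by linarith
      then have "0 \<le> q" using A by (simp add: q_def)
      moreover have "(- C - D) / A \<le> q" using A D by (simp add: q_def divide_right_mono)
      ultimately show False using False by (simp add: p_def)
    qed
    then show ?thesis by simp
  next
    case True
    have "0 \<le> p" by (simp add: p_def)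
    have "q - p \<le> 2 * D"
    proof -
      have "q - p \<le> (- C + D) / A - (- C - D) / A" by (simp add: p_def q_def)
      also have "\<dots> = 2 * D / A" by (simp add: diff_divide_distrib[symmetric])
      also have "\<dots> \<le> 2 * D / 1" using A D by (intro divide_left_mono) auto
      finally show ?thesis by simp
    qed
    moreover have "sqrt q \<le> sqrt p + sqrt (q - p)"
      using sqrt_add_le_add_sqrt[of p "q - p"] \<open>0 \<le> p\<close> True by simp
    ultimately have len: "sqrt q - sqrt p \<le> sqrt (2 * D)"
      by (smt (verit) real_sqrt_le_mono)
    have sub: "{s. \<bar>A * (s - s0)\<^sup>2 + C\<bar> \<le> D} \<subseteq> {s0 + sqrt p..s0 + sqrt q} \<union> {s0 - sqrt q..s0 - sqrt p}"
    proof
      fix s assume "s \<in> {s. \<bar>A * (s - s0)\<^sup>2 + C\<bar> \<le> D}"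
      then have "A * (s - s0)\<^sup>2 \<le> - C + D" "- C - D \<le> A * (s - s0)\<^sup>2" by auto
      then have "(s - s0)\<^sup>2 \<le> q" "p \<le> (s - s0)\<^sup>2"
        using A by (auto simp: p_def q_def field_simps)
      then have "\<bar>s - s0\<bar> \<le> sqrt q" "sqrt p \<le> \<bar>s - s0\<bar>"
        by (metis real_sqrt_abs real_sqrt_le_mono)+
      then show "s \<in> {s0 + sqrt p..s0 + sqrt q} \<union> {s0 - sqrt q..s0 - sqrt p}"
        by (auto simp: abs_if split: if_splits)
    qed
    have "emeasure (coord_measure J i) {s. \<bar>A * (s - s0)\<^sup>2 + C\<bar> \<le> D}
       \<le> emeasure (coord_measure J i) ({s0 + sqrt p..s0 + sqrt q} \<union> {s0 - sqrt q..s0 - sqrt p})"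
      by (intro emeasure_mono sub) simp
    also have "\<dots> \<le> emeasure (coord_measure J i) {s0 + sqrt p..s0 + sqrt q} + emeasure (coord_measure J i) {s0 - sqrt q..s0 - sqrt p}"
      by (intro emeasure_subadditive) auto
    also have "\<dots> \<le> ennreal (sqrt (2 * D) + 1) + ennreal (sqrt (2 * D) + 1)"
    proof (intro add_mono)
      have "sqrt p \<le> sqrt q" using True by simp
      show "emeasure (coord_measure J i) {s0 + sqrt p..s0 + sqrt q} \<le> ennreal (sqrt (2 * D) + 1)"
        by (rule order_trans[OF emeasure_coord_measure_interval ennreal_leI])
          (use len \<open>sqrt p \<le> sqrt q\<close> in auto)
      show "emeasure (coord_measure J i) {s0 - sqrt q..s0 - sqrt p} \<le> ennreal (sqrt (2 * D) + 1)"
        by (rule order_trans[OF emeasure_coord_measure_interval ennreal_leI])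
          (use len \<open>sqrt p \<le> sqrt q\<close> in auto)
    qed
    also have "\<dots> = ennreal (2 * (sqrt (2 * D) + 1))"
      using D by (subst ennreal_plus[symmetric]) auto
    finally show ?thesis .
  qed
qed

section \<open>Measure of a thick shell\<close>

lemma sum_4_distinct:
  fixes i j k l :: 4 and f :: "4 \<Rightarrow> real"
  assumes "distinct [i, j, k, l]"
  shows "sum f UNIV = f i + f j + f k + f l"
  unfolding UNIV_4_distinct[OF assms] using assms by simp

lemma norm_vec_squared: "(norm (x :: real^4))\<^sup>2 = (\<Sum>m\<in>UNIV. (x $ m)\<^sup>2)"
  unfolding power2_norm_eq_inner inner_vec_def by (simp add: power2_eq_square)

lemma nn_integral_indicator_const_mult:
  "(\<integral>\<^sup>+ x. indicator A c * f x \<partial>M) = (indicator A c :: ennreal) * (\<integral>\<^sup>+ x. f x \<partial>M)"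
  by (cases "c \<in> A") auto

text \<open>\<open>\<rho>\<close> stands for a squared radius and may be negative. Cube, slab and
  sphere share the centre, so dilating coordinates about \<open>\<sigma>\<close> changes each
  condition in a controlled way.\<close>

definition shell :: "real^4 \<Rightarrow> real^4 \<Rightarrow> real \<Rightarrow> real \<Rightarrow> real \<Rightarrow> real \<Rightarrow> (real^4) set" where
  "shell \<sigma> a \<rho> \<Lambda> w D = {\<xi>. (\<forall>m. \<bar>\<xi> $ m - \<sigma> $ m\<bar> \<le> \<Lambda>) \<and> \<bar>a \<bullet> (\<xi> - \<sigma>)\<bar> \<le> w \<and> \<bar>(norm (\<xi> - \<sigma>))\<^sup>2 - \<rho>\<bar> \<le> D}"

lemma shell_sets[measurable]: "shell \<sigma> a \<rho> \<Lambda> w D \<in> sets borel"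
proof -
  have "shell \<sigma> a \<rho> \<Lambda> w D = {\<xi> \<in> space borel. (\<forall>m. \<bar>\<xi> $ m - \<sigma> $ m\<bar> \<le> \<Lambda>) \<and> \<bar>a \<bullet> (\<xi> - \<sigma>)\<bar> \<le> w \<and> \<bar>(norm (\<xi> - \<sigma>))\<^sup>2 - \<rho>\<bar> \<le> D}"
    by (simp add: shell_def)
  also have "\<dots> \<in> sets borel" by measurable
  finally show ?thesis .
qed

text \<open>
  The slab determines the coordinate \<open>i\<close> up to \<open>O(w)\<close> from the others. Substituting this into the
  equation of the shell leaves a quadratic condition on any other coordinate \<open>j\<close>, with leading
  coefficient at least 1.
\<close>

lemma emeasure_thick_shell:
  assumes ai: "1/2 \<le> \<bar>a $ i\<bar>" and "0 \<le> w" "0 \<le> D" "0 \<le> \<Lambda>"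
  shows "emeasure (freq_measure J) (shell \<sigma> a \<rho> \<Lambda> w D)
    \<le> ennreal ((2 * \<Lambda> + 1)\<^sup>2 * (4 * w + 1) * (2 * (sqrt (2 * (D + 4 * w * (\<Lambda> + w))) + 1)))"
proof -
  \<comment> \<open>\<open>i\<close> is solved for through the slab and \<open>j\<close> through the
    sphere; \<open>k\<close> and \<open>l\<close> stay free in the cube.\<close>
  obtain j k l :: 4 where dist: "distinct [k, l, j, i]"
  proof -
    have "card (UNIV - {i}) = 3" by (simp add: card_Diff_singleton)
    then obtain j k l where "UNIV - {i} = {j, k, l}" "j \<noteq> k" "k \<noteq> l" "j \<noteq> l"
      unfolding card_3_iff by blast
    moreover from this have "j \<noteq> i" "k \<noteq> i" "l \<noteq> i" by blast+
    ultimately show ?thesis using that[of k l j] by simp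
  qed
  note sum4 = sum_4_distinct[OF dist]
  \<comment> \<open>Let \<open>- z\<close> be the value of \<open>y - \<sigma> $ i\<close> predicted
    by the slab. Since \<open>\<bar>a $ i\<bar> \<ge> 1/2\<close>, the prediction is off by at most
    \<open>2 * w\<close>, and replacing \<open>(y - \<sigma> $ i)^2\<close> by \<open>z^2\<close>
    costs at most \<open>2 * w * (2 * \<Lambda> + 2 * w)\<close>.\<close>
  define D' where "D' = D + 4 * w * (\<Lambda> + w)"
  have "0 \<le> D'" using assms by (simp add: D'_def)
  \<comment> \<open>\<open>A\<close> and \<open>B\<close> are the coefficients of
    \<open>(x - \<sigma> $ j)^2 + z^2\<close> as a quadratic in \<open>x - \<sigma> $ j\<close>;
    \<open>C\<close> collects what remains after completing the square.\<close>
  define A where "A = 1 + (a $ j / a $ i)\<^sup>2"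
  have "1 \<le> A" by (simp add: A_def)
  have ai0: "a $ i \<noteq> 0" using ai by auto
  define b where "b c d = a $ k * (c - \<sigma> $ k) + a $ l * (d - \<sigma> $ l)" for c d
  define B where "B c d = a $ j * b c d / (a $ i)\<^sup>2" for c d
  define C where "C c d = (c - \<sigma> $ k)\<^sup>2 + (d - \<sigma> $ l)\<^sup>2 - \<rho> + (b c d / a $ i)\<^sup>2 - A * (B c d / A)\<^sup>2" for c d
  define S where "S c d = {x. \<bar>A * (x - (\<sigma> $ j - B c d / A))\<^sup>2 + C c d\<bar> \<le> D'}" for c d
  define mm where "mm c d x = \<sigma> $ i - (a $ j * (x - \<sigma> $ j) + b c d) / a $ i" for c d x
  define I where "I m = {x. \<bar>x - \<sigma> $ m\<bar> \<le> \<Lambda>}" for m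
  let ?v = "\<lambda>c d x y. \<chi> m. if m = k then c else if m = l then d else if m = j then x else y"
  \<comment> \<open>A product bound arranged for iterated integration: first over \<open>y\<close>,
    then over \<open>x\<close>, then over the free coordinates.\<close>
  have key: "indicator (shell \<sigma> a \<rho> \<Lambda> w D) (?v c d x y)
    \<le> (indicator (I k) c * (indicator (I l) d * (indicator (S c d) x * indicator {y. \<bar>y - mm c d x\<bar> \<le> 2 * w} y)) :: ennreal)" for c d x y
  proof (cases "?v c d x y \<in> shell \<sigma> a \<rho> \<Lambda> w D")
    case True
    let ?k = "c - \<sigma> $ k" and ?l = "d - \<sigma> $ l" and ?j = "x - \<sigma> $ j" and ?i = "y - \<sigma> $ i"
    from True have box: "\<And>m. \<bar>?v c d x y $ m - \<sigma> $ m\<bar> \<le> \<Lambda>"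
      and slab: "\<bar>a \<bullet> (?v c d x y - \<sigma>)\<bar> \<le> w" and sph: "\<bar>(norm (?v c d x y - \<sigma>))\<^sup>2 - \<rho>\<bar> \<le> D"
      by (auto simp: shell_def)
    have comps: "?v c d x y $ k = c" "?v c d x y $ l = d" "?v c d x y $ j = x" "?v c d x y $ i = y"
      using dist by auto
    have bk: "\<bar>?k\<bar> \<le> \<Lambda>" and bl: "\<bar>?l\<bar> \<le> \<Lambda>" and bi: "\<bar>?i\<bar> \<le> \<Lambda>"
      using box[of k] box[of l] box[of i] unfolding comps by auto
    have slab': "\<bar>b c d + a $ j * ?j + a $ i * ?i\<bar> \<le> w"
      using slab by (simp only: inner_vec_def sum4 b_def comps vector_minus_component inner_real_def)
    have sph': "\<bar>?k\<^sup>2 + ?l\<^sup>2 + ?j\<^sup>2 + ?i\<^sup>2 - \<rho>\<bar> \<le> D"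
      using sph by (simp only: norm_vec_squared sum4 comps vector_minus_component)
    define z where "z = (a $ j * ?j + b c d) / a $ i"
    have az: "a $ i * (?i + z) = b c d + a $ j * ?j + a $ i * ?i"
    proof -
      have "a $ i * z = a $ j * ?j + b c d" using ai0 by (simp add: z_def)
      then show ?thesis by (simp add: distrib_left)
    qed
    have iz: "\<bar>?i + z\<bar> \<le> 2 * w"
    proof -
      have "1/2 * \<bar>?i + z\<bar> \<le> \<bar>a $ i\<bar> * \<bar>?i + z\<bar>" using ai by (intro mult_right_mono) auto
      also have "\<dots> \<le> w" using slab' unfolding az[symmetric] by (simp add: abs_mult)
      finally show ?thesis by simp
    qed
    have "\<bar>?i\<^sup>2 - z\<^sup>2\<bar> = \<bar>?i + z\<bar> * \<bar>?i - z\<bar>"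
      by (simp add: abs_mult[symmetric] power2_eq_square algebra_simps)
    also have "\<dots> \<le> (2 * w) * (2 * \<Lambda> + 2 * w)"
      using iz bi \<open>0 \<le> w\<close> by (intro mult_mono) auto
    also have "\<dots> = 4 * w * (\<Lambda> + w)" by (simp add: algebra_simps)
    finally have zz: "\<bar>?i\<^sup>2 - z\<^sup>2\<bar> \<le> 4 * w * (\<Lambda> + w)" .
    have "A \<noteq> 0" using \<open>1 \<le> A\<close> by simp
    have "A * (?j + B c d / A)\<^sup>2 = A * ?j\<^sup>2 + 2 * ?j * B c d + A * (B c d / A)\<^sup>2"
      using \<open>A \<noteq> 0\<close> by (simp add: power2_eq_square field_simps)
    then have "A * (?j + B c d / A)\<^sup>2 + C c d = ?k\<^sup>2 + ?l\<^sup>2 - \<rho> + (A * ?j\<^sup>2 + 2 * ?j * B c d + (b c d / a $ i)\<^sup>2)"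
      by (simp add: C_def)
    also have "A * ?j\<^sup>2 + 2 * ?j * B c d + (b c d / a $ i)\<^sup>2 = ?j\<^sup>2 + z\<^sup>2"
      using ai0 by (simp add: A_def B_def z_def power2_eq_square field_simps)
    finally have "\<bar>A * (?j + B c d / A)\<^sup>2 + C c d\<bar> \<le> D'"
      using zz sph' unfolding D'_def by linarith
    then have "x \<in> S c d" by (simp add: S_def algebra_simps)
    moreover have "\<bar>y - mm c d x\<bar> \<le> 2 * w" using iz by (simp add: mm_def z_def algebra_simps)
    ultimately show ?thesis using True bk bl by (simp add: I_def)
  qed simp
  have [measurable]: "S c d \<in> sets borel" for c d
  proof -
    have "S c d = {x \<in> space borel. \<bar>A * (x - (\<sigma> $ j - B c d / A))\<^sup>2 + C c d\<bar> \<le> D'}" by (simp add: S_def)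
    then show ?thesis by simp
  qed
  have [measurable]: "I m \<in> sets borel" for m
  proof -
    have "I m = {x \<in> space borel. \<bar>x - \<sigma> $ m\<bar> \<le> \<Lambda>}" by (simp add: I_def)
    then show ?thesis by simp
  qed
  have [measurable]: "{y. \<bar>y - c\<bar> \<le> 2 * w} \<in> sets borel" for c
  proof -
    have "{y. \<bar>y - c\<bar> \<le> 2 * w} = {y \<in> space borel. \<bar>y - c\<bar> \<le> 2 * w}" by simp
    then show ?thesis by simp
  qed
  let ?c1 = "ennreal (4 * w + 1)" and ?c2 = "ennreal (2 * (sqrt (2 * D') + 1))" and ?c3 = "ennreal (2 * \<Lambda> + 1)"
  have "emeasure (freq_measure J) (shell \<sigma> a \<rho> \<Lambda> w D) = (\<integral>\<^sup>+ \<xi>. indicator (shell \<sigma> a \<rho> \<Lambda> w D) \<xi> \<partial>freq_measure J)"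
    by simp
  also have "\<dots> = (\<integral>\<^sup>+ c. \<integral>\<^sup>+ d. \<integral>\<^sup>+ x. \<integral>\<^sup>+ y. indicator (shell \<sigma> a \<rho> \<Lambda> w D) (?v c d x y)
      \<partial>coord_measure J i \<partial>coord_measure J j \<partial>coord_measure J l \<partial>coord_measure J k)"
    by (rule nn_integral_freq_measure_iterated[OF _ dist]) measurable
  also have "\<dots> \<le> (\<integral>\<^sup>+ c. \<integral>\<^sup>+ d. \<integral>\<^sup>+ x. \<integral>\<^sup>+ y. (indicator (I k) c * (indicator (I l) d * (indicator (S c d) x * indicator {y. \<bar>y - mm c d x\<bar> \<le> 2 * w} y)))
      \<partial>coord_measure J i \<partial>coord_measure J j \<partial>coord_measure J l \<partial>coord_measure J k)"
    by (intro nn_integral_mono key)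
  also have "\<dots> = (\<integral>\<^sup>+ c. indicator (I k) c * (\<integral>\<^sup>+ d. indicator (I l) d * (\<integral>\<^sup>+ x. indicator (S c d) x * emeasure (coord_measure J i) {y. \<bar>y - mm c d x\<bar> \<le> 2 * w}
      \<partial>coord_measure J j) \<partial>coord_measure J l) \<partial>coord_measure J k)"
    by (simp add: nn_integral_indicator_const_mult nn_integral_cmult)
  also have "\<dots> \<le> (\<integral>\<^sup>+ c. indicator (I k) c * (\<integral>\<^sup>+ d. indicator (I l) d * (\<integral>\<^sup>+ x. indicator (S c d) x * ?c1
      \<partial>coord_measure J j) \<partial>coord_measure J l) \<partial>coord_measure J k)"
    using emeasure_coord_measure_ball[of "2 * w" J i] \<open>0 \<le> w\<close> by (intro nn_integral_mono mult_left_mono) auto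
  also have "\<dots> = (\<integral>\<^sup>+ c. indicator (I k) c * (\<integral>\<^sup>+ d. indicator (I l) d * (emeasure (coord_measure J j) (S c d) * ?c1)
      \<partial>coord_measure J l) \<partial>coord_measure J k)"
    by (simp add: nn_integral_multc)
  also have "\<dots> \<le> (\<integral>\<^sup>+ c. indicator (I k) c * (\<integral>\<^sup>+ d. indicator (I l) d * (?c2 * ?c1)
      \<partial>coord_measure J l) \<partial>coord_measure J k)"
    unfolding S_def using \<open>1 \<le> A\<close> \<open>0 \<le> D'\<close>
    by (intro nn_integral_mono mult_left_mono mult_right_mono emeasure_coord_measure_quadratic) auto
  also have "\<dots> = emeasure (coord_measure J k) (I k) * (emeasure (coord_measure J l) (I l) * (?c2 * ?c1))"
    by (simp add: nn_integral_multc)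
  also have "\<dots> \<le> ?c3 * (?c3 * (?c2 * ?c1))"
    unfolding I_def using \<open>0 \<le> \<Lambda>\<close>
    by (intro mult_mono emeasure_coord_measure_ball) auto
  also have "\<dots> = ennreal ((2 * \<Lambda> + 1)\<^sup>2 * (4 * w + 1) * (2 * (sqrt (2 * D') + 1)))"
    using assms \<open>0 \<le> D'\<close>
    by (simp add: ennreal_mult[symmetric] power2_eq_square mult_ac del: ennreal_plus)
  finally show ?thesis by (simp add: D'_def)
qed

section \<open>Dilations in the plane\<close>

text \<open>
  Each ray meets the annulus in a segment of relative length \<open>O(\<epsilon> / r)\<close>, so a point lies in \<open>s E\<close>
  only for a set of \<open>s\<close> of that measure.
\<close>

lemma emeasure_dilation_average:
  fixes E E' :: "(real \<times> real) set"
  assumes [measurable]: "E \<in> sets borel" "E' \<in> sets borel"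
    and E: "\<And>z. z \<in> E \<Longrightarrow> \<bar>(norm z)\<^sup>2 - r\<bar> \<le> \<epsilon>"
    and E': "\<And>z s. z \<in> E \<Longrightarrow> 1 \<le> s \<Longrightarrow> s \<le> 1 + h \<Longrightarrow> s *\<^sub>R z \<in> E'"
    and \<epsilon>: "0 < \<epsilon>" "2 * \<epsilon> \<le> r" and h: "0 < h" "h \<le> 1"
  shows "ennreal h * emeasure lborel E \<le> ennreal (8 * \<epsilon> / r) * emeasure lborel E'"
proof -
  \<comment> \<open>In the plane, dilation by \<open>s\<close> multiplies area by
    \<open>s^2 \<ge> 1\<close>.\<close>
  have scale: "emeasure lborel E \<le> (\<integral>\<^sup>+ z. indicator E ((1 / s) *\<^sub>R z) \<partial>lborel)" if s: "1 \<le> s" for s :: real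
  proof -
    have "(\<integral>\<^sup>+ z. indicator E ((1 / s) *\<^sub>R z) \<partial>lborel)
      = (\<integral>\<^sup>+ z. indicator E ((1 / s) *\<^sub>R z) \<partial>density (distr lborel borel (\<lambda>z::real \<times> real. 0 + s *\<^sub>R z)) (\<lambda>_. \<bar>s\<bar> ^ DIM(real \<times> real)))"
      using s by (subst lborel_affine[of s 0]) auto
    also have "\<dots> = (\<integral>\<^sup>+ z. ennreal (\<bar>s\<bar> ^ DIM(real \<times> real)) * indicator E ((1 / s) *\<^sub>R (0 + s *\<^sub>R z)) \<partial>lborel)"
      by (subst nn_integral_density) (auto simp: nn_integral_distr)
    also have "\<dots> = ennreal (s\<^sup>2) * emeasure lborel E"
      using s by (simp add: nn_integral_cmult power2_eq_square)
    also have "\<dots> \<ge> 1 * emeasure lborel E"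
      using s by (intro mult_right_mono) (auto simp: one_le_power)
    finally show ?thesis by simp
  qed
  have slice: "(\<integral>\<^sup>+ s. indicator {1..1 + h} s * indicator E ((1 / s) *\<^sub>R z) \<partial>lborel) \<le> ennreal (8 * \<epsilon> / r) * indicator E' z" for z
  proof (cases "\<exists>s. s \<in> {1..1 + h} \<and> (1 / s) *\<^sub>R z \<in> E")
    case False
    then have "(\<lambda>s. indicator {1..1 + h} s * indicator E ((1 / s) *\<^sub>R z)) = (\<lambda>_. 0 :: ennreal)"
      by (auto simp: indicator_def fun_eq_iff)
    then show ?thesis by simp
  next
    case True
    then obtain s where s: "1 \<le> s" "s \<le> 1 + h" "(1 / s) *\<^sub>R z \<in> E" by auto
    have zE': "z \<in> E'" using E'[OF s(3) s(1,2)] s(1) by simp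
    have bnds: "norm z / sqrt (r + \<epsilon>) \<le> s \<and> s \<le> norm z / sqrt (r - \<epsilon>) \<and> norm z \<le> s * sqrt (r + \<epsilon>)"
      if "1 \<le> s" "(1 / s) *\<^sub>R z \<in> E" for s
    proof -
      have "\<bar>(norm z / s)\<^sup>2 - r\<bar> \<le> \<epsilon>" using E[OF that(2)] that(1) by (simp add: power_divide)
      then have "(norm z / s)\<^sup>2 \<le> r + \<epsilon>" "r - \<epsilon> \<le> (norm z / s)\<^sup>2" by linarith+
      then have "norm z / s \<le> sqrt (r + \<epsilon>)" "sqrt (r - \<epsilon>) \<le> norm z / s"
        using that(1) real_sqrt_le_mono[of "r - \<epsilon>" "(norm z / s)\<^sup>2"] by (auto intro: real_le_rsqrt)
      then show ?thesis
        using that(1) \<epsilon> by (auto simp: field_simps)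
    qed
    \<comment> \<open>Since \<open>s \<le> 2\<close>,
      \<open>norm z \<le> 2 * sqrt (r + \<epsilon>)\<close>. With
      \<open>t = sqrt (r + \<epsilon>) / sqrt (r - \<epsilon>) \<ge> 1\<close> the length is at most
      \<open>2 * (t - 1) \<le> 2 * (t^2 - 1) = 4 * \<epsilon> / (r - \<epsilon>)\<close>, and
      \<open>r - \<epsilon> \<ge> r / 2\<close>.\<close>
    have len: "norm z / sqrt (r - \<epsilon>) - norm z / sqrt (r + \<epsilon>) \<le> 8 * \<epsilon> / r"
    proof -
      have le: "sqrt (r - \<epsilon>) \<le> sqrt (r + \<epsilon>)" "0 < sqrt (r - \<epsilon>)" using \<epsilon> by auto
      have nz: "norm z \<le> 2 * sqrt (r + \<epsilon>)"
      proof -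
        have "norm z \<le> s * sqrt (r + \<epsilon>)" using bnds[OF s(1,3)] by blast
        also have "\<dots> \<le> 2 * sqrt (r + \<epsilon>)" using s h \<epsilon> by (intro mult_right_mono) auto
        finally show ?thesis .
      qed
      have "norm z / sqrt (r - \<epsilon>) - norm z / sqrt (r + \<epsilon>) = norm z * (1 / sqrt (r - \<epsilon>) - 1 / sqrt (r + \<epsilon>))"
        by (simp add: right_diff_distrib)
      also have "\<dots> \<le> 2 * sqrt (r + \<epsilon>) * (1 / sqrt (r - \<epsilon>) - 1 / sqrt (r + \<epsilon>))"
        using le by (intro mult_right_mono nz) (auto simp: frac_le)
      also have "\<dots> = 2 * (sqrt (r + \<epsilon>) / sqrt (r - \<epsilon>) - 1)"
        using \<epsilon> by (simp add: field_simps)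
      also have "\<dots> \<le> 2 * ((sqrt (r + \<epsilon>) / sqrt (r - \<epsilon>))\<^sup>2 - 1)"
      proof -
        have "1 \<le> sqrt (r + \<epsilon>) / sqrt (r - \<epsilon>)" using le by simp
        then have "sqrt (r + \<epsilon>) / sqrt (r - \<epsilon>) \<le> (sqrt (r + \<epsilon>) / sqrt (r - \<epsilon>))\<^sup>2"
          by (intro self_le_power) auto
        then show ?thesis by (intro mult_left_mono diff_right_mono) auto
      qed
      also have "(sqrt (r + \<epsilon>) / sqrt (r - \<epsilon>))\<^sup>2 = (r + \<epsilon>) / (r - \<epsilon>)"
        using \<epsilon> by (simp add: power_divide)
      also have "2 * ((r + \<epsilon>) / (r - \<epsilon>) - 1) = 4 * \<epsilon> / (r - \<epsilon>)"
        using \<epsilon> by (simp add: field_simps)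
      also have "\<dots> \<le> 4 * \<epsilon> / (r / 2)"
        using \<epsilon> by (intro divide_left_mono mult_pos_pos) auto
      finally show ?thesis by simp
    qed
    have "(\<integral>\<^sup>+ s. indicator {1..1 + h} s * indicator E ((1 / s) *\<^sub>R z) \<partial>lborel)
      \<le> (\<integral>\<^sup>+ s. indicator {norm z / sqrt (r + \<epsilon>)..norm z / sqrt (r - \<epsilon>)} s \<partial>lborel)"
      using bnds by (intro nn_integral_mono) (auto simp: indicator_def)
    also have "\<dots> = ennreal (norm z / sqrt (r - \<epsilon>) - norm z / sqrt (r + \<epsilon>))"
      using \<epsilon> by (simp add: divide_left_mono)
    also have "\<dots> \<le> ennreal (8 * \<epsilon> / r)" by (rule ennreal_leI[OF len])
    finally show ?thesis using zE' by simp
  qed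
  \<comment> \<open>The area of \<open>E\<close> is at most that of its dilate by \<open>s\<close>;
    averaging over \<open>s\<close> and exchanging the integrals reduces the claim to
    \<open>slice\<close>.\<close>
  have "ennreal h * emeasure lborel E = (\<integral>\<^sup>+ s. indicator {1..1 + h} s * emeasure lborel E \<partial>lborel)"
    using h by (simp add: nn_integral_multc)
  also have "\<dots> \<le> (\<integral>\<^sup>+ s. indicator {1..1 + h} s * (\<integral>\<^sup>+ z. indicator E ((1 / s) *\<^sub>R z) \<partial>lborel) \<partial>lborel)"
    using scale by (intro nn_integral_mono) (auto simp: indicator_def)
  also have "\<dots> = (\<integral>\<^sup>+ s. \<integral>\<^sup>+ z. indicator {1..1 + h} s * indicator E ((1 / s) *\<^sub>R z) \<partial>lborel \<partial>lborel)"
    by (intro nn_integral_cong nn_integral_cmult[symmetric]) measurable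
  also have "\<dots> = (\<integral>\<^sup>+ z. \<integral>\<^sup>+ s. indicator {1..1 + h} s * indicator E ((1 / s) *\<^sub>R z) \<partial>lborel \<partial>(lborel :: (real \<times> real) measure))"
    by (rule pair_sigma_finite.Fubini'[symmetric])
      (auto simp: pair_sigma_finite_def sigma_finite_lborel)
  also have "\<dots> \<le> (\<integral>\<^sup>+ z. ennreal (8 * \<epsilon> / r) * indicator E' z \<partial>lborel)"
    by (intro nn_integral_mono slice)
  also have "\<dots> = ennreal (8 * \<epsilon> / r) * emeasure lborel E'"
    by (simp add: nn_integral_cmult)
  finally show ?thesis .
qed

lemma emeasure_square_le:
  fixes E :: "(real \<times> real) set"
  assumes "\<And>z. z \<in> E \<Longrightarrow> norm z \<le> b" and "0 \<le> b"
  shows "emeasure lborel E \<le> ennreal (4 * b\<^sup>2)"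
proof -
  have "E \<subseteq> {-b..b} \<times> {-b..b}"
  proof
    fix z assume "z \<in> E"
    then have "norm (fst z) \<le> b" "norm (snd z) \<le> b"
      using assms(1)[of z] norm_fst_le[of "fst z" "snd z"] norm_snd_le[of "snd z" "fst z"]
      by (auto intro: order_trans)
    then show "z \<in> {-b..b} \<times> {-b..b}" by (cases z) auto
  qed
  then have "emeasure lborel E \<le> emeasure lborel ({-b..b} \<times> {-b..b})"
    by (intro emeasure_mono) (auto intro!: borel_closed closed_Times)
  also have "\<dots> = emeasure (lborel \<Otimes>\<^sub>M lborel) ({-b..b} \<times> {-b..b})"
    by (simp add: lborel_prod)
  also have "\<dots> = ennreal (4 * b\<^sup>2)"
    using assms(2) by (subst lborel.emeasure_pair_measure_Times) (auto simp: ennreal_mult[symmetric] power2_eq_square)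
  finally show ?thesis .
qed

text \<open>For \<open>r \<ge> 2 * \<epsilon>\<close>, dilation by factors up to 2 stays in a disc
  whose bounding square has area \<open>16 * (r + \<epsilon>) \<le> 24 * r\<close>; times
  \<open>8 * \<epsilon> / r\<close> this is \<open>192 * \<epsilon>\<close>. For smaller
  \<open>r\<close> the set lies in a disc of squared radius \<open>3 * \<epsilon>\<close>.\<close>

lemma emeasure_annulus_le:
  fixes E :: "(real \<times> real) set"
  assumes [measurable]: "E \<in> sets borel"
    and E: "\<And>z. z \<in> E \<Longrightarrow> \<bar>(norm z)\<^sup>2 - r\<bar> \<le> \<epsilon>" and \<epsilon>: "0 < \<epsilon>"
  shows "emeasure lborel E \<le> ennreal (192 * \<epsilon>)"
proof (cases "2 * \<epsilon> \<le> r")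
  case True
  have "ennreal 1 * emeasure lborel E \<le> ennreal (8 * \<epsilon> / r) * emeasure lborel (cball 0 (2 * sqrt (r + \<epsilon>)) :: (real \<times> real) set)"
  proof (rule emeasure_dilation_average[OF _ _ E _ \<epsilon> True])
    fix z and s :: real assume z: "z \<in> E" "1 \<le> s" "s \<le> 1 + 1"
    have "norm z \<le> sqrt (r + \<epsilon>)" using E[OF z(1)] by (intro real_le_rsqrt) linarith
    then have "s * norm z \<le> 2 * sqrt (r + \<epsilon>)" using z by (intro mult_mono) auto
    then show "s *\<^sub>R z \<in> cball 0 (2 * sqrt (r + \<epsilon>))" using z by simp
  qed auto
  also have "\<dots> \<le> ennreal (8 * \<epsilon> / r) * ennreal (4 * (2 * sqrt (r + \<epsilon>))\<^sup>2)"
    using True \<epsilon> by (intro mult_left_mono emeasure_square_le) auto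
  also have "\<dots> = ennreal (8 * \<epsilon> / r * (16 * (r + \<epsilon>)))"
    using True \<epsilon> by (subst ennreal_mult[symmetric]) (auto simp: power_mult_distrib)
  also have "\<dots> \<le> ennreal (192 * \<epsilon>)"
  proof (rule ennreal_leI)
    have "8 * \<epsilon> / r * (16 * (r + \<epsilon>)) \<le> 8 * \<epsilon> / r * (24 * r)"
      using True \<epsilon> by (intro mult_left_mono) auto
    also have "\<dots> = 192 * \<epsilon>" using True \<epsilon> by simp
    finally show "8 * \<epsilon> / r * (16 * (r + \<epsilon>)) \<le> 192 * \<epsilon>" .
  qed
  finally show ?thesis by simp
next
  case False
  have "emeasure lborel E \<le> ennreal (4 * (sqrt (3 * \<epsilon>))\<^sup>2)"
  proof (rule emeasure_square_le)
    fix z assume "z \<in> E"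
    then show "norm z \<le> sqrt (3 * \<epsilon>)" using E[of z] False by (intro real_le_rsqrt) linarith
  qed (use \<epsilon> in auto)
  also have "\<dots> \<le> ennreal (192 * \<epsilon>)" using \<epsilon> by (intro ennreal_leI) auto
  finally show ?thesis .
qed

text \<open>The coordinates 0 and 1 are real, so their integrals combine into one over the plane,
  shifted so that dilations about \<open>\<sigma>\<close> become dilations about the origin.\<close>

lemma nn_integral_freq_measure_planar:
  assumes J: "0 \<notin> J" "1 \<notin> J" and [measurable]: "f \<in> borel_measurable borel"
  shows "(\<integral>\<^sup>+ \<xi>. f \<xi> \<partial>freq_measure J) = (\<integral>\<^sup>+ c. \<integral>\<^sup>+ d. \<integral>\<^sup>+ z.
      f (\<chi> m. if m = 2 then c else if m = 3 then d else if m = 0 then \<sigma> $ 0 + fst z else \<sigma> $ 1 + snd z)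
      \<partial>lborel \<partial>coord_measure J 3 \<partial>coord_measure J 2)"
proof -
  have [measurable]: "fst \<in> borel_measurable (borel :: (real \<times> real) measure)"
    "snd \<in> borel_measurable (borel :: (real \<times> real) measure)"
    by (intro borel_measurable_continuous_onI continuous_intros)+
  let ?v = "\<lambda>c d x y. \<chi> m::4. if m = 2 then c else if m = 3 then d else if m = 0 then x else (y::real)"
  have dist: "distinct [2, 3, 0, 1 :: 4]" by simp
  have m[measurable]: "(\<lambda>z. ?v c d (fst z) (snd z)) \<in> borel_measurable borel" for c d
    by (rule borel_measurable_vec_lambda) simp
  have fm[measurable]: "(\<lambda>z. f (?v c d (fst z) (snd z))) \<in> borel_measurable borel" for c d
    by measurable
  have fm'[measurable]: "(\<lambda>(x, y). f (?v c d x y)) \<in> borel_measurable (borel \<Otimes>\<^sub>M borel)" for c d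
    using fm[of c d] by (simp add: borel_prod case_prod_beta)
  have "(\<integral>\<^sup>+ \<xi>. f \<xi> \<partial>freq_measure J) = (\<integral>\<^sup>+ c. \<integral>\<^sup>+ d. \<integral>\<^sup>+ x. \<integral>\<^sup>+ y. f (?v c d x y)
      \<partial>coord_measure J 1 \<partial>coord_measure J 0 \<partial>coord_measure J 3 \<partial>coord_measure J 2)"
    by (rule nn_integral_freq_measure_iterated[OF _ dist]) measurable
  also have "\<dots> = (\<integral>\<^sup>+ c. \<integral>\<^sup>+ d. \<integral>\<^sup>+ x. \<integral>\<^sup>+ y. f (?v c d x y) \<partial>lborel \<partial>lborel \<partial>coord_measure J 3 \<partial>coord_measure J 2)"
    using J by (simp add: coord_measure_def)
  also have "\<dots> = (\<integral>\<^sup>+ c. \<integral>\<^sup>+ d. \<integral>\<^sup>+ x. \<integral>\<^sup>+ y. f (?v c d (\<sigma> $ 0 + x) (\<sigma> $ 1 + y)) \<partial>lborel \<partial>lborel \<partial>coord_measure J 3 \<partial>coord_measure J 2)"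
  proof (rule nn_integral_cong, rule nn_integral_cong)
    fix c d
    have [measurable]: "(\<lambda>y. f (?v c d x y)) \<in> borel_measurable borel" for x
      using measurable_Pair2[OF fm'[of c d], of x] by simp
    have "(\<integral>\<^sup>+ x. \<integral>\<^sup>+ y. f (?v c d x y) \<partial>lborel \<partial>lborel) = (\<integral>\<^sup>+ x. \<integral>\<^sup>+ y. f (?v c d (\<sigma> $ 0 + x) y) \<partial>lborel \<partial>lborel)"
      using nn_integral_real_affine[of "\<lambda>x. \<integral>\<^sup>+ y. f (?v c d x y) \<partial>lborel" 1 "\<sigma> $ 0"] unfolding mult_1 by simp
    also have "\<dots> = (\<integral>\<^sup>+ x. \<integral>\<^sup>+ y. f (?v c d (\<sigma> $ 0 + x) (\<sigma> $ 1 + y)) \<partial>lborel \<partial>lborel)"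
    proof (rule nn_integral_cong)
      fix x
      show "(\<integral>\<^sup>+ y. f (?v c d (\<sigma> $ 0 + x) y) \<partial>lborel) = (\<integral>\<^sup>+ y. f (?v c d (\<sigma> $ 0 + x) (\<sigma> $ 1 + y)) \<partial>lborel)"
        using nn_integral_real_affine[of "\<lambda>y. f (?v c d (\<sigma> $ 0 + x) y)" 1 "\<sigma> $ 1"] unfolding mult_1 by simp
    qed
    finally show "(\<integral>\<^sup>+ x. \<integral>\<^sup>+ y. f (?v c d x y) \<partial>lborel \<partial>lborel)
      = (\<integral>\<^sup>+ x. \<integral>\<^sup>+ y. f (?v c d (\<sigma> $ 0 + x) (\<sigma> $ 1 + y)) \<partial>lborel \<partial>lborel)" .
  qed
  also have "\<dots> = (\<integral>\<^sup>+ c. \<integral>\<^sup>+ d. \<integral>\<^sup>+ z. f (?v c d (\<sigma> $ 0 + fst z) (\<sigma> $ 1 + snd z)) \<partial>lborel \<partial>coord_measure J 3 \<partial>coord_measure J 2)"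
  proof (intro nn_integral_cong)
    fix c d
    have "(\<lambda>z. f (?v c d (fst (\<sigma> $ 0 + fst z, \<sigma> $ 1 + snd z)) (snd (\<sigma> $ 0 + fst z, \<sigma> $ 1 + snd z)))) \<in> borel_measurable (lborel \<Otimes>\<^sub>M lborel)"
      by (rule measurable_compose[OF _ fm]) (simp add: borel_prod[symmetric])
    then have "(\<integral>\<^sup>+ x. \<integral>\<^sup>+ y. f (?v c d (\<sigma> $ 0 + x) (\<sigma> $ 1 + y)) \<partial>lborel \<partial>lborel)
      = (\<integral>\<^sup>+ z. f (?v c d (\<sigma> $ 0 + fst z) (\<sigma> $ 1 + snd z)) \<partial>(lborel \<Otimes>\<^sub>M lborel))"
      by (subst lborel.nn_integral_fst[symmetric]) (auto cong: if_cong)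
    then show "(\<integral>\<^sup>+ x. \<integral>\<^sup>+ y. f (?v c d (\<sigma> $ 0 + x) (\<sigma> $ 1 + y)) \<partial>lborel \<partial>lborel)
      = (\<integral>\<^sup>+ z. f (?v c d (\<sigma> $ 0 + fst z) (\<sigma> $ 1 + snd z)) \<partial>lborel)"
      by (simp add: lborel_prod)
  qed
  finally show ?thesis .
qed


text \<open>The source of the gain. The bound is uniform in \<open>\<sigma>\<close> and
  \<open>\<rho>\<close>, because Schur's test meets a different shell in every row.\<close>

lemma shell_count:
  fixes mu lam :: real
  assumes J: "0 \<notin> J" "1 \<notin> J" and mu: "1 \<le> mu" "mu \<le> lam" and a: "norm a = 1" and \<epsilon>: "0 < \<epsilon>" "\<epsilon> \<le> 1"
  shows "emeasure (freq_measure J) (shell \<sigma> a \<rho> (2 * lam) (2 * mu) \<epsilon>)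
    \<le> ennreal (300000 * \<epsilon> * lam\<^sup>2 * (mu / lam) powr (1 / 6))"
proof -
  \<comment> \<open>With the sixth root, \<open>mu = lam * g ^ 6\<close>,
    \<open>sqrt (mu * lam) = lam * g ^ 3\<close> and the balancing radius, of order
    \<open>lam * g\<close>, are all monomials in \<open>lam\<close> and \<open>g\<close>.\<close>
  define g where "g = (mu / lam) powr (1 / 6)"
  have lam: "1 \<le> lam" using mu by linarith
  have g0: "0 < g" using mu lam by (simp add: g_def)
  have g1: "g \<le> 1" unfolding g_def using mu lam by (intro powr_le1) auto
  have g6: "g ^ 6 = mu / lam" using mu lam by (simp add: g_def powr_powr flip: powr_realpow)
  have mu_eq: "mu = lam * g ^ 6" using g6 lam by simp
  \<comment> \<open>Lets \<open>lam * g\<close> absorb the additive constants left by counting, and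
    yields \<open>K \<ge> 4\<close>.\<close>
  have lamg: "1 \<le> lam * g"
  proof -
    have "g ^ 6 \<le> g" using g0 g1 power_decreasing[of 1 6 g] by simp
    then have "lam * g ^ 6 \<le> lam * g" using lam by (intro mult_left_mono) auto
    then show ?thesis using mu mu_eq by linarith
  qed
  define S where "S = shell \<sigma> a \<rho> (2 * lam) (2 * mu) \<epsilon>"
  \<comment> \<open>Dilation by \<open>s \<le> 1 + h \<le> 2\<close> at most doubles the cube, moves
    the slab form by at most \<open>h * 4 * lam = 4 * mu\<close>, and the squared norm by at most
    \<open>3 * h * 8 * lam^2 = 24 * mu * lam\<close>; one more \<open>mu * lam\<close> absorbs
    \<open>\<epsilon>\<close>.\<close>
  define S' where "S' = shell \<sigma> a \<rho> (4 * lam) (6 * mu) (25 * mu * lam)"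
  define h where "h = mu / lam"
  have h: "0 < h" "h \<le> 1" using mu lam by (auto simp: h_def)
  let ?v = "\<lambda>c d z. (\<chi> m. if m = 2 then c else if m = 3 then d else if m = 0 then \<sigma> $ 0 + fst z else \<sigma> $ 1 + snd z) :: real^4"
  have dist: "distinct [2, 3, 0, 1 :: 4]" by simp
  note sum4 = sum_4_distinct[OF dist]
  define r where "r c d = \<rho> - (c - \<sigma> $ 2)\<^sup>2 - (d - \<sigma> $ 3)\<^sup>2" for c d
  define b where "b c d = a $ 2 * (c - \<sigma> $ 2) + a $ 3 * (d - \<sigma> $ 3)" for c d
  have mem: "?v c d z \<in> shell \<sigma> a \<rho> \<Lambda> w D \<longleftrightarrow>
      \<bar>c - \<sigma> $ 2\<bar> \<le> \<Lambda> \<and> \<bar>d - \<sigma> $ 3\<bar> \<le> \<Lambda> \<and> \<bar>fst z\<bar> \<le> \<Lambda> \<and> \<bar>snd z\<bar> \<le> \<Lambda> \<and>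
      \<bar>b c d + a $ 0 * fst z + a $ 1 * snd z\<bar> \<le> w \<and> \<bar>(norm z)\<^sup>2 - r c d\<bar> \<le> D" for c d z \<Lambda> w D
  proof -
    have all: "(\<forall>m::4. Q m) \<longleftrightarrow> Q 2 \<and> Q 3 \<and> Q 0 \<and> Q 1" for Q
      using UNIV_4_distinct[OF dist] by (metis insert_iff empty_iff UNIV_I)
    have nz: "(norm z)\<^sup>2 = (fst z)\<^sup>2 + (snd z)\<^sup>2"
      by (simp add: norm_prod_def)
    have "a \<bullet> (?v c d z - \<sigma>) = b c d + a $ 0 * fst z + a $ 1 * snd z"
      by (simp add: inner_vec_def sum4 b_def)
    moreover have "(norm (?v c d z - \<sigma>))\<^sup>2 - \<rho> = (norm z)\<^sup>2 - r c d"
      by (simp add: norm_vec_squared sum4 nz r_def)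
    ultimately show ?thesis
      by (simp add: shell_def all)
  qed
  define I where "I = {c. \<bar>c - \<sigma> $ 2\<bar> \<le> 2 * lam}"
  \<comment> \<open>The squared radius that separates small circles from large ones.\<close>
  define K where "K = g\<^sup>2 * (2 * lam)\<^sup>2"
  \<comment> \<open>The condition \<open>- \<epsilon> \<le> r c d \<le> K\<close> as one absolute
    value, with leading coefficient \<open>1\<close>, in the form of
    \<open>emeasure_coord_measure_quadratic\<close>.\<close>
  define Q where "Q c = {d. \<bar>1 * (d - \<sigma> $ 3)\<^sup>2 + ((c - \<sigma> $ 2)\<^sup>2 - \<rho> + (K - \<epsilon>) / 2)\<bar> \<le> (K + \<epsilon>) / 2}" for c
  have K: "4 \<le> K"
  proof -
    have "1 \<le> (lam * g)\<^sup>2" using lamg by (simp add: one_le_power)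
    then show ?thesis by (simp add: K_def power_mult_distrib mult.commute)
  qed
  have [measurable]: "fst \<in> borel_measurable (borel :: (real \<times> real) measure)"
    "snd \<in> borel_measurable (borel :: (real \<times> real) measure)"
    by (intro borel_measurable_continuous_onI continuous_intros)+
  have meas_v: "(\<lambda>z. ?v c d z) \<in> borel_measurable borel" for c d
    by (rule borel_measurable_vec_lambda) simp
  have meas_fiber: "{z. ?v c d z \<in> A} \<in> sets borel" if "A \<in> sets borel" for A c d
    using measurable_sets[OF meas_v that, of c d] by (simp add: vimage_def)
  let ?C = "ennreal (8 * \<epsilon> / (h * K))"
  \<comment> \<open>The fibre lies on a circle of squared radius about \<open>r c d\<close>. Few \<open>(c, d)\<close> have \<open>r c d \<le> K\<close>; the other fibres are dilated.\<close>
  have fiber: "emeasure lborel {z. ?v c d z \<in> S} \<le> indicator I c * (indicator (Q c) d * ennreal (192 * \<epsilon>))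
      + ?C * emeasure lborel {z. ?v c d z \<in> S'}" for c d
  proof (cases "\<exists>z. ?v c d z \<in> S")
    case False
    then have "{z. ?v c d z \<in> S} = {}" by blast
    then show ?thesis by (simp only: emeasure_empty) simp
  next
    case True
    then obtain z0 where z0: "?v c d z0 \<in> S" by blast
    have c: "\<bar>c - \<sigma> $ 2\<bar> \<le> 2 * lam" and d: "\<bar>d - \<sigma> $ 3\<bar> \<le> 2 * lam" using z0 unfolding S_def mem by auto
    have r: "- \<epsilon> \<le> r c d"
    proof -
      have "(norm z0)\<^sup>2 - r c d \<le> \<epsilon>" using z0 unfolding S_def mem by linarith
      moreover have "0 \<le> (norm z0)\<^sup>2" by simp
      ultimately show ?thesis by linarith
    qed
    show ?thesis
    proof (cases "r c d \<le> K")
      case True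
      have "c \<in> I" using c by (simp add: I_def)
      moreover have "d \<in> Q c"
        using r True by (simp add: Q_def r_def abs_le_iff field_simps)
      moreover have "emeasure lborel {z. ?v c d z \<in> S} \<le> ennreal (192 * \<epsilon>)"
        by (rule emeasure_annulus_le[OF meas_fiber, where r="r c d"]) (use \<epsilon> in \<open>auto simp: S_def mem\<close>)
      ultimately show ?thesis by (simp add: add_increasing2)
    next
      case False
      \<comment> \<open>Here \<open>r c d > K \<ge> 4 \<ge> 2 * \<epsilon>\<close>, as the dilation
        argument requires.\<close>
      have "ennreal h * emeasure lborel {z. ?v c d z \<in> S} \<le> ennreal (8 * \<epsilon> / r c d) * emeasure lborel {z. ?v c d z \<in> S'}"
      proof (rule emeasure_dilation_average[OF meas_fiber meas_fiber])
        fix z and s :: real assume z: "z \<in> {z. ?v c d z \<in> S}" and s: "1 \<le> s" "s \<le> 1 + h"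
        have zS: "\<bar>fst z\<bar> \<le> 2 * lam" "\<bar>snd z\<bar> \<le> 2 * lam" "\<bar>b c d + a $ 0 * fst z + a $ 1 * snd z\<bar> \<le> 2 * mu"
          "\<bar>(norm z)\<^sup>2 - r c d\<bar> \<le> \<epsilon>"
          using z by (auto simp: S_def mem)
        have s2: "s \<le> 2" using s h by linarith
        have hl: "h * lam = mu" using lam by (simp add: h_def)
        have "\<bar>s * x\<bar> \<le> 4 * lam" if "\<bar>x\<bar> \<le> 2 * lam" for x
        proof -
          have "\<bar>s * x\<bar> = s * \<bar>x\<bar>" using s by (simp add: abs_mult)
          also have "\<dots> \<le> 2 * (2 * lam)" using that s s2 by (intro mult_mono) auto
          finally show ?thesis by simp
        qed
        moreover have "\<bar>b c d + a $ 0 * (s * fst z) + a $ 1 * (s * snd z)\<bar> \<le> 6 * mu"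
        proof -
          have "\<bar>a $ m\<bar> \<le> 1" for m using component_le_norm_cart[of a m] a by simp
          then have "\<bar>a $ 0 * fst z\<bar> \<le> 1 * (2 * lam)" "\<bar>a $ 1 * snd z\<bar> \<le> 1 * (2 * lam)"
            unfolding abs_mult using zS by (intro mult_mono; simp)+
          then have az: "\<bar>a $ 0 * fst z + a $ 1 * snd z\<bar> \<le> 4 * lam" by linarith
          have "\<bar>(s - 1) * (a $ 0 * fst z + a $ 1 * snd z)\<bar> = (s - 1) * \<bar>a $ 0 * fst z + a $ 1 * snd z\<bar>"
            using s by (simp add: abs_mult)
          also have "\<dots> \<le> h * (4 * lam)" using s az by (intro mult_mono) auto
          also have "\<dots> = 4 * mu" using hl by simp
          finally have "\<bar>(s - 1) * (a $ 0 * fst z + a $ 1 * snd z)\<bar> \<le> 4 * mu" .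
          moreover have "b c d + a $ 0 * (s * fst z) + a $ 1 * (s * snd z)
             = (b c d + a $ 0 * fst z + a $ 1 * snd z) + (s - 1) * (a $ 0 * fst z + a $ 1 * snd z)"
            by (simp add: algebra_simps)
          ultimately show ?thesis using zS(3) by linarith
        qed
        moreover have "\<bar>(norm (s *\<^sub>R z))\<^sup>2 - r c d\<bar> \<le> 25 * mu * lam"
        proof -
          have nz: "(norm z)\<^sup>2 \<le> 8 * lam\<^sup>2"
          proof -
            have "(fst z)\<^sup>2 \<le> (2 * lam)\<^sup>2" "(snd z)\<^sup>2 \<le> (2 * lam)\<^sup>2"
              using zS(1,2) by (metis abs_le_square_iff abs_of_nonneg lam order_trans zero_le_one mult_2 add_nonneg_nonneg)+
            then show ?thesis by (simp add: norm_prod_def power_mult_distrib)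
          qed
          have "s\<^sup>2 - 1 = (s - 1) * (s + 1)" by (simp add: power2_eq_square algebra_simps)
          also have "\<dots> \<le> h * 3" using s s2 by (intro mult_mono) auto
          finally have s3: "s\<^sup>2 - 1 \<le> 3 * h" by simp
          have "0 \<le> s\<^sup>2 - 1" using s by (simp add: one_le_power)
          then have "\<bar>(s\<^sup>2 - 1) * (norm z)\<^sup>2\<bar> = (s\<^sup>2 - 1) * (norm z)\<^sup>2" by (simp add: abs_mult)
          also have "\<dots> \<le> (3 * h) * (8 * lam\<^sup>2)" using s3 nz h by (intro mult_mono) auto
          also have "\<dots> = 24 * (h * lam) * lam" by (simp add: power2_eq_square)
          finally have "\<bar>(s\<^sup>2 - 1) * (norm z)\<^sup>2\<bar> \<le> 24 * mu * lam" unfolding hl .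
          moreover have "(norm (s *\<^sub>R z))\<^sup>2 - r c d = ((norm z)\<^sup>2 - r c d) + (s\<^sup>2 - 1) * (norm z)\<^sup>2"
            by (simp add: power_mult_distrib algebra_simps)
          moreover have "1 \<le> mu * lam" using mult_mono[of 1 mu 1 lam] mu lam by simp
          ultimately show ?thesis using zS(4) \<epsilon> by linarith
        qed
        ultimately show "s *\<^sub>R z \<in> {z. ?v c d z \<in> S'}"
          using zS(1,2) c d lam unfolding S'_def mem_Collect_eq mem by auto
      qed (use False K \<epsilon> h in \<open>auto simp: S_def S'_def mem\<close>)
      then have "ennreal (1 / h) * (ennreal h * emeasure lborel {z. ?v c d z \<in> S})
          \<le> ennreal (1 / h) * (ennreal (8 * \<epsilon> / r c d) * emeasure lborel {z. ?v c d z \<in> S'})"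
        by (rule mult_left_mono) simp
      also have "ennreal (1 / h) * (ennreal h * emeasure lborel {z. ?v c d z \<in> S}) = emeasure lborel {z. ?v c d z \<in> S}"
        using h by (simp add: mult.assoc[symmetric] ennreal_mult[symmetric])
      also have "ennreal (1 / h) * (ennreal (8 * \<epsilon> / r c d) * emeasure lborel {z. ?v c d z \<in> S'})
        = ennreal (1 / h * (8 * \<epsilon> / r c d)) * emeasure lborel {z. ?v c d z \<in> S'}"
        using h False K \<epsilon> by (subst ennreal_mult) (auto simp: mult.assoc)
      also have "\<dots> \<le> ?C * emeasure lborel {z. ?v c d z \<in> S'}"
      proof (intro mult_right_mono ennreal_leI)
        have "8 * \<epsilon> / (h * r c d) \<le> 8 * \<epsilon> / (h * K)"
          using h False K \<epsilon> by (intro divide_left_mono mult_left_mono mult_pos_pos) auto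
        then show "1 / h * (8 * \<epsilon> / r c d) \<le> 8 * \<epsilon> / (h * K)" by simp
      qed simp
      finally show ?thesis by (simp add: add_increasing)
    qed
  qed
  have [measurable]: "I \<in> sets borel"
  proof -
    have "I = {c \<in> space borel. \<bar>c - \<sigma> $ 2\<bar> \<le> 2 * lam}" by (simp add: I_def)
    then show ?thesis by simp
  qed
  have [measurable]: "Q c \<in> sets borel" for c
  proof -
    have "Q c = {d \<in> space borel. \<bar>1 * (d - \<sigma> $ 3)\<^sup>2 + ((c - \<sigma> $ 2)\<^sup>2 - \<rho> + (K - \<epsilon>) / 2)\<bar> \<le> (K + \<epsilon>) / 2}" by (simp add: Q_def)
    then show ?thesis by simp
  qed
  have planar: "emeasure (freq_measure J) A = (\<integral>\<^sup>+ c. \<integral>\<^sup>+ d. emeasure lborel {z. ?v c d z \<in> A} \<partial>coord_measure J 3 \<partial>coord_measure J 2)"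
    if A: "A \<in> sets borel" for A
  proof -
    have "emeasure (freq_measure J) A = (\<integral>\<^sup>+ \<xi>. indicator A \<xi> \<partial>freq_measure J)" using A by simp
    also have "\<dots> = (\<integral>\<^sup>+ c. \<integral>\<^sup>+ d. \<integral>\<^sup>+ z. indicator A (?v c d z) \<partial>lborel \<partial>coord_measure J 3 \<partial>coord_measure J 2)"
      by (rule nn_integral_freq_measure_planar[OF J]) (use A in measurable)
    also have "\<dots> = (\<integral>\<^sup>+ c. \<integral>\<^sup>+ d. \<integral>\<^sup>+ z. indicator {z. ?v c d z \<in> A} z \<partial>lborel \<partial>coord_measure J 3 \<partial>coord_measure J 2)"
      by (simp add: indicator_def)
    finally show ?thesis by (simp add: meas_fiber[OF A])
  qed
  have [measurable]: "S' \<in> sets borel" "S \<in> sets borel" by (simp_all add: S_def S'_def)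
  \<comment> \<open>Written as an integral over \<open>z\<close>, the measure of the fibre is seen
    to be measurable in \<open>(c, d)\<close>.\<close>
  have fiber_eq: "emeasure lborel {z. ?v c d z \<in> S'} = (\<integral>\<^sup>+ z. indicator S' (?v c d z) \<partial>lborel)" for c d
  proof -
    have "(\<integral>\<^sup>+ z. indicator S' (?v c d z) \<partial>lborel) = (\<integral>\<^sup>+ z. indicator {z. ?v c d z \<in> S'} z \<partial>lborel)"
      by (simp add: indicator_def)
    then show ?thesis using meas_fiber[of S'] by simp
  qed
  have v3: "(\<lambda>x. ?v (fst (fst x)) (snd (fst x)) (snd x)) \<in> borel_measurable ((coord_measure J 2 \<Otimes>\<^sub>M coord_measure J 3) \<Otimes>\<^sub>M (lborel :: (real \<times> real) measure))"
    by (rule borel_measurable_vec_lambda) simp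
  have ind: "(indicator S' :: _ \<Rightarrow> ennreal) \<in> borel_measurable borel" by simp
  have G[measurable]: "(\<lambda>x. emeasure lborel {z. ?v (fst x) (snd x) z \<in> S'}) \<in> borel_measurable (coord_measure J 2 \<Otimes>\<^sub>M coord_measure J 3)"
    unfolding fiber_eq
    by (rule lborel.borel_measurable_nn_integral)
      (use measurable_compose[OF v3 ind] in \<open>simp add: case_prod_beta cong: if_cong\<close>)
  have G1[measurable]: "(\<lambda>d. emeasure lborel {z. ?v c d z \<in> S'}) \<in> borel_measurable (coord_measure J 3)" for c
    using measurable_compose[OF measurable_Pair1' G, of c] by (simp cong: if_cong)
  have G2[measurable]: "(\<lambda>c. \<integral>\<^sup>+ d. emeasure lborel {z. ?v c d z \<in> S'} \<partial>coord_measure J 3) \<in> borel_measurable (coord_measure J 2)"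
    by (rule sigma_finite_measure.borel_measurable_nn_integral[OF sigma_finite_coord_measure]) (use G in \<open>simp add: case_prod_beta cong: if_cong\<close>)
  have Qb: "emeasure (coord_measure J 3) (Q c) \<le> ennreal (2 * (sqrt (2 * ((K + \<epsilon>) / 2)) + 1))" for c
    unfolding Q_def using K \<epsilon> by (intro emeasure_coord_measure_quadratic) auto
  have Ib: "emeasure (coord_measure J 2) I \<le> ennreal (2 * (2 * lam) + 1)"
    unfolding I_def using lam by (intro emeasure_coord_measure_ball) auto
  have "emeasure (freq_measure J) S \<le> (\<integral>\<^sup>+ c. \<integral>\<^sup>+ d. indicator I c * (indicator (Q c) d * ennreal (192 * \<epsilon>))
      + ?C * emeasure lborel {z. ?v c d z \<in> S'} \<partial>coord_measure J 3 \<partial>coord_measure J 2)"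
    by (subst planar) (auto intro!: nn_integral_mono fiber)
  also have "\<dots> = (\<integral>\<^sup>+ c. indicator I c * (emeasure (coord_measure J 3) (Q c) * ennreal (192 * \<epsilon>))
      + ?C * (\<integral>\<^sup>+ d. emeasure lborel {z. ?v c d z \<in> S'} \<partial>coord_measure J 3) \<partial>coord_measure J 2)"
    by (simp add: nn_integral_add nn_integral_indicator_const_mult nn_integral_multc nn_integral_cmult)
  also have "\<dots> \<le> (\<integral>\<^sup>+ c. indicator I c * (ennreal (2 * (sqrt (2 * ((K + \<epsilon>) / 2)) + 1)) * ennreal (192 * \<epsilon>))
      + ?C * (\<integral>\<^sup>+ d. emeasure lborel {z. ?v c d z \<in> S'} \<partial>coord_measure J 3) \<partial>coord_measure J 2)"
    by (intro nn_integral_mono add_mono mult_left_mono mult_right_mono Qb) auto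
  also have "\<dots> = emeasure (coord_measure J 2) I * (ennreal (2 * (sqrt (2 * ((K + \<epsilon>) / 2)) + 1)) * ennreal (192 * \<epsilon>))
      + ?C * (\<integral>\<^sup>+ c. \<integral>\<^sup>+ d. emeasure lborel {z. ?v c d z \<in> S'} \<partial>coord_measure J 3 \<partial>coord_measure J 2)"
    by (simp add: nn_integral_add nn_integral_multc nn_integral_cmult)
  also have "\<dots> = emeasure (coord_measure J 2) I * (ennreal (2 * (sqrt (2 * ((K + \<epsilon>) / 2)) + 1)) * ennreal (192 * \<epsilon>))
      + ?C * emeasure (freq_measure J) S'"
    by (simp add: planar)
  \<comment> \<open>\<open>7680 = 5 * 8 * 192\<close> belongs to the small circles,
    \<open>202500 = 8 * 81 * 25 * 50 / 4\<close> to the dilated ones.\<close>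
  also have "\<dots> \<le> ennreal (7680 * \<epsilon> * lam\<^sup>2 * g) + ennreal (202500 * \<epsilon> * lam\<^sup>2 * g)"
  proof (rule add_mono)
    have "sqrt (2 * ((K + \<epsilon>) / 2)) \<le> 3 * (g * lam)"
    proof (rule real_le_lsqrt)
      have "2 * ((K + \<epsilon>) / 2) \<le> 2 * K" using K \<epsilon> by simp
      also have "\<dots> = 8 * (g * lam)\<^sup>2" by (simp add: K_def power_mult_distrib)
      also have "\<dots> \<le> (3 * (g * lam))\<^sup>2" by (simp add: power_mult_distrib)
      finally show "2 * ((K + \<epsilon>) / 2) \<le> (3 * (g * lam))\<^sup>2" .
    qed (use g0 lam in auto)
    then have "2 * (sqrt (2 * ((K + \<epsilon>) / 2)) + 1) \<le> 8 * (g * lam)"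
      using lamg by (simp add: mult.commute)
    then have Q': "ennreal (2 * (sqrt (2 * ((K + \<epsilon>) / 2)) + 1)) \<le> ennreal (8 * (g * lam))"
      by (rule ennreal_leI)
    have I': "emeasure (coord_measure J 2) I \<le> ennreal (5 * lam)"
      by (rule order_trans[OF Ib ennreal_leI]) (use lam in simp)
    have "emeasure (coord_measure J 2) I * (ennreal (2 * (sqrt (2 * ((K + \<epsilon>) / 2)) + 1)) * ennreal (192 * \<epsilon>))
      \<le> ennreal (5 * lam) * (ennreal (8 * (g * lam)) * ennreal (192 * \<epsilon>))"
      by (rule mult_mono[OF I' mult_right_mono[OF Q']]) auto
    also have "\<dots> = ennreal (7680 * \<epsilon> * lam\<^sup>2 * g)"
      using lam g0 \<epsilon> by (simp add: ennreal_mult[symmetric] power2_eq_square mult_ac)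
    finally show "emeasure (coord_measure J 2) I * (ennreal (2 * (sqrt (2 * ((K + \<epsilon>) / 2)) + 1)) * ennreal (192 * \<epsilon>))
      \<le> ennreal (7680 * \<epsilon> * lam\<^sup>2 * g)" .
  next
    \<comment> \<open>A unit vector in four dimensions has a coordinate of size at least
      \<open>1/2\<close>.\<close>
    obtain i where i: "1/2 \<le> \<bar>a $ i\<bar>"
    proof (rule ccontr)
      assume "\<not> thesis"
      then have lt: "\<bar>a $ i\<bar> < 1/2" for i using that[of i] by linarith
      have "(a $ i)\<^sup>2 < (1/2)\<^sup>2" for i using lt[of i] by (metis abs_ge_zero power2_abs power_strict_mono zero_less_numeral)
      then have q: "(a $ i)\<^sup>2 < 1/4" for i by (simp add: power2_eq_square)
      have "1 = (a $ 2)\<^sup>2 + (a $ 3)\<^sup>2 + (a $ 0)\<^sup>2 + (a $ 1)\<^sup>2"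
        using norm_vec_squared[of a] a by (simp add: sum4)
      then show False using q[of 0] q[of 1] q[of 2] q[of 3] by linarith
    qed
    have ml: "1 \<le> mu * lam" using mult_mono[of 1 mu 1 lam] mu lam by simp
    have "mu * lam = (lam * g ^ 3)\<^sup>2" by (simp add: mu_eq power_mult_distrib power2_eq_square)
    then have "1 \<le> (lam * g ^ 3)\<^sup>2" using ml by simp
    then have lg3: "1 \<le> lam * g ^ 3"
      using g0 lam by (metis abs_of_nonneg abs_square_le_1 linorder_not_le mult_nonneg_nonneg nle_le order_trans power_one power2_le_imp_le zero_le_one zero_le_power less_imp_le)
    have "sqrt (2 * (25 * mu * lam + 4 * (6 * mu) * (4 * lam + 6 * mu))) \<le> 24 * (lam * g ^ 3)"
    proof (rule real_le_lsqrt)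
      have "mu * mu \<le> mu * lam" using mu by (intro mult_left_mono) auto
      then have "2 * (25 * mu * lam + 4 * (6 * mu) * (4 * lam + 6 * mu)) \<le> 576 * (mu * lam)"
        using ml by (simp add: algebra_simps)
      also have "\<dots> = (24 * (lam * g ^ 3))\<^sup>2" unfolding \<open>mu * lam = (lam * g ^ 3)\<^sup>2\<close> by (simp add: power_mult_distrib)
      finally show "2 * (25 * mu * lam + 4 * (6 * mu) * (4 * lam + 6 * mu)) \<le> (24 * (lam * g ^ 3))\<^sup>2" .
    qed (use mu lam g0 in auto)
    note sqrt24 = this
    have sq: "2 * (sqrt (2 * (25 * mu * lam + 4 * (6 * mu) * (4 * lam + 6 * mu))) + 1) \<le> 50 * (lam * g ^ 3)"
    proof -
      have "2 * (s + 1) \<le> 50 * x" if "s \<le> 24 * x" "1 \<le> x" for s x :: real using that by (simp add: algebra_simps)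
      from this[OF sqrt24 lg3] show ?thesis .
    qed
    have "emeasure (freq_measure J) S' \<le>
      ennreal ((2 * (4 * lam) + 1)\<^sup>2 * (4 * (6 * mu) + 1) * (2 * (sqrt (2 * (25 * mu * lam + 4 * (6 * mu) * (4 * lam + 6 * mu))) + 1)))"
      unfolding S'_def using mu lam by (intro emeasure_thick_shell[OF i]) auto
    also have "\<dots> \<le> ennreal ((9 * lam)\<^sup>2 * (25 * mu) * (50 * (lam * g ^ 3)))"
      using mu lam by (intro ennreal_leI mult_mono power_mono sq) auto
    finally have "?C * emeasure (freq_measure J) S' \<le> ?C * ennreal ((9 * lam)\<^sup>2 * (25 * mu) * (50 * (lam * g ^ 3)))"
      by (rule mult_left_mono) simp
    also have "\<dots> = ennreal (8 * \<epsilon> / (h * K) * ((9 * lam)\<^sup>2 * (25 * mu) * (50 * (lam * g ^ 3))))"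
      using mu lam g0 \<epsilon> h K by (subst ennreal_mult) auto
    \<comment> \<open>Up to constants, \<open>h * K = g ^ 8 * lam^2\<close> divides
      \<open>lam^2 * mu * (lam * g ^ 3) = lam ^ 4 * g ^ 9\<close>, so one factor \<open>g\<close>
      survives.\<close>
    also have "8 * \<epsilon> / (h * K) * ((9 * lam)\<^sup>2 * (25 * mu) * (50 * (lam * g ^ 3))) = 202500 * \<epsilon> * lam\<^sup>2 * g"
    proof -
      have "h = g ^ 6" by (simp add: h_def g6)
      have pw: "g ^ 9 = g ^ 6 * (g\<^sup>2 * g)" by (simp add: eval_nat_numeral)
      have "8 * \<epsilon> / (h * K) * ((9 * lam)\<^sup>2 * (25 * mu) * (50 * (lam * g ^ 3)))
        = 202500 * \<epsilon> * lam\<^sup>2 * (g ^ 9 / (g ^ 6 * g\<^sup>2))"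
        using lam g0 unfolding \<open>h = g ^ 6\<close> K_def mu_eq
        by (simp add: field_simps power2_eq_square eval_nat_numeral)
      also have "g ^ 9 / (g ^ 6 * g\<^sup>2) = g" unfolding pw using g0 by simp
      finally show ?thesis .
    qed
    finally show "?C * emeasure (freq_measure J) S' \<le> ennreal (202500 * \<epsilon> * lam\<^sup>2 * g)" .
  qed
  also have "\<dots> \<le> ennreal (300000 * \<epsilon> * lam\<^sup>2 * g)"
    using \<epsilon> g0 lam by (subst ennreal_plus[symmetric]) (auto intro!: ennreal_leI)
  finally show ?thesis by (simp add: S_def g_def)
qed

subsection \<open>Square integrable functions\<close>

text \<open>The square of \<open>eLp_norm 2\<close>, free of the root and of the case distinction at
  infinity.\<close>

definition sqn :: "'a measure \<Rightarrow> ('a \<Rightarrow> complex) \<Rightarrow> ennreal" where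
  "sqn N f = (\<integral>\<^sup>+ x. ennreal ((norm (f x))\<^sup>2) \<partial>N)"

text \<open>From \<open>(a + b)^2 \<le> 2 * a^2 + 2 * b^2\<close>. This crude substitute for
  Minkowski's inequality suffices for limits and otherwise costs only constants.\<close>

lemma sqn_add_le:
  assumes [measurable]: "f \<in> borel_measurable N" "g \<in> borel_measurable N"
  shows "sqn N (\<lambda>x. f x + g x) \<le> 2 * sqn N f + 2 * sqn N g"
proof -
  have "(norm (f x + g x))\<^sup>2 \<le> 2 * (norm (f x))\<^sup>2 + 2 * (norm (g x))\<^sup>2" for x
  proof -
    have "(norm (f x + g x))\<^sup>2 \<le> (norm (f x) + norm (g x))\<^sup>2"
      by (intro power_mono norm_triangle_ineq) auto
    also have "\<dots> \<le> 2 * (norm (f x))\<^sup>2 + 2 * (norm (g x))\<^sup>2"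
      using sum_squares_bound[of "norm (f x)" "norm (g x)"] by (simp add: power2_sum)
    finally show ?thesis .
  qed
  then have "ennreal ((norm (f x + g x))\<^sup>2) \<le> ennreal (2 * (norm (f x))\<^sup>2 + 2 * (norm (g x))\<^sup>2)" for x
    by (rule ennreal_leI)
  then have "ennreal ((norm (f x + g x))\<^sup>2) \<le> 2 * ennreal ((norm (f x))\<^sup>2) + 2 * ennreal ((norm (g x))\<^sup>2)" for x
    by (simp add: ennreal_mult)
  then have "sqn N (\<lambda>x. f x + g x) \<le> (\<integral>\<^sup>+ x. 2 * ennreal ((norm (f x))\<^sup>2) + 2 * ennreal ((norm (g x))\<^sup>2) \<partial>N)"
    unfolding sqn_def by (intro nn_integral_mono)
  also have "\<dots> = 2 * sqn N f + 2 * sqn N g"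
    unfolding sqn_def by (simp add: nn_integral_add nn_integral_cmult)
  finally show ?thesis .
qed

lemma sqn_minus_commute: "sqn N (\<lambda>x. f x - g x) = sqn N (\<lambda>x. g x - f x)"
  by (simp add: sqn_def norm_minus_commute)

lemma sqn_diff_triangle:
  assumes [measurable]: "f \<in> borel_measurable N" "g \<in> borel_measurable N" "h \<in> borel_measurable N"
  shows "sqn N (\<lambda>x. f x - h x) \<le> 2 * sqn N (\<lambda>x. f x - g x) + 2 * sqn N (\<lambda>x. g x - h x)"
  using sqn_add_le[of "\<lambda>x. f x - g x" N "\<lambda>x. g x - h x"] by simp

lemma sqn_le_diff:
  assumes [measurable]: "f \<in> borel_measurable N" "g \<in> borel_measurable N"
  shows "sqn N f \<le> 2 * sqn N (\<lambda>x. f x - g x) + 2 * sqn N g"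
  using sqn_add_le[of "\<lambda>x. f x - g x" N g] by simp

lemma sqn_diff_le:
  assumes [measurable]: "f \<in> borel_measurable N" "g \<in> borel_measurable N"
  shows "sqn N (\<lambda>x. f x - g x) \<le> 2 * sqn N f + 2 * sqn N g"
  using sqn_add_le[of f N "\<lambda>x. - g x"] by (simp add: sqn_def)

lemma sqn_indicator_le: "sqn N (\<lambda>x. indicator A x * f x) \<le> sqn N f"
  unfolding sqn_def by (intro nn_integral_mono ennreal_leI) (auto simp: indicator_def)

lemma sqn_indicator_tendsto:
  assumes [measurable]: "f \<in> borel_measurable N" "\<And>k. A k \<in> sets N"
    and fin: "sqn N f < \<infinity>" and A: "\<And>x. x \<in> space N \<Longrightarrow> eventually (\<lambda>k::nat. x \<in> A k) sequentially"
  shows "(\<lambda>k. sqn N (\<lambda>x. indicator (A k) x * f x - f x)) \<longlonglongrightarrow> 0"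
proof -
  have "(\<lambda>k. \<integral>\<^sup>+ x. ennreal ((norm (indicator (A k) x * f x - f x))\<^sup>2) \<partial>N) \<longlonglongrightarrow> (\<integral>\<^sup>+ x. 0 \<partial>N)"
  proof (rule nn_integral_dominated_convergence[where w="\<lambda>x. ennreal ((norm (f x))\<^sup>2)"])
    show "AE x in N. (\<lambda>k. ennreal ((norm (indicator (A k) x * f x - f x))\<^sup>2)) \<longlonglongrightarrow> 0"
    proof (rule AE_I2)
      fix x assume "x \<in> space N"
      from A[OF this] have "eventually (\<lambda>k. ennreal ((norm (indicator (A k) x * f x - f x))\<^sup>2) = 0) sequentially"
        by (rule eventually_mono) simp
      then show "(\<lambda>k. ennreal ((norm (indicator (A k) x * f x - f x))\<^sup>2)) \<longlonglongrightarrow> 0"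
        by (rule tendsto_eventually)
    qed
    show "AE x in N. ennreal ((norm (indicator (A k) x * f x - f x))\<^sup>2) \<le> ennreal ((norm (f x))\<^sup>2)" for k
      by (rule AE_I2) (auto simp: indicator_def)
  qed (use fin in \<open>auto simp: sqn_def\<close>)
  then show ?thesis by (simp add: sqn_def)
qed

definition sqn_Cauchy :: "'a measure \<Rightarrow> (nat \<Rightarrow> 'a \<Rightarrow> complex) \<Rightarrow> bool" where
  "sqn_Cauchy N f \<longleftrightarrow> (\<forall>e>0. \<exists>n0. \<forall>m\<ge>n0. \<forall>n\<ge>n0. sqn N (\<lambda>x. f m x - f n x) < e)"

lemma sqn_Cauchy_of_tendsto:
  assumes [measurable]: "\<And>n. f n \<in> borel_measurable N" "g \<in> borel_measurable N"
    and lim: "(\<lambda>n. sqn N (\<lambda>x. f n x - g x)) \<longlonglongrightarrow> 0"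
  shows "sqn_Cauchy N f"
  unfolding sqn_Cauchy_def
proof (intro allI impI)
  fix e :: ennreal assume e: "0 < e"
  have "(\<lambda>n. 4 * sqn N (\<lambda>x. f n x - g x)) \<longlonglongrightarrow> 4 * 0"
    by (intro tendsto_intros lim) auto
  then have "eventually (\<lambda>n. 4 * sqn N (\<lambda>x. f n x - g x) < e) sequentially"
    using e by (simp add: order_tendsto_iff)
  then obtain n0 where n0: "\<And>n. n \<ge> n0 \<Longrightarrow> 4 * sqn N (\<lambda>x. f n x - g x) < e"
    by (auto simp: eventually_sequentially)
  show "\<exists>n0. \<forall>m\<ge>n0. \<forall>n\<ge>n0. sqn N (\<lambda>x. f m x - f n x) < e"
  proof (intro exI allI impI)
    fix m n assume mn: "n0 \<le> m" "n0 \<le> n"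
    define a where "a = max (sqn N (\<lambda>x. f m x - g x)) (sqn N (\<lambda>x. f n x - g x))"
    have "sqn N (\<lambda>x. f m x - f n x) \<le> 2 * sqn N (\<lambda>x. f m x - g x) + 2 * sqn N (\<lambda>x. g x - f n x)"
      by (rule sqn_diff_triangle) auto
    also have "\<dots> \<le> 2 * a + 2 * a"
      unfolding sqn_minus_commute[of N g] a_def by (intro add_mono mult_left_mono) auto
    also have "\<dots> = 4 * a" by (simp add: distrib_right[symmetric])
    also have "\<dots> < e" using n0[OF mn(1)] n0[OF mn(2)] by (simp add: a_def max_def)
    finally show "sqn N (\<lambda>x. f m x - f n x) < e" .
  qed
qed

lemma sqn_Cauchy_mono:
  assumes "sqn_Cauchy N f" and "\<And>m n. sqn N' (\<lambda>x. f' m x - f' n x) \<le> sqn N (\<lambda>x. f m x - f n x)"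
  shows "sqn_Cauchy N' f'"
  unfolding sqn_Cauchy_def
proof (intro allI impI)
  fix e :: ennreal assume "0 < e"
  then obtain n0 where "\<And>m n. m \<ge> n0 \<Longrightarrow> n \<ge> n0 \<Longrightarrow> sqn N (\<lambda>x. f m x - f n x) < e"
    using assms(1) unfolding sqn_Cauchy_def by blast
  then show "\<exists>n0. \<forall>m\<ge>n0. \<forall>n\<ge>n0. sqn N' (\<lambda>x. f' m x - f' n x) < e"
    using order.strict_trans1[OF assms(2)] by blast
qed

text \<open>The limit is exhibited as a pointwise \<open>lim\<close> along a subsequence, so that
  measurability and exact periodicity of the \<open>f n\<close> pass on to it. Fast decay of the
  increments gives convergence almost everywhere, and Fatou gives convergence in norm.\<close>

theorem riesz_fischer:
  assumes [measurable]: "\<And>n. f n \<in> borel_measurable N" and Cauchy: "sqn_Cauchy N f"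
  obtains r :: "nat \<Rightarrow> nat" where "strict_mono r"
    "(\<lambda>n. sqn N (\<lambda>x. f n x - lim (\<lambda>k. f (r k) x))) \<longlonglongrightarrow> 0"
proof -
  have "\<exists>n0. \<forall>m\<ge>n0. \<forall>n\<ge>n0. sqn N (\<lambda>x. f m x - f n x) < ennreal ((1/4) ^ k)" for k :: nat
    using Cauchy unfolding sqn_Cauchy_def by simp
  then obtain n0 where n0: "\<And>k m n. n0 k \<le> m \<Longrightarrow> n0 k \<le> n \<Longrightarrow> sqn N (\<lambda>x. f m x - f n x) < ennreal ((1/4) ^ k)"
    by metis
  \<comment> \<open>The summand \<open>k\<close> makes \<open>r\<close> strictly increasing, and the
    sum keeps \<open>r k\<close> beyond \<open>n0 k\<close>.\<close>
  define r where "r k = k + (\<Sum>i\<le>k. n0 i)" for k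
  have r: "strict_mono r" by (rule strict_monoI_Suc) (simp add: r_def)
  have rn: "n0 k \<le> r k" "r k \<le> r (Suc k)" for k
  proof -
    have "n0 k \<le> (\<Sum>i\<le>k. n0 i)" by (rule member_le_sum) auto
    then show "n0 k \<le> r k" by (simp add: r_def)
  qed (simp add: r_def)
  define d where "d k x = f (r (Suc k)) x - f (r k) x" for k x
  have [measurable]: "d k \<in> borel_measurable N" for k unfolding d_def[abs_def] by simp
  have dk: "sqn N (d k) \<le> ennreal ((1/4) ^ k)" for k
    unfolding d_def using n0[OF order_trans[OF rn] rn(1)] by (rule less_imp_le)
  \<comment> \<open>Against increments with \<open>sqn\<close> at most \<open>4^-k\<close> the
    weights \<open>2^k\<close> still give a finite integral, so almost everywhere
    \<open>norm (d k x)\<close> is at most a constant times \<open>2^(-k/2)\<close>, which is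
    summable.\<close>
  have "(\<integral>\<^sup>+ x. (\<Sum>k. ennreal (2 ^ k) * ennreal ((norm (d k x))\<^sup>2)) \<partial>N) = (\<Sum>k. ennreal (2 ^ k) * sqn N (d k))"
  proof -
    have "(\<integral>\<^sup>+ x. (\<Sum>k. ennreal (2 ^ k) * ennreal ((norm (d k x))\<^sup>2)) \<partial>N)
      = (\<Sum>k. \<integral>\<^sup>+ x. ennreal (2 ^ k) * ennreal ((norm (d k x))\<^sup>2) \<partial>N)"
      by (rule nn_integral_suminf) measurable
    moreover have "(\<integral>\<^sup>+ x. ennreal (2 ^ k) * ennreal ((norm (d k x))\<^sup>2) \<partial>N) = ennreal (2 ^ k) * sqn N (d k)" for k
      unfolding sqn_def by (rule nn_integral_cmult) measurable
    ultimately show ?thesis by simp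
  qed
  also have "\<dots> \<le> (\<Sum>k. ennreal ((1/2) ^ k))"
  proof (rule suminf_le)
    fix k
    have "ennreal (2 ^ k) * sqn N (d k) \<le> ennreal (2 ^ k) * ennreal ((1/4) ^ k)"
      by (intro mult_left_mono dk) simp
    also have "\<dots> = ennreal ((1/2) ^ k)"
      by (subst ennreal_mult[symmetric]) (auto simp: power_mult_distrib[symmetric])
    finally show "ennreal (2 ^ k) * sqn N (d k) \<le> ennreal ((1/2) ^ k)" .
  qed auto
  also have "\<dots> = ennreal (\<Sum>k. (1/2) ^ k)"
    by (rule suminf_ennreal2) (auto simp: summable_geometric)
  finally have "(\<integral>\<^sup>+ x. (\<Sum>k. ennreal (2 ^ k) * ennreal ((norm (d k x))\<^sup>2)) \<partial>N) < \<infinity>"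
    by (rule order.strict_trans1) (simp only: infinity_ennreal_def ennreal_less_top)
  then have "(\<integral>\<^sup>+ x. (\<Sum>k. ennreal (2 ^ k) * ennreal ((norm (d k x))\<^sup>2)) \<partial>N) \<noteq> \<infinity>"
    by (rule less_imp_neq)
  then have "AE x in N. (\<Sum>k. ennreal (2 ^ k) * ennreal ((norm (d k x))\<^sup>2)) \<noteq> \<infinity>"
    by (rule nn_integral_noteq_infinite[rotated]) measurable
  then have conv: "AE x in N. (\<lambda>k. f (r k) x) \<longlonglongrightarrow> lim (\<lambda>k. f (r k) x)"
  proof eventually_elim
    fix x assume "(\<Sum>k. ennreal (2 ^ k) * ennreal ((norm (d k x))\<^sup>2)) \<noteq> \<infinity>"
    moreover have "\<exists>C. 0 \<le> C \<and> y = ennreal C" if "y \<noteq> \<infinity>" for y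
      using that by (cases y) auto
    ultimately obtain C where C: "0 \<le> C" "(\<Sum>k. ennreal (2 ^ k) * ennreal ((norm (d k x))\<^sup>2)) = ennreal C"
      by blast
    have bd: "norm (d k x) \<le> sqrt C * (sqrt (1/2)) ^ k" for k
    proof -
      have "ennreal (2 ^ k * (norm (d k x))\<^sup>2) = (\<Sum>i\<in>{k}. ennreal (2 ^ i) * ennreal ((norm (d i x))\<^sup>2))"
        by (simp add: ennreal_mult del: ennreal_power)
      also have "\<dots> \<le> (\<Sum>k. ennreal (2 ^ k) * ennreal ((norm (d k x))\<^sup>2))"
        by (rule sum_le_suminf) auto
      finally have "2 ^ k * (norm (d k x))\<^sup>2 \<le> C" using C by simp
      then have "(norm (d k x))\<^sup>2 \<le> C * (1/2) ^ k" by (simp add: field_simps power_one_over)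
      then have "norm (d k x) \<le> sqrt (C * (1/2) ^ k)" by (rule real_le_rsqrt)
      then show ?thesis by (simp add: real_sqrt_mult real_sqrt_power)
    qed
    have "summable (\<lambda>k. sqrt C * (sqrt (1/2)) ^ k)"
      by (intro summable_mult summable_geometric) auto
    then have "summable (\<lambda>k. norm (d k x))"
      by (rule summable_comparison_test') (use bd in auto)
    then have "summable (\<lambda>k. d k x)" by (rule summable_norm_cancel)
    then have "(\<lambda>k. f (r 0) x + (\<Sum>i<k. d i x)) \<longlonglongrightarrow> f (r 0) x + (\<Sum>i. d i x)"
      by (intro tendsto_intros summable_LIMSEQ)
    moreover have "f (r 0) x + (\<Sum>i<k. d i x) = f (r k) x" for k
      using sum_lessThan_telescope[of "\<lambda>k. f (r k) x" k] by (simp add: d_def)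
    ultimately have "convergent (\<lambda>k. f (r k) x)" by (auto simp: convergent_def)
    then show "(\<lambda>k. f (r k) x) \<longlonglongrightarrow> lim (\<lambda>k. f (r k) x)" by (simp add: convergent_LIMSEQ_iff)
  qed
  define F where "F x = lim (\<lambda>k. f (r k) x)" for x
  have [measurable]: "F \<in> borel_measurable N" unfolding F_def[abs_def] by measurable
  \<comment> \<open>Fatou along the subsequence; the Cauchy property then makes the right side
    small.\<close>
  have bound: "sqn N (\<lambda>x. f n x - F x) \<le> liminf (\<lambda>k. sqn N (\<lambda>x. f n x - f (r k) x))" for n
  proof -
    have "sqn N (\<lambda>x. f n x - F x) = (\<integral>\<^sup>+ x. liminf (\<lambda>k. ennreal ((norm (f n x - f (r k) x))\<^sup>2)) \<partial>N)"
      unfolding sqn_def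
    proof (rule nn_integral_cong_AE, use conv in eventually_elim)
      fix x assume "(\<lambda>k. f (r k) x) \<longlonglongrightarrow> lim (\<lambda>k. f (r k) x)"
      then have "(\<lambda>k. ennreal ((norm (f n x - f (r k) x))\<^sup>2)) \<longlonglongrightarrow> ennreal ((norm (f n x - F x))\<^sup>2)"
        unfolding F_def by (intro tendsto_intros)
      then show "ennreal ((norm (f n x - F x))\<^sup>2) = liminf (\<lambda>k. ennreal ((norm (f n x - f (r k) x))\<^sup>2))"
        by (rule lim_imp_Liminf[OF sequentially_bot, symmetric])
    qed
    also have "\<dots> \<le> liminf (\<lambda>k. sqn N (\<lambda>x. f n x - f (r k) x))"
      unfolding sqn_def by (rule nn_integral_liminf) measurable
    finally show ?thesis .
  qed
  have "(\<lambda>n. sqn N (\<lambda>x. f n x - F x)) \<longlonglongrightarrow> 0"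
  proof (rule order_tendstoI)
    fix e :: ennreal assume "0 < e"
    then obtain e' where e': "0 < e'" "e' < e" using dense by blast
    obtain n1 where n1: "\<And>m n. m \<ge> n1 \<Longrightarrow> n \<ge> n1 \<Longrightarrow> sqn N (\<lambda>x. f m x - f n x) < e'"
      using Cauchy e'(1) unfolding sqn_Cauchy_def by blast
    show "eventually (\<lambda>n. sqn N (\<lambda>x. f n x - F x) < e) sequentially"
      unfolding eventually_sequentially
    proof (intro exI allI impI)
      fix n assume n: "n1 \<le> n"
      have "eventually (\<lambda>k. sqn N (\<lambda>x. f n x - f (r k) x) \<le> e') sequentially"
        unfolding eventually_sequentially
        using n1[OF n] seq_suble[OF r] by (meson less_imp_le order_trans)
      then have "liminf (\<lambda>k. sqn N (\<lambda>x. f n x - f (r k) x)) \<le> liminf (\<lambda>k. e')"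
        by (rule Liminf_mono)
      also have "\<dots> = e'" by (simp add: Liminf_const)
      finally show "sqn N (\<lambda>x. f n x - F x) < e" using bound[of n] e'(2) by order
    qed
  qed auto
  then show ?thesis using that[OF r] by (simp add: F_def)
qed

lemma eLp_norm_two:
  "eLp_norm 2 N f = (if sqn N f = \<infinity> then \<infinity> else ennreal (sqrt (enn2real (sqn N f))))"
  by (simp add: eLp_norm_def sqn_def Let_def powr_numeral powr_half_sqrt)

lemma eLp_norm_two_squared: "(eLp_norm 2 N f)\<^sup>2 = sqn N f"
  by (auto simp: eLp_norm_two power2_eq_square ennreal_mult[symmetric] ennreal_enn2real_if)

lemma eLp_norm_two_finite: "eLp_norm 2 N f < \<infinity> \<longleftrightarrow> sqn N f < \<infinity>"
  by (auto simp: eLp_norm_two less_top)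

lemma eLp_norm_two_tendsto_0:
  "(\<lambda>n. eLp_norm 2 N (f n)) \<longlonglongrightarrow> 0 \<longleftrightarrow> (\<lambda>n. sqn N (f n)) \<longlonglongrightarrow> 0"
proof
  assume "(\<lambda>n. eLp_norm 2 N (f n)) \<longlonglongrightarrow> 0"
  then have "(\<lambda>n. eLp_norm 2 N (f n) * eLp_norm 2 N (f n)) \<longlonglongrightarrow> 0 * 0"
    by (intro tendsto_intros) auto
  then show "(\<lambda>n. sqn N (f n)) \<longlonglongrightarrow> 0"
    by (simp add: eLp_norm_two_squared[symmetric] power2_eq_square)
next
  assume *: "(\<lambda>n. sqn N (f n)) \<longlonglongrightarrow> 0"
  show "(\<lambda>n. eLp_norm 2 N (f n)) \<longlonglongrightarrow> 0"
  proof (rule order_tendstoI)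
    fix e :: ennreal assume "0 < e"
    then have "0 < e\<^sup>2" by (simp add: power2_eq_square ennreal_zero_less_mult_iff)
    then have "eventually (\<lambda>n. sqn N (f n) < e\<^sup>2) sequentially"
      using * by (simp add: order_tendsto_iff)
    then show "eventually (\<lambda>n. eLp_norm 2 N (f n) < e) sequentially"
    proof eventually_elim
      case (elim n)
      then show ?case unfolding eLp_norm_two_squared[symmetric]
        by (meson linorder_not_le power_mono zero_le)
    qed
  qed auto
qed

section \<open>Integrability and continuity of pairings\<close>

lemma nn_integral_mult_le_sqn:
  assumes [measurable]: "f \<in> borel_measurable N" "g \<in> borel_measurable N"
  shows "(\<integral>\<^sup>+ x. ennreal (norm (f x * g x)) \<partial>N)\<^sup>2 \<le> sqn N f * sqn N g"
  using Cauchy_Schwarz_nn_integral[of "\<lambda>x. ennreal (norm (f x))" N "\<lambda>x. ennreal (norm (g x))"]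
  by (simp add: sqn_def norm_mult ennreal_mult ennreal_power)

lemma integrable_mult_sqn:
  assumes [measurable]: "f \<in> borel_measurable N" "g \<in> borel_measurable N"
    and fin: "sqn N f < \<infinity>" "sqn N g < \<infinity>"
  shows "integrable N (\<lambda>x. f x * g x)"
proof (rule integrableI_bounded)
  have "(\<integral>\<^sup>+ x. ennreal (norm (f x * g x)) \<partial>N)\<^sup>2 < \<infinity>"
    using nn_integral_mult_le_sqn[of f N g] fin by (metis assms(1,2) ennreal_mult_less_top infinity_ennreal_def order.strict_trans1)
  then show "(\<integral>\<^sup>+ x. ennreal (norm (f x * g x)) \<partial>N) < \<infinity>"
    by (auto simp: power2_eq_square ennreal_mult_less_top less_top[symmetric])
qed measurable

text \<open>Cauchy-Schwarz. This carries identities for truncations over to their limits in the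
  mean.\<close>

lemma integral_mult_tendsto_sqn:
  assumes [measurable]: "\<And>n. f n \<in> borel_measurable N" "F \<in> borel_measurable N" "g \<in> borel_measurable N"
    and fin: "sqn N F < \<infinity>" "\<And>n. sqn N (f n) < \<infinity>" "sqn N g < \<infinity>"
    and lim: "(\<lambda>n. sqn N (\<lambda>x. f n x - F x)) \<longlonglongrightarrow> 0"
  shows "(\<lambda>n. LINT x|N. f n x * g x) \<longlonglongrightarrow> (LINT x|N. F x * g x)"
proof -
  have "(\<lambda>n. (LINT x|N. f n x * g x) - (LINT x|N. F x * g x)) \<longlonglongrightarrow> 0"
  proof -
    have eq: "(LINT x|N. f n x * g x) - (LINT x|N. F x * g x) = (LINT x|N. (f n x - F x) * g x)" for n
      by (subst Bochner_Integration.integral_diff[symmetric]) (auto intro!: integrable_mult_sqn fin simp: left_diff_distrib)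
    have le: "(ennreal (norm ((LINT x|N. f n x * g x) - (LINT x|N. F x * g x))))\<^sup>2 \<le> sqn N (\<lambda>x. f n x - F x) * sqn N g" for n
    proof -
      have "ennreal (norm (LINT x|N. (f n x - F x) * g x)) \<le> (\<integral>\<^sup>+ x. ennreal (norm ((f n x - F x) * g x)) \<partial>N)"
        by (rule norm_integral_le_nn_integral)
      then have "(ennreal (norm (LINT x|N. (f n x - F x) * g x)))\<^sup>2 \<le> (\<integral>\<^sup>+ x. ennreal (norm ((f n x - F x) * g x)) \<partial>N)\<^sup>2"
        by (intro power_mono) auto
      also have "\<dots> \<le> sqn N (\<lambda>x. f n x - F x) * sqn N g"
        by (rule nn_integral_mult_le_sqn) auto
      finally show ?thesis unfolding eq .
    qed
    define D where "D n = norm ((LINT x|N. f n x * g x) - (LINT x|N. F x * g x))" for n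
    have "(\<lambda>n. sqn N (\<lambda>x. f n x - F x) * sqn N g) \<longlonglongrightarrow> 0 * sqn N g"
      using fin(3) by (intro tendsto_mult_ennreal lim tendsto_const) auto
    then have lim0: "(\<lambda>n. sqn N (\<lambda>x. f n x - F x) * sqn N g) \<longlonglongrightarrow> 0" by simp
    have "(\<lambda>n. (ennreal (D n))\<^sup>2) \<longlonglongrightarrow> 0"
      by (rule tendsto_sandwich[OF _ _ tendsto_const[of 0] lim0]) (use le in \<open>simp_all add: D_def\<close>)
    then have "(\<lambda>n. (D n)\<^sup>2) \<longlonglongrightarrow> 0"
      by (simp add: D_def ennreal_power ennreal_tendsto_0_iff)
    then have "(\<lambda>n. sqrt ((D n)\<^sup>2)) \<longlonglongrightarrow> sqrt 0"
      by (rule tendsto_real_sqrt)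
    then show ?thesis unfolding D_def by (simp add: tendsto_norm_zero_iff)
  qed
  then show ?thesis by (rule LIM_zero_cancel)
qed

subsection \<open>Fourier inversion\<close>

definition period_cell :: "4 set \<Rightarrow> (real^4) set" where
  "period_cell J = {x. \<forall>i\<in>J. x $ i \<in> {0..2 * pi}}"

lemma M_measure_eq: "M_measure J = restrict_space lborel (period_cell J)"
  by (simp add: M_measure_def period_cell_def)

lemma period_cell_sets[measurable]: "period_cell J \<in> sets borel"
proof -
  have "period_cell J = {x \<in> space borel. \<forall>i\<in>J. x $ i \<in> {0..2 * pi}}" by (simp add: period_cell_def)
  then show ?thesis by simp
qed

text \<open>
  The \<open>\<sigma>\<close>-algebra of \<^term>\<open>M_measure J\<close> is restricted to the period cell; the same measure on all
  Borel sets is easier to work with.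
\<close>

definition cell_measure :: "4 set \<Rightarrow> (real^4) measure" where
  "cell_measure J = density lborel (indicator (period_cell J))"

lemma sets_cell_measure[measurable_cong, simp]: "sets (cell_measure J) = sets borel"
  by (simp add: cell_measure_def)

lemma space_cell_measure[simp]: "space (cell_measure J) = UNIV"
  by (simp add: cell_measure_def)

lemma emeasure_cell_measure_le:
  assumes "A \<in> sets borel"
  shows "emeasure (cell_measure J) A \<le> emeasure lborel A"
proof -
  have "emeasure (cell_measure J) A = (\<integral>\<^sup>+ x. indicator (period_cell J) x * indicator A x \<partial>lborel)"
    unfolding cell_measure_def using assms by (intro emeasure_density) auto
  also have "\<dots> \<le> (\<integral>\<^sup>+ x. indicator A x \<partial>lborel)"
    by (intro nn_integral_mono) (auto simp: indicator_def)
  finally show ?thesis using assms by simp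
qed

lemma sigma_finite_cell_measure: "sigma_finite_measure (cell_measure J)"
proof (rule sigma_finite_measure.intro, intro exI conjI ballI)
  show "countable (range (\<lambda>k::nat. cball (0 :: real^4) (real k)))" by simp
  show "range (\<lambda>k::nat. cball (0 :: real^4) (real k)) \<subseteq> sets (cell_measure J)" by auto
  show "\<Union> (range (\<lambda>k::nat. cball (0 :: real^4) (real k))) = space (cell_measure J)"
    by (auto simp: real_arch_simple)
  show "emeasure (cell_measure J) a \<noteq> \<infinity>" if "a \<in> range (\<lambda>k::nat. cball (0 :: real^4) (real k))" for a
  proof -
    from that obtain k where a: "a = cball 0 (real k)" by blast
    have "emeasure (cell_measure J) a \<le> emeasure lborel a"
      unfolding a by (rule emeasure_cell_measure_le) simp
    also have "\<dots> < \<infinity>" unfolding a by (rule emeasure_lborel_cball_finite)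
    finally show ?thesis by simp
  qed
qed

interpretation cell: sigma_finite_measure "cell_measure J" for J by (rule sigma_finite_cell_measure)
interpretation freq: sigma_finite_measure "freq_measure J" for J by (rule sigma_finite_freq_measure)

lemma nn_integral_M_measure:
  assumes [measurable]: "f \<in> borel_measurable borel"
  shows "(\<integral>\<^sup>+ x. f x \<partial>M_measure J) = (\<integral>\<^sup>+ x. f x \<partial>cell_measure J)"
proof -
  have "(\<integral>\<^sup>+ x. f x \<partial>M_measure J) = (\<integral>\<^sup>+ x. f x * indicator (period_cell J) x \<partial>lborel)"
    unfolding M_measure_eq by (rule nn_integral_restrict_space) simp
  also have "\<dots> = (\<integral>\<^sup>+ x. f x \<partial>cell_measure J)"
    unfolding cell_measure_def by (subst nn_integral_density) (auto simp: mult.commute)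
  finally show ?thesis .
qed

lemma integral_cell_measure:
  fixes f :: "real^4 \<Rightarrow> complex"
  assumes [measurable]: "f \<in> borel_measurable borel"
  shows "(LINT x|cell_measure J. f x) = (LINT x|lborel. indicator (period_cell J) x *\<^sub>R f x)"
proof -
  have "cell_measure J = density lborel (\<lambda>x. ennreal (indicator (period_cell J) x))"
    by (simp add: cell_measure_def ennreal_indicator)
  then show ?thesis by (simp only:) (rule integral_density, auto)
qed

lemma integrable_cell_measure:
  fixes f :: "real^4 \<Rightarrow> complex"
  assumes [measurable]: "f \<in> borel_measurable borel"
  shows "integrable (cell_measure J) f \<longleftrightarrow> integrable lborel (\<lambda>x. indicator (period_cell J) x *\<^sub>R f x)"
proof -
  have "cell_measure J = density lborel (\<lambda>x. ennreal (indicator (period_cell J) x))"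
    by (simp add: cell_measure_def ennreal_indicator)
  then show ?thesis by (simp only:) (rule integrable_density, auto)
qed

lemma integral_M_measure:
  fixes f :: "real^4 \<Rightarrow> complex"
  assumes [measurable]: "f \<in> borel_measurable borel"
  shows "(LINT x|M_measure J. f x) = (LINT x|cell_measure J. f x)"
  unfolding integral_cell_measure[OF assms] M_measure_eq by (rule integral_restrict_space) simp

section \<open>Fejer weights on M and their Fourier transforms\<close>

definition M_weight :: "4 set \<Rightarrow> real \<Rightarrow> real^4 \<Rightarrow> real" where
  "M_weight J e x = (\<Prod>i\<in>UNIV. if i \<in> J then 1 else fejer e (x $ i))"

text \<open>
  \<open>(2 \<pi>)\<^bsup>-4\<^esup>\<close> times the Fourier transform of \<^const>\<open>M_weight\<close> on \<^term>\<open>freq_space J\<close>. The periodic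
  coordinates need no weight, because the exponentials are orthogonal on the period cell.
\<close>

definition freq_kernel :: "4 set \<Rightarrow> real \<Rightarrow> real^4 \<Rightarrow> real" where
  "freq_kernel J e \<zeta> = (\<Prod>i\<in>UNIV. if i \<in> J then (if \<zeta> $ i = 0 then 1 else 0) else tri e (\<zeta> $ i))"

lemma borel_measurable_M_weight[measurable]: "M_weight J e \<in> borel_measurable borel"
  unfolding M_weight_def[abs_def] by measurable

lemma borel_measurable_freq_kernel[measurable]: "freq_kernel J e \<in> borel_measurable borel"
  unfolding freq_kernel_def[abs_def] by measurable

lemma M_weight_nonneg: "0 \<le> M_weight J e x"
  unfolding M_weight_def by (intro prod_nonneg) (auto simp: fejer_nonneg)

lemma M_weight_le_1: "M_weight J e x \<le> 1"
  unfolding M_weight_def by (intro prod_le_1) (auto simp: fejer_nonneg fejer_le_1)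

lemma M_weight_tendsto: "(\<lambda>e. M_weight J e x) \<midarrow>0\<rightarrow> 1"
proof -
  have "((\<lambda>e. \<Prod>i\<in>UNIV. if i \<in> J then 1 else fejer e (x $ i)) \<longlongrightarrow> (\<Prod>i\<in>(UNIV :: 4 set). 1)) (at 0)"
  proof (rule tendsto_prod)
    show "((\<lambda>e. if i \<in> J then 1 else fejer e (x $ i)) \<longlongrightarrow> 1) (at 0)" for i
      by (cases "i \<in> J") (auto intro: fejer_tendsto)
  qed
  then show ?thesis by (simp add: M_weight_def)
qed

lemma freq_kernel_nonneg: "0 < e \<Longrightarrow> 0 \<le> freq_kernel J e \<zeta>"
  unfolding freq_kernel_def by (intro prod_nonneg) (auto simp: tri_nonneg)

lemma freq_kernel_minus: "freq_kernel J e (- \<zeta>) = freq_kernel J e \<zeta>"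
  unfolding freq_kernel_def by (intro prod.cong) (auto simp: tri_minus)

lemma freq_kernel_eq_0:
  assumes "0 < e" "e \<le> \<bar>\<zeta> $ i\<bar>"
  shows "freq_kernel J e \<zeta> = 0"
  unfolding freq_kernel_def
proof (rule prod_zero)
  show "\<exists>i\<in>UNIV. (if i \<in> J then (if \<zeta> $ i = 0 then 1 else 0) else tri e (\<zeta> $ i)) = 0"
    using assms by (intro bexI[of _ i]) (auto simp: tri_eq_0)
qed simp

text \<open>A product of one-dimensional masses: a point mass at the integer
  \<open>\<xi> $ i\<close> under counting measure, or a triangle of area 1.\<close>

lemma nn_integral_freq_kernel:
  assumes "0 < e" "\<xi> \<in> freq_space J"
  shows "(\<integral>\<^sup>+ \<eta>. ennreal (freq_kernel J e (\<xi> - \<eta>)) \<partial>freq_measure J) = 1"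
proof -
  have "(\<integral>\<^sup>+ \<eta>. ennreal (freq_kernel J e (\<xi> - \<eta>)) \<partial>freq_measure J) =
    (\<integral>\<^sup>+ \<eta>. (\<Prod>i\<in>UNIV. (\<lambda>y. if i \<in> J then indicator {\<xi> $ i} y else ennreal (tri e (\<xi> $ i - y))) (\<eta> $ i)) \<partial>freq_measure J)"
    unfolding freq_kernel_def
    by (intro nn_integral_cong, subst prod_ennreal[symmetric])
      (auto intro!: prod.cong simp: tri_nonneg assms indicator_def)
  also have "\<dots> = (\<Prod>i\<in>UNIV. \<integral>\<^sup>+ y. (if i \<in> J then indicator {\<xi> $ i} y else ennreal (tri e (\<xi> $ i - y))) \<partial>coord_measure J i)"
    by (rule nn_integral_freq_measure_prod) simp
  also have "\<dots> = (\<Prod>i\<in>(UNIV :: 4 set). 1)"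
  proof (rule prod.cong[OF refl])
    fix i :: 4
    show "(\<integral>\<^sup>+ y. (if i \<in> J then indicator {\<xi> $ i} y else ennreal (tri e (\<xi> $ i - y))) \<partial>coord_measure J i) = 1"
    proof (cases "i \<in> J")
      case True
      then obtain k :: int where k: "\<xi> $ i = of_int k" using assms(2) by (auto simp: freq_space_def elim!: Ints_cases)
      have "real_of_int -` {real_of_int k} = {k}" by auto
      then show ?thesis using True by (simp add: coord_measure_def k emeasure_distr)
    next
      case False
      then show ?thesis using nn_integral_tri[OF assms(1)] by (simp add: coord_measure_def)
    qed
  qed
  finally show ?thesis by simp
qed

lemma cis_sum: "finite A \<Longrightarrow> cis (\<Sum>i\<in>A. f i) = (\<Prod>i\<in>A. cis (f i))"
  by (induction A rule: finite_induct) (auto simp: cis_mult[symmetric])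

text \<open>The integral factors over the coordinates, into orthogonality on a period for
  \<open>i \<in> J\<close> and the Fejer transform otherwise; each contributes one
  \<open>2 * pi\<close>.\<close>

lemma M_weight_cis:
  assumes e: "0 < e" and \<zeta>: "\<And>i. i \<in> J \<Longrightarrow> \<zeta> $ i \<in> \<int>"
  shows "integrable (cell_measure J) (\<lambda>x. complex_of_real (M_weight J e x) * cis (x \<bullet> \<zeta>))" (is ?int)
    and "(LINT x|cell_measure J. complex_of_real (M_weight J e x) * cis (x \<bullet> \<zeta>)) = complex_of_real ((2 * pi) ^ 4 * freq_kernel J e \<zeta>)" (is ?eq)
proof -
  define f where "f i x = (if i \<in> J then indicator {0..2 * pi} x *\<^sub>R cis (x * \<zeta> $ i)
    else complex_of_real (fejer e x) * cis (x * \<zeta> $ i))" for i :: 4 and x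
  have int: "integrable lborel (f i)" for i
  proof (cases "i \<in> J")
    case True
    have "integrable lborel (\<lambda>x. indicator {0..2 * pi} x *\<^sub>R cis (x * \<zeta> $ i))"
      by (intro borel_integrable_compact continuous_intros) auto
    then show ?thesis using True by (simp add: f_def[abs_def])
  next
    case False
    have "integrable lborel (\<lambda>x. complex_of_real (fejer e x) * cis (x * \<zeta> $ i))"
      by (rule Bochner_Integration.integrable_bound[OF integrable_fejer[OF e]]) (auto simp: norm_mult)
    then show ?thesis using False by (simp add: f_def[abs_def])
  qed
  have eq: "indicator (period_cell J) x *\<^sub>R (complex_of_real (M_weight J e x) * cis (x \<bullet> \<zeta>)) = (\<Prod>i\<in>UNIV. f i (x $ i))" for x
  proof -
    have "indicator (period_cell J) x = (\<Prod>i\<in>UNIV. if i \<in> J then indicator {0..2 * pi} (x $ i) else (1 :: complex))"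
    proof (cases "x \<in> period_cell J")
      case True
      then have "(\<Prod>i\<in>UNIV. if i \<in> J then indicator {0..2 * pi} (x $ i) else (1 :: complex)) = 1"
        by (intro prod.neutral) (auto simp: period_cell_def)
      then show ?thesis using True by simp
    next
      case False
      then show ?thesis by (auto simp: period_cell_def indicator_def intro!: prod_zero[symmetric])
    qed
    then have "indicator (period_cell J) x *\<^sub>R (complex_of_real (M_weight J e x) * cis (x \<bullet> \<zeta>)) =
      (\<Prod>i\<in>UNIV. if i \<in> J then indicator {0..2 * pi} (x $ i) else (1 :: complex)) *
      ((\<Prod>i\<in>UNIV. if i \<in> J then 1 else complex_of_real (fejer e (x $ i))) * (\<Prod>i\<in>UNIV. cis (x $ i * \<zeta> $ i)))"
      by (simp add: scaleR_conv_of_real of_real_indicator M_weight_def inner_vec_def cis_sum if_distrib[of complex_of_real] cong: if_cong)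
    also have "\<dots> = (\<Prod>i\<in>UNIV. f i (x $ i))"
      unfolding prod.distrib[symmetric]
      by (intro prod.cong) (auto simp: f_def scaleR_conv_of_real of_real_indicator)
    finally show ?thesis .
  qed
  show ?int
    by (subst integrable_cell_measure) (measurable, simp only: eq integrable_lborel_prod[OF int])
  have "(LINT x|cell_measure J. complex_of_real (M_weight J e x) * cis (x \<bullet> \<zeta>)) = (\<Prod>i\<in>UNIV. LINT x|lborel. f i x)"
    by (subst integral_cell_measure) (measurable, simp only: eq integral_lborel_prod[OF int])
  also have "\<dots> = (\<Prod>i\<in>UNIV. complex_of_real (2 * pi * (if i \<in> J then (if \<zeta> $ i = 0 then 1 else 0) else tri e (\<zeta> $ i))))"
  proof (rule prod.cong[OF refl])
    fix i
    show "(LINT x|lborel. f i x) = complex_of_real (2 * pi * (if i \<in> J then (if \<zeta> $ i = 0 then 1 else 0) else tri e (\<zeta> $ i)))"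
      using integral_period_cis[of "\<zeta> $ i"] \<zeta>[of i] integral_fejer_cis[OF e, of "\<zeta> $ i"]
      by (auto simp: f_def)
  qed
  also have "\<dots> = complex_of_real ((2 * pi) ^ 4 * freq_kernel J e \<zeta>)"
    by (simp add: prod.distrib freq_kernel_def)
  finally show ?eq .
qed

definition weighted_M :: "4 set \<Rightarrow> real \<Rightarrow> (real^4) measure" where
  "weighted_M J e = density (cell_measure J) (\<lambda>x. ennreal (M_weight J e x))"

lemma sets_weighted_M[measurable_cong, simp]: "sets (weighted_M J e) = sets borel"
  by (simp add: weighted_M_def)

lemma finite_weighted_M:
  assumes "0 < e"
  shows "finite_measure (weighted_M J e)"
proof (rule finite_measureI)
  \<comment> \<open>The zero frequency gives the weight itself.\<close>
  have "integrable (cell_measure J) (\<lambda>x. complex_of_real (M_weight J e x))"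
    using M_weight_cis(1)[OF assms, of J 0] by simp
  then have "(\<integral>\<^sup>+ x. ennreal (norm (complex_of_real (M_weight J e x))) \<partial>cell_measure J) < \<infinity>"
    unfolding integrable_iff_bounded by (rule conjunct2)
  then have "(\<integral>\<^sup>+ x. ennreal (M_weight J e x) \<partial>cell_measure J) < \<infinity>"
    by (simp only: norm_of_real abs_of_nonneg[OF M_weight_nonneg])
  moreover have "emeasure (weighted_M J e) (space (weighted_M J e)) = (\<integral>\<^sup>+ x. ennreal (M_weight J e x) \<partial>cell_measure J)"
  proof -
    have "emeasure (weighted_M J e) (space (weighted_M J e)) =
        (\<integral>\<^sup>+ x. ennreal (M_weight J e x) * indicator (space (cell_measure J)) x \<partial>cell_measure J)"
      unfolding weighted_M_def space_density by (rule emeasure_density) measurable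
    also have "\<dots> = (\<integral>\<^sup>+ x. ennreal (M_weight J e x) \<partial>cell_measure J)"
      by (rule nn_integral_cong) simp
    finally show ?thesis .
  qed
  ultimately show "emeasure (weighted_M J e) (space (weighted_M J e)) \<noteq> \<infinity>" by simp
qed

lemma integral_weighted_M:
  fixes f :: "real^4 \<Rightarrow> complex"
  assumes "f \<in> borel_measurable (cell_measure J)"
  shows "(LINT x|weighted_M J e. f x) = (LINT x|cell_measure J. complex_of_real (M_weight J e x) * f x)"
proof -
  have "(LINT x|weighted_M J e. f x) = (LINT x|cell_measure J. M_weight J e x *\<^sub>R f x)"
    unfolding weighted_M_def by (rule integral_density) (use assms in \<open>auto simp: M_weight_nonneg\<close>)
  then show ?thesis by (simp add: scaleR_conv_of_real)
qed

lemma bounded_phase_M: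
  assumes "0 < e"
  shows "bounded_phase (weighted_M J e) (freq_measure J) (\<lambda>x \<xi>. cis (x \<bullet> \<xi>))"
proof (rule bounded_phase.intro)
  show "(\<lambda>(x, \<xi>). cis (x \<bullet> \<xi>)) \<in> borel_measurable (weighted_M J e \<Otimes>\<^sub>M freq_measure J)"
    by measurable
qed (auto simp: finite_weighted_M[OF assms] sigma_finite_freq_measure)

lemma freq_space_diff: "\<xi> \<in> freq_space J \<Longrightarrow> \<eta> \<in> freq_space J \<Longrightarrow> \<xi> - \<eta> \<in> freq_space J"
  by (auto simp: freq_space_def)

lemma ker_weighted_M:
  assumes e: "0 < e" and "\<xi> \<in> freq_space J" "\<eta> \<in> freq_space J"
  shows "bounded_phase.ker (weighted_M J e) (\<lambda>x \<xi>. cis (x \<bullet> \<xi>)) \<xi> \<eta> = complex_of_real ((2 * pi) ^ 4 * freq_kernel J e (\<xi> - \<eta>))"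
proof -
  interpret bounded_phase "weighted_M J e" "freq_measure J" "\<lambda>x \<xi>. cis (x \<bullet> \<xi>)" by (rule bounded_phase_M[OF e])
  have "ker \<xi> \<eta> = (LINT x|weighted_M J e. cis (x \<bullet> (\<xi> - \<eta>)))"
    by (simp add: ker_def cis_cnj cis_mult inner_diff_right)
  also have "\<dots> = (LINT x|cell_measure J. complex_of_real (M_weight J e x) * cis (x \<bullet> (\<xi> - \<eta>)))"
    by (rule integral_weighted_M) simp
  also have "\<dots> = complex_of_real ((2 * pi) ^ 4 * freq_kernel J e (\<xi> - \<eta>))"
    using freq_space_diff[OF assms(2,3)] by (intro M_weight_cis e) (auto simp: freq_space_def)
  finally show ?thesis .
qed

text \<open>\<open>transf\<close> does not involve the weighted measure, so any positive
  \<open>e\<close> serves to enter the locale.\<close>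

lemma inv_fourier_transf:
  assumes "0 < (e :: real)"
  shows "inv_fourier J g = (\<lambda>x. (1 / (2 * pi)\<^sup>2) *\<^sub>R bounded_phase.transf (freq_measure J) (\<lambda>x \<xi>. cis (x \<bullet> \<xi>)) g x)"
  unfolding inv_fourier_def bounded_phase.transf_def[OF bounded_phase_M[OF assms]] ..

lemma inv_fourier_cong_AE:
  assumes [measurable]: "g \<in> borel_measurable borel" "h \<in> borel_measurable borel"
    and "AE \<xi> in freq_measure J. g \<xi> = h \<xi>"
  shows "inv_fourier J g = inv_fourier J h"
proof (rule ext)
  fix x
  have "(LINT \<xi>|freq_measure J. cis (x \<bullet> \<xi>) * g \<xi>) = (LINT \<xi>|freq_measure J. cis (x \<bullet> \<xi>) * h \<xi>)"
  proof (rule integral_cong_AE)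
    show "AE \<xi> in freq_measure J. cis (x \<bullet> \<xi>) * g \<xi> = cis (x \<bullet> \<xi>) * h \<xi>"
      using assms(3) by eventually_elim simp
  qed measurable
  then show "inv_fourier J g x = inv_fourier J h x" by (simp only: inv_fourier_def)
qed

lemma borel_measurable_inv_fourier:
  assumes [measurable]: "g \<in> borel_measurable borel"
  shows "inv_fourier J g \<in> borel_measurable borel"
proof -
  have "(\<lambda>x. LINT \<xi>|freq_measure J. cis (x \<bullet> \<xi>) * g \<xi>) \<in> borel_measurable borel" by measurable
  then show ?thesis unfolding inv_fourier_def[abs_def] by measurable
qed

lemma borel_measurable_freq_measure: "f \<in> borel_measurable (freq_measure J) \<longleftrightarrow> f \<in> borel_measurable borel"
  by (simp only: measurable_cong_sets[OF sets_freq_measure refl])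

definition eps_seq :: "nat \<Rightarrow> real" where "eps_seq n = inverse (real (Suc n))"

lemma eps_seq_pos: "0 < eps_seq n" by (simp add: eps_seq_def)

lemma eps_seq_tendsto: "eps_seq \<longlonglongrightarrow> 0"
  unfolding eps_seq_def[abs_def] by (rule LIMSEQ_inverse_real_of_nat)

lemma M_weight_eps_tendsto: "(\<lambda>n. M_weight J (eps_seq n) x) \<longlonglongrightarrow> 1"
proof (rule filterlim_compose[OF M_weight_tendsto filterlim_atI[OF eps_seq_tendsto]])
  show "\<forall>\<^sub>F n in sequentially. eps_seq n \<noteq> 0"
    by (rule always_eventually) (simp add: eps_seq_def)
qed

text \<open>Schur's test: the kernel is \<open>(2 * pi) ^ 4\<close> times
  \<open>freq_kernel\<close>, whose rows have mass 1, and the constant cancels against the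
  normalisation of \<open>inv_fourier\<close>. Fatou then removes the weight.\<close>

lemma sqn_inv_fourier_le:
  assumes g: "integrable (freq_measure J) g"
  shows "sqn (cell_measure J) (inv_fourier J g) \<le> sqn (freq_measure J) g"
proof -
  \<comment> \<open>The kernel formula is available on \<open>freq_space J\<close>, whose complement
    is a null set, so \<open>g\<close> is cut off there.\<close>
  define g' where "g' \<xi> = indicator (freq_space J) \<xi> * g \<xi>" for \<xi>
  have [measurable]: "g \<in> borel_measurable borel" using borel_measurable_integrable[OF g] borel_measurable_freq_measure by blast
  have [measurable]: "g' \<in> borel_measurable borel" unfolding g'_def[abs_def] by measurable
  have AE: "AE \<xi> in freq_measure J. g \<xi> = g' \<xi>"
    using AE_freq_space by eventually_elim (simp add: g'_def)
  have g': "integrable (freq_measure J) g'"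
    by (rule integrable_cong_AE[THEN iffD1, OF _ _ AE g]) auto
  have G: "inv_fourier J g = inv_fourier J g'" by (rule inv_fourier_cong_AE) (use AE in auto)
  have [measurable]: "inv_fourier J g' \<in> borel_measurable borel" by (rule borel_measurable_inv_fourier) simp
  have bound: "(\<integral>\<^sup>+ x. ennreal (M_weight J e x * (norm (inv_fourier J g' x))\<^sup>2) \<partial>cell_measure J) \<le> sqn (freq_measure J) g'"
    if e: "0 < e" for e
  proof -
    interpret bounded_phase "weighted_M J e" "freq_measure J" "\<lambda>x \<xi>. cis (x \<bullet> \<xi>)" by (rule bounded_phase_M[OF e])
    let ?c = "(2 * pi) ^ 4 :: real"
    have "(\<integral>\<^sup>+ x. ennreal ((norm (transf g' x))\<^sup>2) \<partial>weighted_M J e) \<le> ennreal ?c * (\<integral>\<^sup>+ \<xi>. ennreal ((norm (g' \<xi>))\<^sup>2) \<partial>freq_measure J)"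
    proof (rule schur_bound[OF g', where S="freq_space J" and \<kappa>="\<lambda>\<xi> \<eta>. ennreal ?c * ennreal (freq_kernel J e (\<xi> - \<eta>))"])
      fix \<xi> \<eta> assume "\<xi> \<in> freq_space J" "\<eta> \<in> freq_space J"
      then show "ennreal (norm (ker \<xi> \<eta>)) \<le> ennreal ?c * ennreal (freq_kernel J e (\<xi> - \<eta>))"
        using ker_weighted_M[OF e] freq_kernel_nonneg[OF e] by (simp add: norm_mult norm_power ennreal_mult abs_mult)
    next
      fix \<xi> assume "\<xi> \<in> freq_space J"
      have "(\<integral>\<^sup>+ \<eta>. ennreal ?c * ennreal (freq_kernel J e (\<xi> - \<eta>)) * indicator (freq_space J) \<eta> \<partial>freq_measure J)
        \<le> (\<integral>\<^sup>+ \<eta>. ennreal ?c * ennreal (freq_kernel J e (\<xi> - \<eta>)) \<partial>freq_measure J)"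
        by (intro nn_integral_mono) (auto simp: indicator_def)
      also have "\<dots> = ennreal ?c"
        using nn_integral_freq_kernel[OF e \<open>\<xi> \<in> freq_space J\<close>] by (subst nn_integral_cmult) auto
      finally show "(\<integral>\<^sup>+ \<eta>. ennreal ?c * ennreal (freq_kernel J e (\<xi> - \<eta>)) * indicator (freq_space J) \<eta> \<partial>freq_measure J) \<le> ennreal ?c" .
    next
      show "ennreal ?c * ennreal (freq_kernel J e (\<xi> - \<eta>)) = ennreal ?c * ennreal (freq_kernel J e (\<eta> - \<xi>))" for \<xi> \<eta>
        using freq_kernel_minus[of J e "\<xi> - \<eta>"] by simp
    qed (auto simp: g'_def)
    also have "(\<integral>\<^sup>+ x. ennreal ((norm (transf g' x))\<^sup>2) \<partial>weighted_M J e)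
      = (\<integral>\<^sup>+ x. ennreal ?c * ennreal (M_weight J e x * (norm (inv_fourier J g' x))\<^sup>2) \<partial>cell_measure J)"
      unfolding weighted_M_def inv_fourier_transf[OF e]
      using borel_measurable_transf[of g']
      by (subst nn_integral_density)
        (auto simp: ennreal_mult[symmetric] M_weight_nonneg power_divide power_mult[symmetric] intro!: nn_integral_cong arg_cong[where f=ennreal])
    also have "\<dots> = ennreal ?c * (\<integral>\<^sup>+ x. ennreal (M_weight J e x * (norm (inv_fourier J g' x))\<^sup>2) \<partial>cell_measure J)"
      by (rule nn_integral_cmult) simp
    finally show ?thesis
      by (subst (asm) ennreal_mult_le_mult_iff) (auto simp: sqn_def)
  qed
  have "sqn (cell_measure J) (inv_fourier J g') = (\<integral>\<^sup>+ x. liminf (\<lambda>n. ennreal (M_weight J (eps_seq n) x * (norm (inv_fourier J g' x))\<^sup>2)) \<partial>cell_measure J)"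
    unfolding sqn_def
  proof (rule nn_integral_cong)
    fix x
    have "(\<lambda>n. ennreal (M_weight J (eps_seq n) x * (norm (inv_fourier J g' x))\<^sup>2)) \<longlonglongrightarrow> ennreal (1 * (norm (inv_fourier J g' x))\<^sup>2)"
      by (intro tendsto_intros M_weight_eps_tendsto)
    from lim_imp_Liminf[OF sequentially_bot this]
    show "ennreal ((norm (inv_fourier J g' x))\<^sup>2) = liminf (\<lambda>n. ennreal (M_weight J (eps_seq n) x * (norm (inv_fourier J g' x))\<^sup>2))"
      by simp
  qed
  also have "\<dots> \<le> liminf (\<lambda>n. \<integral>\<^sup>+ x. ennreal (M_weight J (eps_seq n) x * (norm (inv_fourier J g' x))\<^sup>2) \<partial>cell_measure J)"
    by (rule nn_integral_liminf) simp
  also have "\<dots> \<le> liminf (\<lambda>n. sqn (freq_measure J) g')"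
    by (intro Liminf_mono always_eventually allI bound eps_seq_pos)
  also have "\<dots> = sqn (freq_measure J) g'" by (simp add: Liminf_const)
  also have "\<dots> = sqn (freq_measure J) g"
    unfolding sqn_def by (rule nn_integral_cong_AE) (use AE in eventually_elim, simp)
  finally show ?thesis unfolding G .
qed

section \<open>Parseval pairing through an approximate identity\<close>

lemma borel_measurable_cell_measure: "f \<in> borel_measurable (cell_measure J) \<longleftrightarrow> f \<in> borel_measurable borel"
  by (simp only: measurable_cong_sets[OF sets_cell_measure refl])

lemma norm_le_4:
  fixes x :: "real^4"
  assumes "\<And>i. \<bar>x $ i\<bar> \<le> e"
  shows "norm x \<le> 4 * e"
proof -
  have "norm x \<le> (\<Sum>i\<in>UNIV. \<bar>x $ i\<bar>)" by (rule norm_le_l1_cart)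
  also have "\<dots> \<le> (\<Sum>i\<in>(UNIV :: 4 set). e)" by (intro sum_mono assms)
  finally show ?thesis by simp
qed

text \<open>Parseval's identity with a weight: multiplication by the weight in \<open>x\<close>
  becomes convolution with \<open>freq_kernel\<close> in frequency.\<close>

lemma integral_inv_fourier_weighted:
  assumes e: "0 < e" and g: "integrable (freq_measure J) g" and h: "integrable (freq_measure J) h"
    and g0: "\<And>\<xi>. \<xi> \<notin> freq_space J \<Longrightarrow> g \<xi> = 0" and h0: "\<And>\<xi>. \<xi> \<notin> freq_space J \<Longrightarrow> h \<xi> = 0"
  shows "(LINT x|cell_measure J. complex_of_real (M_weight J e x) * (inv_fourier J g x * cnj (inv_fourier J h x)))
    = (LINT \<xi>|freq_measure J. g \<xi> * (LINT \<eta>|freq_measure J. cnj (h \<eta>) * complex_of_real (freq_kernel J e (\<xi> - \<eta>))))"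
proof -
  have [measurable]: "g \<in> borel_measurable borel" "h \<in> borel_measurable borel"
    using borel_measurable_integrable[OF g] borel_measurable_integrable[OF h] borel_measurable_freq_measure by blast+
  have [measurable]: "inv_fourier J g \<in> borel_measurable borel" "inv_fourier J h \<in> borel_measurable borel"
    by (rule borel_measurable_inv_fourier, simp)+
  interpret bounded_phase "weighted_M J e" "freq_measure J" "\<lambda>x \<xi>. cis (x \<bullet> \<xi>)" by (rule bounded_phase_M[OF e])
  let ?c = "complex_of_real ((2 * pi) ^ 4)"
  have c0: "?c \<noteq> 0" by simp
  have tr: "transf g x * cnj (transf h x) = ?c * (inv_fourier J g x * cnj (inv_fourier J h x))" for x
    unfolding inv_fourier_transf[OF e] by (simp add: scaleR_conv_of_real power2_eq_square eval_nat_numeral)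
  have "?c * (LINT x|cell_measure J. complex_of_real (M_weight J e x) * (inv_fourier J g x * cnj (inv_fourier J h x)))
    = (LINT x|cell_measure J. complex_of_real (M_weight J e x) * (transf g x * cnj (transf h x)))"
    unfolding tr Bochner_Integration.integral_mult_right_zero[symmetric] by (simp only: mult.left_commute)
  also have "\<dots> = (LINT x|weighted_M J e. transf g x * cnj (transf h x))"
    unfolding tr by (rule integral_weighted_M[symmetric]) simp
  also have "\<dots> = (LINT \<xi>|freq_measure J. LINT \<eta>|freq_measure J. g \<xi> * cnj (h \<eta>) * ker \<xi> \<eta>)"
    by (rule integral_transf_cnj[OF g h])
  also have "\<dots> = (LINT \<xi>|freq_measure J. LINT \<eta>|freq_measure J. (?c * g \<xi>) * (cnj (h \<eta>) * complex_of_real (freq_kernel J e (\<xi> - \<eta>))))"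
  proof (intro Bochner_Integration.integral_cong refl)
    fix \<xi> \<eta>
    show "g \<xi> * cnj (h \<eta>) * ker \<xi> \<eta> = (?c * g \<xi>) * (cnj (h \<eta>) * complex_of_real (freq_kernel J e (\<xi> - \<eta>)))"
    proof (cases "\<xi> \<in> freq_space J \<and> \<eta> \<in> freq_space J")
      case True
      then show ?thesis using ker_weighted_M[OF e, of \<xi> J \<eta>] by (simp add: mult_ac)
    qed (use g0 h0 in auto)
  qed
  also have "\<dots> = ?c * (LINT \<xi>|freq_measure J. g \<xi> * (LINT \<eta>|freq_measure J. cnj (h \<eta>) * complex_of_real (freq_kernel J e (\<xi> - \<eta>))))"
    unfolding Bochner_Integration.integral_mult_right_zero mult.assoc ..
  finally show ?thesis using c0 mult_left_cancel by blast
qed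

text \<open>\<open>freq_kernel J e\<close> has mass 1 and vanishes unless every coordinate is
  smaller than \<open>e\<close>, so it averages \<open>h\<close> near \<open>\<xi>\<close>. The
  second part is the majorant for dominated convergence.\<close>

lemma freq_kernel_approx:
  fixes h :: "real^4 \<Rightarrow> real"
  assumes \<xi>: "\<xi> \<in> freq_space J" and cont: "isCont h \<xi>" and [measurable]: "h \<in> borel_measurable borel"
    and bd: "\<And>\<eta>. \<bar>h \<eta>\<bar> \<le> H"
  shows "(\<lambda>n. LINT \<eta>|freq_measure J. complex_of_real (h \<eta>) * complex_of_real (freq_kernel J (eps_seq n) (\<xi> - \<eta>))) \<longlonglongrightarrow> complex_of_real (h \<xi>)"
    and "norm (LINT \<eta>|freq_measure J. complex_of_real (h \<eta>) * complex_of_real (freq_kernel J (eps_seq n) (\<xi> - \<eta>))) \<le> H"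
proof -
  let ?K = "\<lambda>n \<eta>. freq_kernel J (eps_seq n) (\<xi> - \<eta>)"
  have K0: "0 \<le> ?K n \<eta>" for n \<eta> by (rule freq_kernel_nonneg[OF eps_seq_pos])
  have K1: "(\<integral>\<^sup>+ \<eta>. ennreal (?K n \<eta>) \<partial>freq_measure J) = 1" for n by (rule nn_integral_freq_kernel[OF eps_seq_pos \<xi>])
  have Kint: "integrable (freq_measure J) (\<lambda>\<eta>. ?K n \<eta>)" for n
    by (rule integrableI_nonneg) (use K0 K1 in auto)
  have K1': "(LINT \<eta>|freq_measure J. ?K n \<eta>) = 1" for n
    using nn_integral_eq_integral[OF Kint, of n] K0 K1[of n] by (simp add: integral_nonneg_AE)
  have hKint: "integrable (freq_measure J) (\<lambda>\<eta>. h \<eta> * ?K n \<eta>)" for n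
  proof (rule Bochner_Integration.integrable_bound[OF integrable_mult_right[OF Kint[of n], of H]])
    show "AE \<eta> in freq_measure J. norm (h \<eta> * ?K n \<eta>) \<le> norm (H * ?K n \<eta>)"
    proof (rule AE_I2)
      fix \<eta>
      have "\<bar>h \<eta>\<bar> * \<bar>?K n \<eta>\<bar> \<le> \<bar>H\<bar> * \<bar>?K n \<eta>\<bar>" using bd[of \<eta>] by (intro mult_right_mono) auto
      then show "norm (h \<eta> * ?K n \<eta>) \<le> norm (H * ?K n \<eta>)" by (simp add: abs_mult)
    qed
  qed measurable
  have re: "(LINT \<eta>|freq_measure J. complex_of_real (h \<eta>) * complex_of_real (?K n \<eta>)) = complex_of_real (LINT \<eta>|freq_measure J. h \<eta> * ?K n \<eta>)" for n
    by (simp flip: of_real_mult)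
  have "\<bar>LINT \<eta>|freq_measure J. h \<eta> * ?K n \<eta>\<bar> \<le> (LINT \<eta>|freq_measure J. H * ?K n \<eta>)"
  proof (rule order_trans[OF integral_abs_bound integral_mono])
    show "integrable (freq_measure J) (\<lambda>\<eta>. \<bar>h \<eta> * ?K n \<eta>\<bar>)" using hKint by simp
    show "integrable (freq_measure J) (\<lambda>\<eta>. H * ?K n \<eta>)" using Kint by simp
    show "\<bar>h \<eta> * ?K n \<eta>\<bar> \<le> H * ?K n \<eta>" for \<eta>
      using mult_right_mono[OF bd[of \<eta>] K0[of n \<eta>]] K0[of n \<eta>] by (simp add: abs_mult)
  qed
  then show "norm (LINT \<eta>|freq_measure J. complex_of_real (h \<eta>) * complex_of_real (?K n \<eta>)) \<le> H"
    unfolding re norm_of_real using K1'[of n] by simp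
  have "(\<lambda>n. LINT \<eta>|freq_measure J. h \<eta> * ?K n \<eta>) \<longlonglongrightarrow> h \<xi>"
  proof (rule metric_LIMSEQ_I)
    fix r :: real assume r: "0 < r"
    then obtain d where d: "0 < d" "\<And>\<eta>. dist \<eta> \<xi> < d \<Longrightarrow> dist (h \<eta>) (h \<xi>) < r / 2"
      using cont unfolding continuous_at_eps_delta by (metis half_gt_zero)
    \<comment> \<open>Four coordinates below \<open>d / 4\<close> keep the norm below
      \<open>d\<close>.\<close>
    have "eventually (\<lambda>n. eps_seq n < d / 4) sequentially"
      by (rule order_tendstoD(2)[OF eps_seq_tendsto]) (use d(1) in simp)
    then obtain n0 where n0: "\<And>n. n \<ge> n0 \<Longrightarrow> eps_seq n < d / 4" by (auto simp: eventually_sequentially)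
    show "\<exists>n0. \<forall>n\<ge>n0. dist (LINT \<eta>|freq_measure J. h \<eta> * ?K n \<eta>) (h \<xi>) < r"
    proof (intro exI allI impI)
      fix n assume n: "n0 \<le> n"
      have "(LINT \<eta>|freq_measure J. h \<eta> * ?K n \<eta>) - h \<xi> = (LINT \<eta>|freq_measure J. h \<eta> * ?K n \<eta>) - (LINT \<eta>|freq_measure J. h \<xi> * ?K n \<eta>)"
        using K1'[of n] by simp
      also have "\<dots> = (LINT \<eta>|freq_measure J. (h \<eta> - h \<xi>) * ?K n \<eta>)"
        using hKint[of n] Kint[of n] by (subst Bochner_Integration.integral_diff[symmetric]) (auto simp: left_diff_distrib)
      finally have eq: "(LINT \<eta>|freq_measure J. h \<eta> * ?K n \<eta>) - h \<xi> = (LINT \<eta>|freq_measure J. (h \<eta> - h \<xi>) * ?K n \<eta>)" .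
      have "\<bar>LINT \<eta>|freq_measure J. (h \<eta> - h \<xi>) * ?K n \<eta>\<bar> \<le> (LINT \<eta>|freq_measure J. (r / 2) * ?K n \<eta>)"
      proof (rule order_trans[OF integral_abs_bound integral_mono])
        show "integrable (freq_measure J) (\<lambda>\<eta>. \<bar>(h \<eta> - h \<xi>) * ?K n \<eta>\<bar>)"
          using hKint[of n] Kint[of n] by (simp add: left_diff_distrib)
        show "integrable (freq_measure J) (\<lambda>\<eta>. (r / 2) * ?K n \<eta>)" using Kint by simp
        show "\<bar>(h \<eta> - h \<xi>) * ?K n \<eta>\<bar> \<le> (r / 2) * ?K n \<eta>" for \<eta>
        proof (cases "\<exists>i. eps_seq n \<le> \<bar>(\<xi> - \<eta>) $ i\<bar>")
          case True
          then obtain i where "eps_seq n \<le> \<bar>(\<xi> - \<eta>) $ i\<bar>" by blast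
          from freq_kernel_eq_0[OF eps_seq_pos this] have "?K n \<eta> = 0" .
          then show ?thesis by simp
        next
          case False
          then have "norm (\<xi> - \<eta>) \<le> 4 * eps_seq n" by (intro norm_le_4) (meson less_le_not_le linear)
          then have "dist \<eta> \<xi> < d" using n0[OF n] by (simp add: dist_norm norm_minus_commute)
          then have "\<bar>h \<eta> - h \<xi>\<bar> \<le> r / 2" using d(2) by (force simp: dist_real_def)
          from mult_right_mono[OF this K0[of n \<eta>]] show ?thesis
            using K0[of n \<eta>] by (simp only: abs_mult abs_of_nonneg)
        qed
      qed
      then have "\<bar>(LINT \<eta>|freq_measure J. h \<eta> * ?K n \<eta>) - h \<xi>\<bar> \<le> r / 2"
        unfolding eq using K1'[of n] by simp
      then show "dist (LINT \<eta>|freq_measure J. h \<eta> * ?K n \<eta>) (h \<xi>) < r" using r by (simp add: dist_real_def)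
    qed
  qed
  then show "(\<lambda>n. LINT \<eta>|freq_measure J. complex_of_real (h \<eta>) * complex_of_real (?K n \<eta>)) \<longlonglongrightarrow> complex_of_real (h \<xi>)"
    unfolding re by (rule tendsto_of_real)
qed

text \<open>The limit of \<open>integral_inv_fourier_weighted\<close> as the weight tends to 1, by
  dominated convergence on both sides. Continuity of \<open>h\<close> gives pointwise convergence of
  its averages; such test functions suffice for inversion.\<close>

lemma integral_inv_fourier_inv_fourier:
  fixes h :: "real^4 \<Rightarrow> real"
  assumes g: "integrable (freq_measure J) g" "sqn (freq_measure J) g < \<infinity>" and g0: "\<And>\<xi>. \<xi> \<notin> freq_space J \<Longrightarrow> g \<xi> = 0"
    and h: "integrable (freq_measure J) h" "sqn (freq_measure J) (\<lambda>\<xi>. complex_of_real (h \<xi>)) < \<infinity>"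
    and cont: "continuous_on UNIV h" and bd: "\<And>\<eta>. \<bar>h \<eta>\<bar> \<le> H"
  shows "(LINT x|cell_measure J. inv_fourier J g x * cnj (inv_fourier J (\<lambda>\<xi>. complex_of_real (h \<xi>)) x)) = (LINT \<xi>|freq_measure J. g \<xi> * complex_of_real (h \<xi>))"
proof -
  define h' where "h' \<xi> = indicator (freq_space J) \<xi> * complex_of_real (h \<xi>)" for \<xi>
  have [measurable]: "h \<in> borel_measurable borel" using cont by (rule borel_measurable_continuous_onI)
  have [measurable]: "h' \<in> borel_measurable borel" unfolding h'_def[abs_def] by measurable
  have [measurable]: "g \<in> borel_measurable borel"
    using borel_measurable_integrable[OF g(1)] borel_measurable_freq_measure by blast
  have AE: "AE \<xi> in freq_measure J. complex_of_real (h \<xi>) = h' \<xi>"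
    using AE_freq_space by eventually_elim (simp add: h'_def)
  have Gh: "inv_fourier J (\<lambda>\<xi>. complex_of_real (h \<xi>)) = inv_fourier J h'"
    by (rule inv_fourier_cong_AE[OF _ _ AE]) auto
  have hi: "integrable (freq_measure J) (\<lambda>\<xi>. complex_of_real (h \<xi>))" using h(1) by simp
  have h'i: "integrable (freq_measure J) h'"
    by (rule integrable_cong_AE[THEN iffD1, OF _ _ AE hi]) auto
  have [measurable]: "inv_fourier J g \<in> borel_measurable borel" "inv_fourier J h' \<in> borel_measurable borel"
    by (rule borel_measurable_inv_fourier, simp)+
  have "sqn (freq_measure J) h' \<le> sqn (freq_measure J) (\<lambda>\<xi>. complex_of_real (h \<xi>))"
    unfolding h'_def by (rule sqn_indicator_le)
  then have fin: "sqn (cell_measure J) (inv_fourier J g) < \<infinity>" "sqn (cell_measure J) (inv_fourier J h') < \<infinity>"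
    using sqn_inv_fourier_le[OF g(1)] sqn_inv_fourier_le[OF h'i] g(2) h(2) by (auto intro: order.strict_trans1 order_trans)
  have "sqn (cell_measure J) (\<lambda>x. cnj (inv_fourier J h' x)) < \<infinity>" using fin(2) by (simp add: sqn_def)
  then have int: "integrable (cell_measure J) (\<lambda>x. inv_fourier J g x * cnj (inv_fourier J h' x))"
    by (intro integrable_mult_sqn fin) auto
  have L: "(\<lambda>n. LINT x|cell_measure J. complex_of_real (M_weight J (eps_seq n) x) * (inv_fourier J g x * cnj (inv_fourier J h' x)))
    \<longlonglongrightarrow> (LINT x|cell_measure J. inv_fourier J g x * cnj (inv_fourier J h' x))"
  proof (rule integral_dominated_convergence[where w="\<lambda>x. norm (inv_fourier J g x * cnj (inv_fourier J h' x))"])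
    show "AE x in cell_measure J. (\<lambda>n. complex_of_real (M_weight J (eps_seq n) x) * (inv_fourier J g x * cnj (inv_fourier J h' x)))
      \<longlonglongrightarrow> inv_fourier J g x * cnj (inv_fourier J h' x)"
    proof (rule AE_I2)
      fix x
      have "(\<lambda>n. complex_of_real (M_weight J (eps_seq n) x) * (inv_fourier J g x * cnj (inv_fourier J h' x)))
        \<longlonglongrightarrow> complex_of_real 1 * (inv_fourier J g x * cnj (inv_fourier J h' x))"
        by (intro tendsto_intros M_weight_eps_tendsto)
      then show "(\<lambda>n. complex_of_real (M_weight J (eps_seq n) x) * (inv_fourier J g x * cnj (inv_fourier J h' x)))
        \<longlonglongrightarrow> inv_fourier J g x * cnj (inv_fourier J h' x)" by simp
    qed
    show "AE x in cell_measure J. norm (complex_of_real (M_weight J (eps_seq n) x) * (inv_fourier J g x * cnj (inv_fourier J h' x)))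
      \<le> norm (inv_fourier J g x * cnj (inv_fourier J h' x))" for n
    proof (rule AE_I2)
      fix x
      show "norm (complex_of_real (M_weight J (eps_seq n) x) * (inv_fourier J g x * cnj (inv_fourier J h' x)))
        \<le> norm (inv_fourier J g x * cnj (inv_fourier J h' x))"
        using mult_right_mono[OF M_weight_le_1[of J "eps_seq n" x], of "norm (inv_fourier J g x * cnj (inv_fourier J h' x))"]
        by (simp only: norm_mult norm_of_real abs_of_nonneg[OF M_weight_nonneg] mult_1 norm_ge_zero zero_le_mult_iff simp_thms)
    qed
  qed (use int in auto)
  have eq: "(LINT x|cell_measure J. complex_of_real (M_weight J (eps_seq n) x) * (inv_fourier J g x * cnj (inv_fourier J h' x)))
    = (LINT \<xi>|freq_measure J. g \<xi> * (LINT \<eta>|freq_measure J. complex_of_real (h \<eta>) * complex_of_real (freq_kernel J (eps_seq n) (\<xi> - \<eta>))))" for n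
  proof -
    have "(LINT \<eta>|freq_measure J. cnj (h' \<eta>) * complex_of_real (freq_kernel J (eps_seq n) (\<xi> - \<eta>)))
      = (LINT \<eta>|freq_measure J. complex_of_real (h \<eta>) * complex_of_real (freq_kernel J (eps_seq n) (\<xi> - \<eta>)))" for \<xi>
    proof (rule integral_cong_AE)
      show "AE \<eta> in freq_measure J. cnj (h' \<eta>) * complex_of_real (freq_kernel J (eps_seq n) (\<xi> - \<eta>)) =
        complex_of_real (h \<eta>) * complex_of_real (freq_kernel J (eps_seq n) (\<xi> - \<eta>))"
        using AE by eventually_elim (metis complex_cnj_complex_of_real)
    qed measurable
    then show ?thesis
      using integral_inv_fourier_weighted[OF eps_seq_pos g(1) h'i g0] by (simp add: h'_def)
  qed
  have gh: "integrable (freq_measure J) (\<lambda>\<xi>. H * norm (g \<xi>))" using g(1) by simp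
  have R: "(\<lambda>n. LINT \<xi>|freq_measure J. g \<xi> * (LINT \<eta>|freq_measure J. complex_of_real (h \<eta>) * complex_of_real (freq_kernel J (eps_seq n) (\<xi> - \<eta>))))
    \<longlonglongrightarrow> (LINT \<xi>|freq_measure J. g \<xi> * complex_of_real (h \<xi>))"
  proof (rule integral_dominated_convergence[OF _ _ gh])
    show "AE \<xi> in freq_measure J. (\<lambda>n. g \<xi> * (LINT \<eta>|freq_measure J. complex_of_real (h \<eta>) * complex_of_real (freq_kernel J (eps_seq n) (\<xi> - \<eta>))))
      \<longlonglongrightarrow> g \<xi> * complex_of_real (h \<xi>)"
      using AE_freq_space
    proof eventually_elim
      case (elim \<xi>)
      have "isCont h \<xi>" using cont by (simp add: continuous_on_eq_continuous_at)
      then show ?case by (intro tendsto_intros freq_kernel_approx(1)[OF elim _ _ bd]) auto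
    qed
    show "AE \<xi> in freq_measure J. norm (g \<xi> * (LINT \<eta>|freq_measure J. complex_of_real (h \<eta>) * complex_of_real (freq_kernel J (eps_seq n) (\<xi> - \<eta>))))
      \<le> H * norm (g \<xi>)" for n
      using AE_freq_space
    proof eventually_elim
      case (elim \<xi>)
      have "isCont h \<xi>" using cont by (simp add: continuous_on_eq_continuous_at)
      from freq_kernel_approx(2)[OF elim this _ bd, of n]
      have "norm (LINT \<eta>|freq_measure J. complex_of_real (h \<eta>) * complex_of_real (freq_kernel J (eps_seq n) (\<xi> - \<eta>))) \<le> H" by simp
      then show ?case unfolding norm_mult by (subst mult.commute) (intro mult_right_mono, auto)
    qed
  qed measurable
  show ?thesis unfolding Gh using LIMSEQ_unique[OF L R[folded eq]] .
qed

section \<open>The Fourier transform as an adjoint\<close>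

lemma integrable_fourier_product:
  assumes f: "integrable (cell_measure J) f" and g: "integrable (freq_measure J) g"
  shows "integrable (cell_measure J \<Otimes>\<^sub>M freq_measure J) (\<lambda>(x, \<xi>). f x * (cnj (g \<xi>) * cis (- (x \<bullet> \<xi>))))"
proof -
  interpret pair_sigma_finite "cell_measure J" "freq_measure J" ..
  have [measurable]: "g \<in> borel_measurable borel" "f \<in> borel_measurable borel"
    using borel_measurable_integrable[OF g] borel_measurable_integrable[OF f]
      borel_measurable_freq_measure borel_measurable_cell_measure by blast+
  have "integrable (cell_measure J \<Otimes>\<^sub>M freq_measure J) (\<lambda>(x, \<xi>). norm (f x) * norm (g \<xi>))"
    by (rule Fubini_integrable) (use f g in \<open>auto simp: case_prod_beta\<close>)
  then show ?thesis
    by (rule Bochner_Integration.integrable_bound) (auto simp: norm_mult)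
qed

lemma fourier_eq_cell:
  assumes [measurable]: "f \<in> borel_measurable borel"
  shows "fourier J f = (\<lambda>\<xi>. (1 / (2 * pi)\<^sup>2) *\<^sub>R (LINT x|cell_measure J. cis (- (x \<bullet> \<xi>)) * f x))"
  unfolding fourier_def[abs_def] by (subst integral_M_measure) auto

lemma borel_measurable_fourier:
  assumes [measurable]: "f \<in> borel_measurable borel"
  shows "fourier J f \<in> borel_measurable borel"
  unfolding fourier_eq_cell[OF assms] by measurable

text \<open>Fubini, hence for integrable functions; general square integrable ones enter later
  through truncations.\<close>

lemma fourier_adjoint:
  assumes f: "integrable (cell_measure J) f" and g: "integrable (freq_measure J) g"
  shows "(LINT \<xi>|freq_measure J. fourier J f \<xi> * cnj (g \<xi>)) = (LINT x|cell_measure J. f x * cnj (inv_fourier J g x))"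
proof -
  interpret pair_sigma_finite "cell_measure J" "freq_measure J" ..
  have [measurable]: "f \<in> borel_measurable borel"
    using borel_measurable_integrable[OF f] borel_measurable_cell_measure by blast
  let ?c = "complex_of_real (1 / (2 * pi)\<^sup>2)"
  have "(LINT \<xi>|freq_measure J. fourier J f \<xi> * cnj (g \<xi>))
    = (LINT \<xi>|freq_measure J. LINT x|cell_measure J. ?c * (f x * (cnj (g \<xi>) * cis (- (x \<bullet> \<xi>)))))"
  proof (intro Bochner_Integration.integral_cong refl)
    fix \<xi>
    have "fourier J f \<xi> * cnj (g \<xi>) = ?c * ((LINT x|cell_measure J. cis (- (x \<bullet> \<xi>)) * f x) * cnj (g \<xi>))"
      by (simp add: fourier_eq_cell scaleR_conv_of_real)
    also have "\<dots> = (LINT x|cell_measure J. ?c * ((cis (- (x \<bullet> \<xi>)) * f x) * cnj (g \<xi>)))"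
      by (simp only: Bochner_Integration.integral_mult_right_zero Bochner_Integration.integral_mult_left_zero)
    finally show "fourier J f \<xi> * cnj (g \<xi>) = (LINT x|cell_measure J. ?c * (f x * (cnj (g \<xi>) * cis (- (x \<bullet> \<xi>)))))"
      by (simp only: mult_ac)
  qed
  also have "\<dots> = ?c * (LINT \<xi>|freq_measure J. LINT x|cell_measure J. f x * (cnj (g \<xi>) * cis (- (x \<bullet> \<xi>))))"
    by (simp only: Bochner_Integration.integral_mult_right_zero)
  also have "\<dots> = ?c * (LINT x|cell_measure J. LINT \<xi>|freq_measure J. f x * (cnj (g \<xi>) * cis (- (x \<bullet> \<xi>))))"
    by (subst Fubini_integral[OF integrable_fourier_product[OF f g]]) (rule refl)
  also have "\<dots> = (LINT x|cell_measure J. f x * cnj (inv_fourier J g x))"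
  proof -
    have "cnj (inv_fourier J g x) = ?c * (LINT \<xi>|freq_measure J. cnj (g \<xi>) * cis (- (x \<bullet> \<xi>)))" for x
    proof -
      have "cnj (LINT \<xi>|freq_measure J. cis (x \<bullet> \<xi>) * g \<xi>) = (LINT \<xi>|freq_measure J. cnj (cis (x \<bullet> \<xi>) * g \<xi>))"
        by (rule Bochner_Integration.integral_cnj[symmetric])
      then show ?thesis by (simp add: inv_fourier_def scaleR_conv_of_real cis_cnj mult.commute)
    qed
    then show ?thesis by (simp only: Bochner_Integration.integral_mult_right_zero mult.left_commute[of _ ?c])
  qed
  finally show ?thesis .
qed

lemma sqn_M_measure: "f \<in> borel_measurable borel \<Longrightarrow> sqn (M_measure J) f = sqn (cell_measure J) f"
  unfolding sqn_def by (rule nn_integral_M_measure) measurable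

lemma integrable_indicator_mult_sqn:
  assumes [measurable]: "f \<in> borel_measurable N" "A \<in> sets N" and A: "emeasure N A < \<infinity>" and fin: "sqn N f < \<infinity>"
  shows "integrable N (\<lambda>x. indicator A x * f x)"
proof (rule integrable_mult_sqn)
  have "sqn N (indicator A) = emeasure N A"
  proof -
    have "sqn N (indicator A) = (\<integral>\<^sup>+ x. indicator A x \<partial>N)"
      unfolding sqn_def by (intro nn_integral_cong) (auto simp: indicator_def)
    then show ?thesis by simp
  qed
  then show "sqn N (indicator A) < \<infinity>" using A by simp
qed (use fin in auto)

lemma sqn_fourier_le:
  assumes f: "integrable (cell_measure J) f"
  shows "sqn (freq_measure J) (fourier J f) \<le> sqn (cell_measure J) f"
proof -
  have [measurable]: "f \<in> borel_measurable borel"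
    using borel_measurable_integrable[OF f] borel_measurable_cell_measure by blast
  have [measurable]: "fourier J f \<in> borel_measurable borel" by (rule borel_measurable_fourier) simp
  define B where "B = 1 / (2 * pi)\<^sup>2 * (LINT x|cell_measure J. norm (f x))"
  have B: "norm (fourier J f \<xi>) \<le> B" for \<xi>
  proof -
    have "norm (LINT x|cell_measure J. cis (- (x \<bullet> \<xi>)) * f x) \<le> (LINT x|cell_measure J. norm (cis (- (x \<bullet> \<xi>)) * f x))"
      by (rule integral_norm_bound)
    also have "\<dots> = (LINT x|cell_measure J. norm (f x))" by (simp add: norm_mult)
    finally have "1 / (2 * pi)\<^sup>2 * norm (LINT x|cell_measure J. cis (- (x \<bullet> \<xi>)) * f x) \<le> B"
      unfolding B_def by (intro mult_left_mono) auto
    then show ?thesis by (simp add: fourier_eq_cell)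
  qed
  \<comment> \<open>Truncation makes the norm finite, so that half of it can be absorbed
    below.\<close>
  define A where "A k = freq_cube (real k)" for k :: nat
  have [measurable]: "A k \<in> sets borel" for k by (simp add: A_def)
  \<comment> \<open>Duality: test \<open>fourier J f\<close> against its own truncation and use the bound for the adjoint.\<close>
  have bound: "sqn (freq_measure J) (\<lambda>\<xi>. indicator (A k) \<xi> * fourier J f \<xi>) \<le> sqn (cell_measure J) f" for k
  proof -
    define g where "g \<xi> = indicator (A k) \<xi> * fourier J f \<xi>" for \<xi>
    have [measurable]: "g \<in> borel_measurable borel" unfolding g_def[abs_def] by measurable
    have Afin: "emeasure (freq_measure J) (A k) < \<infinity>" unfolding A_def by (rule emeasure_freq_cube)
    have gint: "integrable (freq_measure J) g"
    proof (rule Bochner_Integration.integrable_bound)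
      show "integrable (freq_measure J) (\<lambda>\<xi>. B * indicator (A k) \<xi>)"
        using Afin by (intro integrable_mult_right integrable_real_indicator) auto
      show "AE \<xi> in freq_measure J. norm (g \<xi>) \<le> norm (B * indicator (A k) \<xi>)"
        using B by (intro AE_I2) (auto simp: g_def indicator_def intro: order_trans[OF _ abs_ge_self])
    qed simp
    have gfin: "sqn (freq_measure J) g < \<infinity>"
    proof -
      have "sqn (freq_measure J) g \<le> (\<integral>\<^sup>+ \<xi>. ennreal (B\<^sup>2) * indicator (A k) \<xi> \<partial>freq_measure J)"
        unfolding sqn_def using B
        by (intro nn_integral_mono) (auto simp: g_def indicator_def intro!: ennreal_leI power_mono)
      also have "\<dots> = ennreal (B\<^sup>2) * emeasure (freq_measure J) (A k)" by (rule nn_integral_cmult_indicator) simp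
      also have "\<dots> < \<infinity>" using Afin by (simp add: ennreal_mult_less_top)
      finally show ?thesis .
    qed
    have Gm[measurable]: "inv_fourier J g \<in> borel_measurable borel" by (rule borel_measurable_inv_fourier) simp
    have sq: "fourier J f \<xi> * cnj (g \<xi>) = complex_of_real ((norm (g \<xi>))\<^sup>2)" for \<xi>
      by (auto simp: g_def indicator_def complex_norm_square simp flip: of_real_power)
    have "sqn (freq_measure J) g = ennreal (LINT \<xi>|freq_measure J. (norm (g \<xi>))\<^sup>2)"
      unfolding sqn_def
    proof (rule nn_integral_eq_integral)
      show "integrable (freq_measure J) (\<lambda>\<xi>. (norm (g \<xi>))\<^sup>2)"
        by (rule integrableI_nonneg) (use gfin in \<open>auto simp: sqn_def\<close>)
    qed auto
    also have "(LINT \<xi>|freq_measure J. (norm (g \<xi>))\<^sup>2) = norm (complex_of_real (LINT \<xi>|freq_measure J. (norm (g \<xi>))\<^sup>2))"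
      by (simp add: integral_nonneg_AE)
    also have "complex_of_real (LINT \<xi>|freq_measure J. (norm (g \<xi>))\<^sup>2) = (LINT \<xi>|freq_measure J. fourier J f \<xi> * cnj (g \<xi>))"
      unfolding sq integral_complex_of_real ..
    also have "\<dots> = (LINT x|cell_measure J. f x * cnj (inv_fourier J g x))"
      by (rule fourier_adjoint[OF f gint])
    also have "ennreal (norm \<dots>) \<le> (\<integral>\<^sup>+ x. ennreal (norm (f x * cnj (inv_fourier J g x))) \<partial>cell_measure J)"
      by (rule norm_integral_le_nn_integral)
    also have "\<dots> \<le> (\<integral>\<^sup>+ x. ennreal (1/2) * ennreal ((norm (f x))\<^sup>2) + ennreal (1/2) * ennreal ((norm (inv_fourier J g x))\<^sup>2) \<partial>cell_measure J)"
    proof (rule nn_integral_mono)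
      fix x
      have le: "norm (f x * cnj (inv_fourier J g x)) \<le> (1/2) * (norm (f x))\<^sup>2 + (1/2) * (norm (inv_fourier J g x))\<^sup>2"
        using sum_squares_bound[of "norm (f x)" "norm (inv_fourier J g x)"] by (simp add: norm_mult)
      have half: "ennreal (1/2 * z) = ennreal (1/2) * ennreal z" for z by (rule ennreal_mult') simp
      from ennreal_leI[OF le] show "ennreal (norm (f x * cnj (inv_fourier J g x))) \<le>
        ennreal (1/2) * ennreal ((norm (f x))\<^sup>2) + ennreal (1/2) * ennreal ((norm (inv_fourier J g x))\<^sup>2)"
        unfolding half[symmetric] by (subst (asm) ennreal_plus) auto
    qed
    also have "\<dots> = ennreal (1/2) * sqn (cell_measure J) f + ennreal (1/2) * sqn (cell_measure J) (inv_fourier J g)"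
      unfolding sqn_def by (simp add: nn_integral_add nn_integral_cmult)
    also have "\<dots> \<le> ennreal (1/2) * sqn (cell_measure J) f + ennreal (1/2) * sqn (freq_measure J) g"
      by (intro add_mono mult_left_mono sqn_inv_fourier_le gint) auto
    finally have le: "sqn (freq_measure J) g \<le> ennreal (1/2) * sqn (cell_measure J) f + ennreal (1/2) * sqn (freq_measure J) g" .
    \<comment> \<open>From \<open>b \<le> a / 2 + b / 2\<close>, where \<open>b\<close> is
      finite.\<close>
    have "sqn (freq_measure J) g \<le> sqn (cell_measure J) f"
    proof (cases "sqn (cell_measure J) f = \<infinity>")
      case False
      obtain a where a: "0 \<le> a" "sqn (cell_measure J) f = ennreal a" using False by (cases "sqn (cell_measure J) f") auto
      obtain b where b: "0 \<le> b" "sqn (freq_measure J) g = ennreal b" using gfin by (cases "sqn (freq_measure J) g") auto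
      have "ennreal (1/2 * a + 1/2 * b) = ennreal (1/2) * ennreal a + ennreal (1/2) * ennreal b"
        using a(1) b(1) by (simp add: ennreal_mult'[of "1/2", symmetric] del: ennreal_half)
      then have "ennreal b \<le> ennreal (1/2 * a + 1/2 * b)" using le a b by simp
      then have "b \<le> 1/2 * a + 1/2 * b" using a(1) b(1) by (subst (asm) ennreal_le_iff) auto
      then show ?thesis using a b by simp
    qed simp
    then show ?thesis unfolding g_def[abs_def] .
  qed
  have "sqn (freq_measure J) (fourier J f) = (\<integral>\<^sup>+ \<xi>. liminf (\<lambda>k. ennreal ((norm (indicator (A k) \<xi> * fourier J f \<xi>))\<^sup>2)) \<partial>freq_measure J)"
    unfolding sqn_def
  proof (rule nn_integral_cong)
    fix \<xi>
    obtain k0 :: nat where k0: "\<xi> \<in> freq_cube (real k0)" using UN_freq_cube by blast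
    have "eventually (\<lambda>k. \<xi> \<in> A k) sequentially"
      unfolding eventually_sequentially A_def freq_cube_def mem_Collect_eq
      using k0 by (intro exI[of _ k0]) (force simp: freq_cube_def intro: order_trans)
    then have "eventually (\<lambda>k. ennreal ((norm (indicator (A k) \<xi> * fourier J f \<xi>))\<^sup>2) = ennreal ((norm (fourier J f \<xi>))\<^sup>2)) sequentially"
      by (rule eventually_mono) simp
    then have "(\<lambda>k. ennreal ((norm (indicator (A k) \<xi> * fourier J f \<xi>))\<^sup>2)) \<longlonglongrightarrow> ennreal ((norm (fourier J f \<xi>))\<^sup>2)"
      by (rule tendsto_eventually)
    then show "ennreal ((norm (fourier J f \<xi>))\<^sup>2) = liminf (\<lambda>k. ennreal ((norm (indicator (A k) \<xi> * fourier J f \<xi>))\<^sup>2))"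
      by (rule lim_imp_Liminf[OF sequentially_bot, symmetric])
  qed
  also have "\<dots> \<le> liminf (\<lambda>k. sqn (freq_measure J) (\<lambda>\<xi>. indicator (A k) \<xi> * fourier J f \<xi>))"
    unfolding sqn_def by (rule nn_integral_liminf) measurable
  also have "\<dots> \<le> liminf (\<lambda>k. sqn (cell_measure J) f)"
    by (intro Liminf_mono always_eventually allI bound)
  finally show ?thesis by (simp add: Liminf_const)
qed

section \<open>The Fourier transform on square integrable functions\<close>

lemma fourier_diff:
  assumes f: "integrable (cell_measure J) f" and g: "integrable (cell_measure J) g"
  shows "fourier J f \<xi> - fourier J g \<xi> = fourier J (\<lambda>x. f x - g x) \<xi>"
proof -
  have [measurable]: "f \<in> borel_measurable borel" "g \<in> borel_measurable borel"
    using borel_measurable_integrable[OF f] borel_measurable_integrable[OF g] borel_measurable_cell_measure by blast+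
  have int: "integrable (cell_measure J) (\<lambda>x. cis (- (x \<bullet> \<xi>)) * f x)" if "integrable (cell_measure J) f" for f
  proof -
    have [measurable]: "f \<in> borel_measurable borel"
      using borel_measurable_integrable[OF that] borel_measurable_cell_measure by blast
    show ?thesis
      by (rule Bochner_Integration.integrable_bound[OF that]) (auto simp: norm_mult)
  qed
  have "(LINT x|cell_measure J. cis (- (x \<bullet> \<xi>)) * (f x - g x)) =
    (LINT x|cell_measure J. cis (- (x \<bullet> \<xi>)) * f x) - (LINT x|cell_measure J. cis (- (x \<bullet> \<xi>)) * g x)"
    unfolding right_diff_distrib by (rule Bochner_Integration.integral_diff[OF int[OF f] int[OF g]])
  then show ?thesis by (simp add: fourier_eq_cell scaleR_right_diff_distrib)
qed

text \<open>The truncation that occurs in the definition of \<open>fourier_L2\<close>.\<close>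

definition cut :: "nat \<Rightarrow> (real^4 \<Rightarrow> complex) \<Rightarrow> real^4 \<Rightarrow> complex" where
  "cut k f x = indicator (cball 0 (real k)) x * f x"

lemma borel_measurable_cut[measurable]: "f \<in> borel_measurable borel \<Longrightarrow> cut k f \<in> borel_measurable borel"
  unfolding cut_def[abs_def] by (intro borel_measurable_times borel_measurable_indicator) auto

lemma emeasure_cell_cball: "emeasure (cell_measure J) (cball 0 r) < \<infinity>"
  by (rule order.strict_trans1[OF emeasure_cell_measure_le emeasure_lborel_cball_finite]) simp

lemma integrable_cut:
  assumes [measurable]: "f \<in> borel_measurable borel" and "sqn (cell_measure J) f < \<infinity>"
  shows "integrable (cell_measure J) (cut k f)"
  unfolding cut_def[abs_def]
  by (rule integrable_indicator_mult_sqn) (use assms emeasure_cell_cball in auto)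

lemma sqn_cut_tendsto:
  assumes [measurable]: "f \<in> borel_measurable borel" and "sqn (cell_measure J) f < \<infinity>"
  shows "(\<lambda>k. sqn (cell_measure J) (\<lambda>x. cut k f x - f x)) \<longlonglongrightarrow> 0"
  unfolding cut_def
proof (rule sqn_indicator_tendsto)
  show "\<forall>\<^sub>F k in sequentially. x \<in> cball 0 (real k)" for x :: "real^4"
  proof -
    obtain n :: nat where "norm x \<le> real n" using real_arch_simple by blast
    then show ?thesis unfolding eventually_sequentially by (intro exI[of _ n]) auto
  qed
qed (use assms in auto)

lemma fourier_cut_Cauchy:
  assumes [measurable]: "f \<in> borel_measurable borel" and fin: "sqn (cell_measure J) f < \<infinity>"
  shows "sqn_Cauchy (freq_measure J) (\<lambda>k. fourier J (cut k f))"
proof (rule sqn_Cauchy_mono)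
  show "sqn_Cauchy (cell_measure J) (\<lambda>k. cut k f)"
    by (rule sqn_Cauchy_of_tendsto[OF _ _ sqn_cut_tendsto[OF assms]]) auto
  show "sqn (freq_measure J) (\<lambda>\<xi>. fourier J (cut m f) \<xi> - fourier J (cut n f) \<xi>)
    \<le> sqn (cell_measure J) (\<lambda>x. cut m f x - cut n f x)" for m n
    unfolding fourier_diff[OF integrable_cut[OF assms] integrable_cut[OF assms]]
    by (rule sqn_fourier_le) (simp add: integrable_cut[OF assms])
qed

lemma sqn_fourier_cut: 
  assumes [measurable]: "f \<in> borel_measurable borel" and fin: "sqn (cell_measure J) f < \<infinity>"
  shows "sqn (freq_measure J) (fourier J (cut k f)) \<le> sqn (cell_measure J) f"
  by (rule order_trans[OF sqn_fourier_le[OF integrable_cut[OF assms]]])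
    (unfold cut_def[abs_def], rule sqn_indicator_le)

text \<open>The choice in \<open>fourier_L2\<close> needs a witness. The transforms of the
  truncations form a Cauchy sequence by \<open>sqn_fourier_le\<close>, and
  \<open>riesz_fischer\<close> supplies its limit.\<close>

lemma fourier_L2_spec:
  assumes [measurable]: "f \<in> borel_measurable borel" and fin: "sqn (cell_measure J) f < \<infinity>"
  shows "fourier_L2 J f \<in> borel_measurable borel"
    and "sqn (freq_measure J) (fourier_L2 J f) < \<infinity>"
    and "(\<lambda>k. sqn (freq_measure J) (\<lambda>\<xi>. fourier J (cut k f) \<xi> - fourier_L2 J f \<xi>)) \<longlonglongrightarrow> 0"
proof -
  have [measurable]: "fourier J (cut k f) \<in> borel_measurable borel" for k by (rule borel_measurable_fourier) simp
  obtain r :: "nat \<Rightarrow> nat" where lim: "(\<lambda>k. sqn (freq_measure J) (\<lambda>\<xi>. fourier J (cut k f) \<xi> - lim (\<lambda>j. fourier J (cut (r j) f) \<xi>))) \<longlonglongrightarrow> 0"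
    by (rule riesz_fischer[OF _ fourier_cut_Cauchy[OF assms]]) auto
  define g where "g \<xi> = lim (\<lambda>j. fourier J (cut (r j) f) \<xi>)" for \<xi>
  have [measurable]: "g \<in> borel_measurable borel" unfolding g_def[abs_def] by measurable
  have lim': "(\<lambda>k. sqn (freq_measure J) (\<lambda>\<xi>. g \<xi> - fourier J (cut k f) \<xi>)) \<longlonglongrightarrow> 0"
    using lim unfolding g_def[symmetric] by (subst sqn_minus_commute)
  have "sqn (freq_measure J) g < \<infinity>"
  proof -
    have "eventually (\<lambda>k. sqn (freq_measure J) (\<lambda>\<xi>. g \<xi> - fourier J (cut k f) \<xi>) < 1) sequentially"
      by (rule order_tendstoD(2)[OF lim']) simp
    then obtain k where k: "sqn (freq_measure J) (\<lambda>\<xi>. g \<xi> - fourier J (cut k f) \<xi>) < 1"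
      by (auto simp: eventually_sequentially)
    have "sqn (freq_measure J) g \<le> 2 * sqn (freq_measure J) (\<lambda>\<xi>. g \<xi> - fourier J (cut k f) \<xi>) + 2 * sqn (freq_measure J) (fourier J (cut k f))"
      by (rule sqn_le_diff) auto
    also have "\<dots> \<le> 2 * 1 + 2 * sqn (cell_measure J) f"
      by (intro add_mono mult_left_mono less_imp_le[OF k] sqn_fourier_cut assms) auto
    also have "\<dots> < \<infinity>" using fin by (simp add: ennreal_mult_less_top)
    finally show ?thesis .
  qed
  define spec where "spec g \<longleftrightarrow> g \<in> L2 (freq_measure J) \<and> (\<lambda>k::nat. eLp_norm 2 (freq_measure J)
        (\<lambda>\<xi>. g \<xi> - fourier J (\<lambda>x. indicator (cball 0 (real k)) x * f x) \<xi>)) \<longlonglongrightarrow> 0" for g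
  have "spec g"
    using lim' \<open>sqn (freq_measure J) g < \<infinity>\<close> unfolding spec_def L2_def eLp_norm_two_finite eLp_norm_two_tendsto_0 cut_def[abs_def] by simp
  moreover have "fourier_L2 J f = (SOME g. spec g)"
    unfolding fourier_L2_def spec_def ..
  ultimately have spec: "spec (fourier_L2 J f)"
    by (simp only: someI[of spec])
  have *: "fourier_L2 J f \<in> L2 (freq_measure J)"
    "(\<lambda>k. sqn (freq_measure J) (\<lambda>\<xi>. fourier_L2 J f \<xi> - fourier J (cut k f) \<xi>)) \<longlonglongrightarrow> 0"
    using spec unfolding spec_def eLp_norm_two_tendsto_0 cut_def[abs_def] by auto
  show "fourier_L2 J f \<in> borel_measurable borel" "sqn (freq_measure J) (fourier_L2 J f) < \<infinity>"
    using *(1) unfolding L2_def eLp_norm_two_finite borel_measurable_freq_measure by auto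
  show "(\<lambda>k. sqn (freq_measure J) (\<lambda>\<xi>. fourier J (cut k f) \<xi> - fourier_L2 J f \<xi>)) \<longlonglongrightarrow> 0"
    using *(2) by (subst sqn_minus_commute)
qed

section \<open>Inversion on square integrable functions\<close>

definition trunc :: "4 set \<Rightarrow> nat \<Rightarrow> (real^4 \<Rightarrow> complex) \<Rightarrow> real^4 \<Rightarrow> complex" where
  "trunc J k g \<xi> = indicator (freq_cube (real k) \<inter> freq_space J) \<xi> * g \<xi>"

lemma borel_measurable_trunc[measurable]: "f \<in> borel_measurable borel \<Longrightarrow> trunc J k f \<in> borel_measurable borel"
  unfolding trunc_def[abs_def] by (intro borel_measurable_times borel_measurable_indicator) auto

lemma sqn_cong_AE: "AE x in N. f x = g x \<Longrightarrow> sqn N f = sqn N g"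
  unfolding sqn_def by (intro nn_integral_cong_AE) auto

lemma sqn_trunc_le: "sqn N (trunc J k g) \<le> sqn N g"
  unfolding trunc_def[abs_def] by (rule sqn_indicator_le)

lemma integrable_trunc:
  assumes [measurable]: "g \<in> borel_measurable borel" and fin: "sqn (freq_measure J) g < \<infinity>"
  shows "integrable (freq_measure J) (trunc J k g)"
  unfolding trunc_def[abs_def]
proof (rule integrable_indicator_mult_sqn)
  have "emeasure (freq_measure J) (freq_cube (real k) \<inter> freq_space J) \<le> emeasure (freq_measure J) (freq_cube (real k))"
    by (rule emeasure_mono) auto
  then show "emeasure (freq_measure J) (freq_cube (real k) \<inter> freq_space J) < \<infinity>"
    using emeasure_freq_cube order.strict_trans1 by blast
qed (use fin in auto)

lemma eventually_freq_cube: "\<forall>\<^sub>F k in sequentially. \<xi> \<in> freq_cube (real k)"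
proof -
  obtain k0 :: nat where k0: "\<xi> \<in> freq_cube (real k0)" using UN_freq_cube by blast
  show ?thesis
    unfolding eventually_sequentially freq_cube_def mem_Collect_eq
    using k0 by (intro exI[of _ k0]) (force simp: freq_cube_def intro: order_trans)
qed

lemma sqn_trunc_tendsto:
  assumes [measurable]: "g \<in> borel_measurable borel" and fin: "sqn (freq_measure J) g < \<infinity>"
  shows "(\<lambda>k. sqn (freq_measure J) (\<lambda>\<xi>. trunc J k g \<xi> - g \<xi>)) \<longlonglongrightarrow> 0"
proof -
  have "sqn (freq_measure J) (\<lambda>\<xi>. trunc J k g \<xi> - g \<xi>) = sqn (freq_measure J) (\<lambda>\<xi>. indicator (freq_cube (real k)) \<xi> * g \<xi> - g \<xi>)" for k
    by (rule sqn_cong_AE) (use AE_freq_space in eventually_elim, auto simp: trunc_def indicator_def)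
  moreover have "(\<lambda>k. sqn (freq_measure J) (\<lambda>\<xi>. indicator (freq_cube (real k)) \<xi> * g \<xi> - g \<xi>)) \<longlonglongrightarrow> 0"
    by (rule sqn_indicator_tendsto) (use fin eventually_freq_cube in auto)
  ultimately show ?thesis by simp
qed

text \<open>By adjointness, pairing the transform of \<open>v\<close> with \<open>h\<close> amounts
  to pairing \<open>v\<close> with the inverse transform of \<open>h\<close>. Now \<open>v\<close>
  is a limit of inverse transforms of truncations of \<open>g\<close>, and for these
  \<open>integral_inv_fourier_inv_fourier\<close> returns the pairing of the truncation with
  \<open>h\<close>. Every limit passes through the pairing by
  \<open>integral_mult_tendsto_sqn\<close>.\<close>

lemma fourier_inversion_weak:
  fixes h :: "real^4 \<Rightarrow> real"
  assumes [measurable]: "g \<in> borel_measurable borel" and g: "sqn (freq_measure J) g < \<infinity>"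
    and [measurable]: "v \<in> borel_measurable borel" and v: "sqn (cell_measure J) v < \<infinity>"
    and lim: "(\<lambda>k. sqn (cell_measure J) (\<lambda>x. inv_fourier J (trunc J k g) x - v x)) \<longlonglongrightarrow> 0"
    and cont: "continuous_on UNIV h" and bd: "\<And>\<eta>. \<bar>h \<eta>\<bar> \<le> H" and supp: "\<And>\<xi>. \<xi> \<notin> freq_cube m \<Longrightarrow> h \<xi> = 0"
  shows "(LINT \<xi>|freq_measure J. fourier_L2 J v \<xi> * complex_of_real (h \<xi>)) = (LINT \<xi>|freq_measure J. g \<xi> * complex_of_real (h \<xi>))"
proof -
  have [measurable]: "h \<in> borel_measurable borel" using cont by (rule borel_measurable_continuous_onI)
  have cube: "emeasure (freq_measure J) (freq_cube m) < \<infinity>" by (rule emeasure_freq_cube)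
  have hint: "integrable (freq_measure J) h"
  proof (rule Bochner_Integration.integrable_bound)
    show "integrable (freq_measure J) (\<lambda>\<xi>. H * indicator (freq_cube m) \<xi>)"
      using cube by (intro integrable_mult_right integrable_real_indicator) auto
    show "AE \<xi> in freq_measure J. norm (h \<xi>) \<le> norm (H * indicator (freq_cube m) \<xi>)"
    proof (rule AE_I2)
      fix \<xi>
      show "norm (h \<xi>) \<le> norm (H * indicator (freq_cube m) \<xi>)"
        using bd[of \<xi>] supp[of \<xi>] by (cases "\<xi> \<in> freq_cube m") auto
    qed
  qed simp
  define hc where "hc \<xi> = complex_of_real (h \<xi>)" for \<xi>
  have [measurable]: "hc \<in> borel_measurable borel" unfolding hc_def[abs_def] by measurable
  have hcint: "integrable (freq_measure J) hc" unfolding hc_def[abs_def] using hint by simp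
  have hcfin: "sqn (freq_measure J) hc < \<infinity>"
  proof -
    have "sqn (freq_measure J) hc \<le> (\<integral>\<^sup>+ \<xi>. ennreal (H\<^sup>2) * indicator (freq_cube m) \<xi> \<partial>freq_measure J)"
      unfolding sqn_def
    proof (rule nn_integral_mono)
      fix \<xi>
      have "(h \<xi>)\<^sup>2 \<le> H\<^sup>2" using bd[of \<xi>] by (metis abs_ge_zero power2_abs power_mono)
      then show "ennreal ((norm (hc \<xi>))\<^sup>2) \<le> ennreal (H\<^sup>2) * indicator (freq_cube m) \<xi>"
        using supp[of \<xi>] by (cases "\<xi> \<in> freq_cube m") (auto simp: hc_def intro: ennreal_leI)
    qed
    also have "\<dots> = ennreal (H\<^sup>2) * emeasure (freq_measure J) (freq_cube m)" by (rule nn_integral_cmult_indicator) simp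
    also have "\<dots> < \<infinity>" using cube by (simp add: ennreal_mult_less_top)
    finally show ?thesis .
  qed
  define w where "w x = cnj (inv_fourier J hc x)" for x
  have Gm: "inv_fourier J hc \<in> borel_measurable borel" by (rule borel_measurable_inv_fourier) simp
  have [measurable]: "w \<in> borel_measurable borel" unfolding w_def[abs_def] by (rule measurable_compose[OF Gm borel_measurable_cnj])
  have wfin: "sqn (cell_measure J) w < \<infinity>"
    using order.strict_trans1[OF sqn_inv_fourier_le[OF hcint] hcfin] by (simp add: sqn_def w_def)
  have [measurable]: "fourier J (cut k v) \<in> borel_measurable borel" for k by (rule borel_measurable_fourier) simp
  have [measurable]: "fourier_L2 J v \<in> borel_measurable borel" by (rule fourier_L2_spec(1)) (use v in auto)
  have [measurable]: "inv_fourier J (trunc J k g) \<in> borel_measurable borel" for k by (rule borel_measurable_inv_fourier) simp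
  have A: "(\<lambda>k. LINT \<xi>|freq_measure J. fourier J (cut k v) \<xi> * hc \<xi>) \<longlonglongrightarrow> (LINT \<xi>|freq_measure J. fourier_L2 J v \<xi> * hc \<xi>)"
  proof (rule integral_mult_tendsto_sqn)
    show "sqn (freq_measure J) (fourier J (cut k v)) < \<infinity>" for k
      using sqn_fourier_cut[OF _ v] v by (auto intro: order.strict_trans1)
    show "sqn (freq_measure J) (fourier_L2 J v) < \<infinity>" by (rule fourier_L2_spec(2)) (use v in auto)
    show "(\<lambda>n. sqn (freq_measure J) (\<lambda>\<xi>. fourier J (cut n v) \<xi> - fourier_L2 J v \<xi>)) \<longlonglongrightarrow> 0"
      by (rule fourier_L2_spec(3)) (use v in auto)
  qed (use hcfin in auto)
  have B: "(\<lambda>k. LINT x|cell_measure J. cut k v x * w x) \<longlonglongrightarrow> (LINT x|cell_measure J. v x * w x)"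
  proof (rule integral_mult_tendsto_sqn)
    show "sqn (cell_measure J) (cut k v) < \<infinity>" for k
      using order.strict_trans1[OF sqn_indicator_le v] unfolding cut_def[abs_def] .
    show "(\<lambda>n. sqn (cell_measure J) (\<lambda>x. cut n v x - v x)) \<longlonglongrightarrow> 0"
      by (rule sqn_cut_tendsto) (use v in auto)
  qed (use v wfin in auto)
  have eq: "(LINT \<xi>|freq_measure J. fourier J (cut k v) \<xi> * hc \<xi>) = (LINT x|cell_measure J. cut k v x * w x)" for k
    using fourier_adjoint[OF integrable_cut[OF _ v] hcint, of k] by (simp add: w_def) (simp add: hc_def)
  have 1: "(LINT \<xi>|freq_measure J. fourier_L2 J v \<xi> * hc \<xi>) = (LINT x|cell_measure J. v x * w x)"
    using LIMSEQ_unique[OF A[unfolded eq] B] .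
  have C: "(\<lambda>k. LINT x|cell_measure J. inv_fourier J (trunc J k g) x * w x) \<longlonglongrightarrow> (LINT x|cell_measure J. v x * w x)"
  proof (rule integral_mult_tendsto_sqn[OF _ _ _ v _ wfin lim])
    show "sqn (cell_measure J) (inv_fourier J (trunc J k g)) < \<infinity>" for k
      by (rule order.strict_trans1[OF order_trans[OF sqn_inv_fourier_le sqn_trunc_le] g]) (rule integrable_trunc, use g in auto)
  qed auto
  have D: "(\<lambda>k. LINT \<xi>|freq_measure J. trunc J k g \<xi> * hc \<xi>) \<longlonglongrightarrow> (LINT \<xi>|freq_measure J. g \<xi> * hc \<xi>)"
    by (rule integral_mult_tendsto_sqn[OF _ _ _ g _ hcfin sqn_trunc_tendsto])
      (use g order.strict_trans1[OF sqn_trunc_le g] in auto)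
  have eq2: "(LINT x|cell_measure J. inv_fourier J (trunc J k g) x * w x) = (LINT \<xi>|freq_measure J. trunc J k g \<xi> * hc \<xi>)" for k
    unfolding w_def hc_def
  proof (rule integral_inv_fourier_inv_fourier[OF _ _ _ hint _ cont bd])
    show "integrable (freq_measure J) (trunc J k g)" by (rule integrable_trunc) (use g in auto)
    show "sqn (freq_measure J) (trunc J k g) < \<infinity>" by (rule order.strict_trans1[OF sqn_trunc_le g])
    show "trunc J k g \<xi> = 0" if "\<xi> \<notin> freq_space J" for \<xi> using that by (simp add: trunc_def)
    show "sqn (freq_measure J) (\<lambda>\<xi>. complex_of_real (h \<xi>)) < \<infinity>" using hcfin unfolding hc_def .
  qed
  have 2: "(LINT x|cell_measure J. v x * w x) = (LINT \<xi>|freq_measure J. g \<xi> * hc \<xi>)"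
    using LIMSEQ_unique[OF C[unfolded eq2] D] .
  show ?thesis using 1 2 unfolding hc_def by simp
qed

text \<open>Continuous functions decreasing to the indicator of a bounded closed set show that
  \<open>D\<close> has integral 0 over that set. Closed sets generate the Borel sets, and a function
  with zero integral over every Borel set vanishes almost everywhere; this is done on each cube,
  where \<open>D\<close> is integrable.\<close>

lemma AE_zero_of_test_functions:
  fixes D :: "real^4 \<Rightarrow> complex"
  assumes [measurable]: "D \<in> borel_measurable borel" and fin: "sqn (freq_measure J) D < \<infinity>"
    and test: "\<And>h m. continuous_on UNIV h \<Longrightarrow> (\<And>\<xi>. \<bar>h \<xi>\<bar> \<le> 1) \<Longrightarrow> (\<And>\<xi>. \<xi> \<notin> freq_cube m \<Longrightarrow> h \<xi> = 0) \<Longrightarrow>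
      (LINT \<xi>|freq_measure J. D \<xi> * complex_of_real (h \<xi>)) = 0"
  shows "AE \<xi> in freq_measure J. D \<xi> = 0"
proof -
  have Dint: "integrable (freq_measure J) (\<lambda>\<xi>. indicator (freq_cube m) \<xi> * D \<xi>)" for m
    by (rule integrable_indicator_mult_sqn) (use fin emeasure_freq_cube in auto)
  have K0: "(LINT \<xi>|freq_measure J. indicator K \<xi> * D \<xi>) = 0" if K: "closed K" "K \<subseteq> freq_cube m" for K and m :: real
  proof (cases "K = {}")
    case False
    \<comment> \<open>Supported within distance 1 of \<open>K\<close>, hence in
      \<open>freq_cube (m + 1)\<close>. The empty set is treated apart because
      \<open>infdist\<close> to it is 0 by convention.\<close>
    define h where "h n \<xi> = max 0 (1 - real (Suc n) * infdist \<xi> K)" for n \<xi>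
    have h1: "\<bar>h n \<xi>\<bar> \<le> 1" for n \<xi> by (simp add: h_def infdist_nonneg)
    have hcont: "continuous_on UNIV (h n)" for n
      unfolding h_def[abs_def] by (intro continuous_intros)
    have hsupp: "h n \<xi> = 0" if "\<xi> \<notin> freq_cube (m + 1)" for n \<xi>
    proof (rule ccontr)
      assume "h n \<xi> \<noteq> 0"
      then have "real (Suc n) * infdist \<xi> K < 1" by (auto simp: h_def max_def split: if_splits)
      moreover have "1 * infdist \<xi> K \<le> real (Suc n) * infdist \<xi> K"
        by (intro mult_right_mono) (auto simp: infdist_nonneg)
      ultimately have "infdist \<xi> K < 1" by linarith
      then obtain y where y: "y \<in> K" "dist \<xi> y < 1"
        using False infdist_attains_inf[OF K(1) False, of \<xi>] by metis
      have "\<bar>\<xi> $ i\<bar> \<le> m + 1" for i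
      proof -
        have "\<bar>(\<xi> - y) $ i\<bar> \<le> norm (\<xi> - y)" by (rule component_le_norm_cart)
        moreover have "\<bar>y $ i\<bar> \<le> m" using y(1) K(2) by (auto simp: freq_cube_def)
        ultimately show ?thesis using y(2) by (simp add: dist_norm)
      qed
      then show False using that by (simp add: freq_cube_def)
    qed
    have [measurable]: "h n \<in> borel_measurable borel" for n by (rule borel_measurable_continuous_onI[OF hcont])
    have [measurable]: "K \<in> sets borel" using K(1) by simp
    have "(\<lambda>n. LINT \<xi>|freq_measure J. D \<xi> * complex_of_real (h n \<xi>)) \<longlonglongrightarrow> (LINT \<xi>|freq_measure J. indicator K \<xi> * D \<xi>)"
    proof (rule integral_dominated_convergence[where w="\<lambda>\<xi>. norm (indicator (freq_cube (m + 1)) \<xi> * D \<xi>)"])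
      show "AE \<xi> in freq_measure J. (\<lambda>n. D \<xi> * complex_of_real (h n \<xi>)) \<longlonglongrightarrow> indicator K \<xi> * D \<xi>"
      proof (rule AE_I2)
        fix \<xi>
        have "(\<lambda>n. h n \<xi>) \<longlonglongrightarrow> indicator K \<xi>"
        proof (cases "\<xi> \<in> K")
          case True
          then show ?thesis by (simp add: h_def)
        next
          case False
          then have pos: "0 < infdist \<xi> K" using K(1) \<open>K \<noteq> {}\<close> in_closed_iff_infdist_zero[of K \<xi>] infdist_nonneg[of \<xi> K] by auto
          have "eventually (\<lambda>n. h n \<xi> = 0) sequentially"
          proof -
            obtain n0 where n0: "1 < real n0 * infdist \<xi> K" using reals_Archimedean3[OF pos] by blast
            have "h n \<xi> = 0" if "n0 \<le> n" for n
            proof -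
              have "real n0 * infdist \<xi> K \<le> real (Suc n) * infdist \<xi> K" using that pos by (intro mult_right_mono) auto
              then show ?thesis using n0 by (simp add: h_def)
            qed
            then show ?thesis unfolding eventually_sequentially by blast
          qed
          then show ?thesis using False by (simp add: tendsto_eventually)
        qed
        then have "(\<lambda>n. D \<xi> * complex_of_real (h n \<xi>)) \<longlonglongrightarrow> D \<xi> * complex_of_real (indicator K \<xi>)"
          by (intro tendsto_intros)
        then show "(\<lambda>n. D \<xi> * complex_of_real (h n \<xi>)) \<longlonglongrightarrow> indicator K \<xi> * D \<xi>"
          by (simp add: mult.commute of_real_indicator)
      qed
      show "AE \<xi> in freq_measure J. norm (D \<xi> * complex_of_real (h n \<xi>)) \<le> norm (indicator (freq_cube (m + 1)) \<xi> * D \<xi>)" for n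
      proof (rule AE_I2)
        fix \<xi>
        show "norm (D \<xi> * complex_of_real (h n \<xi>)) \<le> norm (indicator (freq_cube (m + 1)) \<xi> * D \<xi>)"
          using h1[of n \<xi>] hsupp[of \<xi> n] by (cases "\<xi> \<in> freq_cube (m + 1)") (auto simp: norm_mult mult_left_le)
      qed
    qed (use Dint in auto)
    then have "(\<lambda>n. 0) \<longlonglongrightarrow> (LINT \<xi>|freq_measure J. indicator K \<xi> * D \<xi>)"
      using test[OF hcont h1 hsupp] by simp
    then show ?thesis using LIMSEQ_unique[OF _ tendsto_const] by blast
  qed simp
  have cube_closed: "closed (freq_cube m)" for m
  proof -
    have "freq_cube m = (\<Inter>i. {\<xi>. \<bar>\<xi> $ i\<bar> \<le> m})" by (auto simp: freq_cube_def)
    then show ?thesis by (simp only:) (intro closed_INT ballI closed_Collect_le continuous_intros)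
  qed
  have zero: "AE \<xi> in freq_measure J. indicator (freq_cube (real k)) \<xi> * D \<xi> = 0" for k :: nat
  proof (rule sigma_finite_measure.density_zero[OF sigma_finite_freq_measure Dint])
    fix A :: "(real^4) set" assume "A \<in> sets (freq_measure J)"
    then have "A \<in> sigma_sets UNIV (Collect closed)"
      by (simp add: borel_eq_closed)
    let ?D = "\<lambda>\<xi>. indicator (freq_cube (real k)) \<xi> * D \<xi>"
    have Int_stable: "Int_stable (Collect closed :: (real^4) set set)" by (auto simp: Int_stable_def)
    have sub: "(Collect closed :: (real^4) set set) \<subseteq> Pow UNIV" by auto
    have closedA: "(LINT \<xi>:A|freq_measure J. ?D \<xi>) = 0" if "closed A" for A
    proof -
      have "(LINT \<xi>:A|freq_measure J. ?D \<xi>) = (LINT \<xi>|freq_measure J. indicator (A \<inter> freq_cube (real k)) \<xi> * D \<xi>)"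
        unfolding set_lebesgue_integral_def
        by (intro Bochner_Integration.integral_cong refl) (auto simp: indicator_def)
      also have "\<dots> = 0" by (rule K0) (use that cube_closed in auto)
      finally show ?thesis .
    qed
    have set_int: "set_integrable (freq_measure J) B ?D" if "B \<in> sets borel" for B
      unfolding set_integrable_def using that by (intro integrable_mult_indicator Dint) auto
    have sets: "B \<in> sets borel" if "B \<in> sigma_sets UNIV (Collect closed)" for B :: "(real^4) set"
      using that by (simp add: borel_eq_closed)
    \<comment> \<open>Closed sets form an intersection-stable generator; complements work because
      the whole space is closed.\<close>
    show "(LINT \<xi>:A|freq_measure J. ?D \<xi>) = 0"
      using Int_stable sub \<open>A \<in> sigma_sets UNIV (Collect closed)\<close>
    proof (induction rule: sigma_sets_induct_disjoint)
      case (basic A)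
      then show ?case by (simp add: closedA)
    next
      case empty
      then show ?case by (simp add: set_lebesgue_integral_def)
    next
      case (compl A)
      have [measurable]: "A \<in> sets borel" by (rule sets[OF compl(1)])
      have "(LINT \<xi>:A \<union> (UNIV - A)|freq_measure J. ?D \<xi>) = (LINT \<xi>:A|freq_measure J. ?D \<xi>) + (LINT \<xi>:UNIV - A|freq_measure J. ?D \<xi>)"
        by (rule set_integral_Un) (auto intro!: set_int)
      moreover have "A \<union> (UNIV - A) = UNIV" by auto
      ultimately show ?case using closedA[of UNIV] compl(2) by simp
    next
      case (union A)
      have [measurable]: "A i \<in> sets borel" for i using union(2) sets by blast
      have "(LINT \<xi>:(\<Union>i. A i)|freq_measure J. ?D \<xi>) = (\<Sum>i. LINT \<xi>:A i|freq_measure J. ?D \<xi>)"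
        by (rule lebesgue_integral_countable_add) (use union(1) in \<open>auto simp: disjoint_family_on_def intro!: set_int\<close>)
      then show ?case using union(3) by simp
    qed
  qed
  have "AE \<xi> in freq_measure J. \<forall>k::nat. indicator (freq_cube (real k)) \<xi> * D \<xi> = 0"
    unfolding AE_all_countable using zero by blast
  then show ?thesis
  proof eventually_elim
    case (elim \<xi>)
    obtain k :: nat where "\<xi> \<in> freq_cube (real k)" using UN_freq_cube by blast
    then show ?case using spec[OF elim, of k] by simp
  qed
qed

theorem fourier_inversion:
  assumes [measurable]: "g \<in> borel_measurable borel" and g: "sqn (freq_measure J) g < \<infinity>"
    and [measurable]: "v \<in> borel_measurable borel" and v: "sqn (cell_measure J) v < \<infinity>"
    and lim: "(\<lambda>k. sqn (cell_measure J) (\<lambda>x. inv_fourier J (trunc J k g) x - v x)) \<longlonglongrightarrow> 0"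
  shows "AE \<xi> in freq_measure J. fourier_L2 J v \<xi> = g \<xi>"
proof -
  have [measurable]: "fourier_L2 J v \<in> borel_measurable borel" by (rule fourier_L2_spec(1)) (use v in auto)
  have Ffin: "sqn (freq_measure J) (fourier_L2 J v) < \<infinity>" by (rule fourier_L2_spec(2)) (use v in auto)
  have "AE \<xi> in freq_measure J. fourier_L2 J v \<xi> - g \<xi> = 0"
  proof (rule AE_zero_of_test_functions)
    have "sqn (freq_measure J) (\<lambda>\<xi>. fourier_L2 J v \<xi> - g \<xi>) \<le> 2 * sqn (freq_measure J) (fourier_L2 J v) + 2 * sqn (freq_measure J) g"
      by (rule sqn_diff_le) auto
    also have "\<dots> < \<infinity>" using Ffin g by (simp add: ennreal_mult_less_top)
    finally show "sqn (freq_measure J) (\<lambda>\<xi>. fourier_L2 J v \<xi> - g \<xi>) < \<infinity>" .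
    fix h :: "real^4 \<Rightarrow> real" and m
    assume h: "continuous_on UNIV h" "\<And>\<xi>. \<bar>h \<xi>\<bar> \<le> 1" "\<And>\<xi>. \<xi> \<notin> freq_cube m \<Longrightarrow> h \<xi> = 0"
    have [measurable]: "h \<in> borel_measurable borel" using h(1) by (rule borel_measurable_continuous_onI)
    have hfin: "sqn (freq_measure J) (\<lambda>\<xi>. complex_of_real (h \<xi>)) < \<infinity>"
    proof -
      have "sqn (freq_measure J) (\<lambda>\<xi>. complex_of_real (h \<xi>)) \<le> (\<integral>\<^sup>+ \<xi>. indicator (freq_cube m) \<xi> \<partial>freq_measure J)"
        unfolding sqn_def
      proof (rule nn_integral_mono)
        fix \<xi>
        have "(h \<xi>)\<^sup>2 \<le> 1" using h(2)[of \<xi>] by (simp add: abs_square_le_1)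
        then show "ennreal ((norm (complex_of_real (h \<xi>)))\<^sup>2) \<le> indicator (freq_cube m) \<xi>"
          using h(3)[of \<xi>] by (cases "\<xi> \<in> freq_cube m") auto
      qed
      also have "\<dots> < \<infinity>" using emeasure_freq_cube by simp
      finally show ?thesis .
    qed
    have int: "integrable (freq_measure J) (\<lambda>\<xi>. fourier_L2 J v \<xi> * complex_of_real (h \<xi>))"
      "integrable (freq_measure J) (\<lambda>\<xi>. g \<xi> * complex_of_real (h \<xi>))"
      by (rule integrable_mult_sqn; use Ffin g hfin in simp)+
    show "(LINT \<xi>|freq_measure J. (fourier_L2 J v \<xi> - g \<xi>) * complex_of_real (h \<xi>)) = 0"
      unfolding left_diff_distrib Bochner_Integration.integral_diff[OF int]
      using fourier_inversion_weak[OF _ g _ v lim h] by simp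
  qed simp
  then show ?thesis by simp
qed

lemma freq_cube_mono: "a \<le> b \<Longrightarrow> freq_cube a \<subseteq> freq_cube b"
  by (auto simp: freq_cube_def intro: order_trans)

text \<open>The truncations of \<open>g\<close> are eventually \<open>g\<close> itself, so by
  inversion \<open>g\<close> is the Fourier transform of its own inverse transform, and boundedness
  of the Fourier transform applies. The factor 2 stems from \<open>sqn_le_diff\<close> and only
  affects the final constant.\<close>

lemma sqn_le_2_inv_fourier:
  assumes [measurable]: "g \<in> borel_measurable borel" and g: "sqn (freq_measure J) g < \<infinity>"
    and supp: "\<And>\<xi>. \<xi> \<notin> freq_cube m \<inter> freq_space J \<Longrightarrow> g \<xi> = 0"
  shows "sqn (freq_measure J) g \<le> 2 * sqn (cell_measure J) (inv_fourier J g)"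
proof -
  obtain k0 :: nat where k0: "m \<le> real k0" using real_arch_simple by blast
  have tr: "trunc J k g = g" if "k0 \<le> k" for k
  proof
    fix \<xi>
    have "freq_cube m \<subseteq> freq_cube (real k)" using k0 that by (intro freq_cube_mono) simp
    then show "trunc J k g \<xi> = g \<xi>" using supp[of \<xi>] by (auto simp: trunc_def indicator_def)
  qed
  have gint: "integrable (freq_measure J) g" using integrable_trunc[OF _ g, of k0] tr[of k0] by simp
  have [measurable]: "inv_fourier J g \<in> borel_measurable borel" by (rule borel_measurable_inv_fourier) simp
  have v: "sqn (cell_measure J) (inv_fourier J g) < \<infinity>"
    by (rule order.strict_trans1[OF sqn_inv_fourier_le[OF gint] g])
  let ?v = "inv_fourier J g"
  have "AE \<xi> in freq_measure J. fourier_L2 J ?v \<xi> = g \<xi>"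
  proof (rule fourier_inversion[OF _ g _ v])
    have "eventually (\<lambda>k. sqn (cell_measure J) (\<lambda>x. inv_fourier J (trunc J k g) x - ?v x) = 0) sequentially"
      unfolding eventually_sequentially by (intro exI[of _ k0]) (simp add: tr sqn_def)
    then show "(\<lambda>k. sqn (cell_measure J) (\<lambda>x. inv_fourier J (trunc J k g) x - ?v x)) \<longlonglongrightarrow> 0"
      by (rule tendsto_eventually)
  qed auto
  then have eq: "sqn (freq_measure J) (fourier_L2 J ?v) = sqn (freq_measure J) g" by (rule sqn_cong_AE)
  have [measurable]: "fourier J (cut k ?v) \<in> borel_measurable borel" for k by (rule borel_measurable_fourier) simp
  have [measurable]: "fourier_L2 J ?v \<in> borel_measurable borel" by (rule fourier_L2_spec(1)) (use v in auto)
  have bound: "sqn (freq_measure J) g \<le> 2 * sqn (freq_measure J) (\<lambda>\<xi>. fourier J (cut k ?v) \<xi> - fourier_L2 J ?v \<xi>) + 2 * sqn (cell_measure J) ?v" for k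
  proof -
    have "sqn (freq_measure J) (fourier_L2 J ?v) \<le> 2 * sqn (freq_measure J) (\<lambda>\<xi>. fourier_L2 J ?v \<xi> - fourier J (cut k ?v) \<xi>) + 2 * sqn (freq_measure J) (fourier J (cut k ?v))"
      by (rule sqn_le_diff) auto
    also have "\<dots> \<le> 2 * sqn (freq_measure J) (\<lambda>\<xi>. fourier J (cut k ?v) \<xi> - fourier_L2 J ?v \<xi>) + 2 * sqn (cell_measure J) ?v"
      using sqn_fourier_cut[OF _ v, of k] by (subst sqn_minus_commute) (intro add_mono mult_left_mono, auto)
    finally show ?thesis unfolding eq .
  qed
  have "(\<lambda>k. 2 * sqn (freq_measure J) (\<lambda>\<xi>. fourier J (cut k ?v) \<xi> - fourier_L2 J ?v \<xi>) + 2 * sqn (cell_measure J) ?v)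
    \<longlonglongrightarrow> 2 * 0 + 2 * sqn (cell_measure J) ?v"
    by (intro tendsto_add tendsto_mult_ennreal tendsto_const fourier_L2_spec(3)) (use v in auto)
  then have "(\<lambda>k. 2 * sqn (freq_measure J) (\<lambda>\<xi>. fourier J (cut k ?v) \<xi> - fourier_L2 J ?v \<xi>) + 2 * sqn (cell_measure J) ?v)
    \<longlonglongrightarrow> 2 * sqn (cell_measure J) ?v" by simp
  then show ?thesis
    by (rule LIMSEQ_le_const) (use bound in blast)
qed

lemma inv_fourier_diff:
  assumes f: "integrable (freq_measure J) f" and g: "integrable (freq_measure J) g"
  shows "inv_fourier J f x - inv_fourier J g x = inv_fourier J (\<lambda>\<xi>. f \<xi> - g \<xi>) x"
proof -
  have int: "integrable (freq_measure J) (\<lambda>\<xi>. cis (x \<bullet> \<xi>) * f \<xi>)" if "integrable (freq_measure J) f" for f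
  proof -
    have [measurable]: "f \<in> borel_measurable borel"
      using borel_measurable_integrable[OF that] borel_measurable_freq_measure by blast
    show ?thesis
      by (rule Bochner_Integration.integrable_bound[OF that]) (auto simp: norm_mult)
  qed
  have "(LINT \<xi>|freq_measure J. cis (x \<bullet> \<xi>) * (f \<xi> - g \<xi>)) =
    (LINT \<xi>|freq_measure J. cis (x \<bullet> \<xi>) * f \<xi>) - (LINT \<xi>|freq_measure J. cis (x \<bullet> \<xi>) * g \<xi>)"
    unfolding right_diff_distrib by (rule Bochner_Integration.integral_diff[OF int[OF f] int[OF g]])
  then show ?thesis by (simp add: inv_fourier_def scaleR_right_diff_distrib)
qed

lemma inv_fourier_periodic:
  assumes i: "i \<in> J" and supp: "\<And>\<xi>. \<xi> \<notin> freq_space J \<Longrightarrow> g \<xi> = 0"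
  shows "inv_fourier J g (x + axis i (2 * pi)) = inv_fourier J g x"
proof -
  have eq: "cis ((x + axis i (2 * pi)) \<bullet> \<xi>) * g \<xi> = cis (x \<bullet> \<xi>) * g \<xi>" for \<xi>
  proof (cases "\<xi> \<in> freq_space J")
    case True
    then have "\<xi> $ i \<in> \<int>" using i by (simp add: freq_space_def)
    then have "cis (2 * pi * \<xi> $ i) = 1" by (rule cis_multiple_2pi)
    moreover have "(x + axis i (2 * pi)) \<bullet> \<xi> = x \<bullet> \<xi> + 2 * pi * \<xi> $ i"
      by (simp add: inner_add_left inner_axis' )
    ultimately show ?thesis by (simp add: cis_mult[symmetric])
  qed (simp add: supp)
  show ?thesis by (simp only: inv_fourier_def eq)
qed

section \<open>The propagator on the frequency side\<close>

lemma L2_M_D: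
  assumes "u \<in> L2_M J"
  shows "u \<in> borel_measurable borel" "sqn (cell_measure J) u < \<infinity>"
  using assms by (auto simp: L2_M_def L2_def eLp_norm_two_finite sqn_M_measure simp del: infinity_ennreal_def)

text \<open>Supplies the witness for the choice in \<open>schroedinger\<close>.\<close>

theorem ex_L2_M_fourier_L2:
  assumes [measurable]: "g \<in> borel_measurable borel" and g: "sqn (freq_measure J) g < \<infinity>"
  shows "\<exists>v\<in>L2_M J. AE \<xi> in freq_measure J. fourier_L2 J v \<xi> = g \<xi>"
proof -
  define f where "f k = inv_fourier J (trunc J k g)" for k
  have [measurable]: "f k \<in> borel_measurable borel" for k
    unfolding f_def by (rule borel_measurable_inv_fourier) simp
  have int: "integrable (freq_measure J) (trunc J k g)" for k
    by (rule integrable_trunc) (use g in auto)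
  have "sqn_Cauchy (cell_measure J) f"
  proof (rule sqn_Cauchy_mono)
    show "sqn_Cauchy (freq_measure J) (\<lambda>k. trunc J k g)"
      by (rule sqn_Cauchy_of_tendsto[OF _ _ sqn_trunc_tendsto[OF _ g]]) auto
    show "sqn (cell_measure J) (\<lambda>x. f m x - f n x) \<le> sqn (freq_measure J) (\<lambda>\<xi>. trunc J m g \<xi> - trunc J n g \<xi>)" for m n
      unfolding f_def inv_fourier_diff[OF int int]
      by (rule sqn_inv_fourier_le) (simp add: int)
  qed
  then obtain r :: "nat \<Rightarrow> nat" where lim: "(\<lambda>k. sqn (cell_measure J) (\<lambda>x. f k x - lim (\<lambda>j. f (r j) x))) \<longlonglongrightarrow> 0"
    using riesz_fischer[of f "cell_measure J"] by auto
  define v where "v x = lim (\<lambda>j. f (r j) x)" for x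
  have [measurable]: "v \<in> borel_measurable borel" unfolding v_def[abs_def] by measurable
  have lim': "(\<lambda>k. sqn (cell_measure J) (\<lambda>x. f k x - v x)) \<longlonglongrightarrow> 0" using lim unfolding v_def .
  have vfin: "sqn (cell_measure J) v < \<infinity>"
  proof -
    have "eventually (\<lambda>k. sqn (cell_measure J) (\<lambda>x. f k x - v x) < 1) sequentially"
      by (rule order_tendstoD(2)[OF lim']) simp
    then obtain k where k: "sqn (cell_measure J) (\<lambda>x. f k x - v x) < 1"
      by (auto simp: eventually_sequentially)
    have "sqn (cell_measure J) v \<le> 2 * sqn (cell_measure J) (\<lambda>x. v x - f k x) + 2 * sqn (cell_measure J) (f k)"
      by (rule sqn_le_diff) auto
    also have "\<dots> \<le> 2 * 1 + 2 * sqn (freq_measure J) g"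
    proof (intro add_mono mult_left_mono)
      show "sqn (cell_measure J) (\<lambda>x. v x - f k x) \<le> 1" using k by (subst sqn_minus_commute) simp
      show "sqn (cell_measure J) (f k) \<le> sqn (freq_measure J) g"
        unfolding f_def by (rule order_trans[OF sqn_inv_fourier_le[OF int] sqn_trunc_le])
    qed auto
    also have "\<dots> < \<infinity>" using g by (simp add: ennreal_mult_less_top)
    finally show ?thesis .
  qed
  \<comment> \<open>\<open>trunc\<close> vanishes off \<open>freq_space J\<close>, so every
    \<open>f k\<close> is exactly periodic, and so is the pointwise limit.\<close>
  have per: "v (x + axis i (2 * pi)) = v x" if "i \<in> J" for i x
  proof -
    have "f k (x + axis i (2 * pi)) = f k x" for k
      unfolding f_def by (rule inv_fourier_periodic[OF that]) (simp add: trunc_def)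
    then show ?thesis by (simp add: v_def)
  qed
  have vM: "v \<in> borel_measurable (M_measure J)"
    unfolding M_measure_eq by (rule measurable_restrict_space1) simp
  have "v \<in> L2_M J"
    using per vM vfin unfolding L2_M_def L2_def eLp_norm_two_finite by (simp add: sqn_M_measure)
  moreover have "AE \<xi> in freq_measure J. fourier_L2 J v \<xi> = g \<xi>"
    by (rule fourier_inversion[OF _ g _ vfin lim'[unfolded f_def]]) auto
  ultimately show ?thesis by blast
qed

text \<open>The solution with Fourier data \<open>g\<close> as an explicit integral, free of the
  choice operators and measurable jointly in time and space.\<close>

definition propagate :: "4 set \<Rightarrow> real \<Rightarrow> (real^4 \<Rightarrow> complex) \<Rightarrow> real^4 \<Rightarrow> complex" where
  "propagate J t g = inv_fourier J (\<lambda>\<xi>. cis (- t * (norm \<xi>)\<^sup>2) * g \<xi>)"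

text \<open>The choice in \<open>schroedinger\<close> is pinned down almost everywhere in frequency,
  and null sets of frequencies do not affect the inversion integral.\<close>

lemma P_schroedinger:
  assumes u: "u \<in> L2_M J" and [measurable]: "R \<in> sets borel"
  shows "P J R (schroedinger J t u) = propagate J t (\<lambda>\<xi>. indicator R \<xi> * fourier_L2 J u \<xi>)"
proof -
  have [measurable]: "fourier_L2 J u \<in> borel_measurable borel" by (rule fourier_L2_spec(1)) (use L2_M_D[OF u] in auto)
  have fin: "sqn (freq_measure J) (fourier_L2 J u) < \<infinity>" by (rule fourier_L2_spec(2)) (use L2_M_D[OF u] in auto)
  define w where "w \<xi> = cis (- t * (norm \<xi>)\<^sup>2) * fourier_L2 J u \<xi>" for \<xi> :: "real^4"
  have [measurable]: "w \<in> borel_measurable borel" unfolding w_def[abs_def] by measurable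
  have "sqn (freq_measure J) w < \<infinity>" using fin by (simp add: sqn_def w_def norm_mult)
  from ex_L2_M_fourier_L2[OF _ this]
  have "\<exists>v. v \<in> L2_M J \<and> (AE \<xi> in freq_measure J. fourier_L2 J v \<xi> = cis (- t * (norm \<xi>)\<^sup>2) * fourier_L2 J u \<xi>)"
    by (auto simp: w_def)
  then have s: "schroedinger J t u \<in> L2_M J \<and> (AE \<xi> in freq_measure J. fourier_L2 J (schroedinger J t u) \<xi> = cis (- t * (norm \<xi>)\<^sup>2) * fourier_L2 J u \<xi>)"
    unfolding schroedinger_def by (rule someI_ex)
  have [measurable]: "fourier_L2 J (schroedinger J t u) \<in> borel_measurable borel"
    by (rule fourier_L2_spec(1)) (use L2_M_D s in auto)
  show ?thesis
    unfolding P_def propagate_def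
  proof (rule inv_fourier_cong_AE)
    show "AE \<xi> in freq_measure J. indicator R \<xi> * fourier_L2 J (schroedinger J t u) \<xi> = cis (- t * (norm \<xi>)\<^sup>2) * (indicator R \<xi> * fourier_L2 J u \<xi>)"
      using conjunct2[OF s] by eventually_elim (simp add: mult_ac)
  qed measurable
qed

subsection \<open>The space-time estimate\<close>

definition time_weight :: "real \<Rightarrow> real measure" where
  "time_weight e = density lborel (\<lambda>t. ennreal (fejer e t))"

lemma sets_time_weight[measurable_cong, simp]: "sets (time_weight e) = sets borel"
  by (simp add: time_weight_def)

lemma space_time_weight[simp]: "space (time_weight e) = UNIV"
  by (simp add: time_weight_def)

lemma finite_time_weight:
  assumes "0 < e"
  shows "finite_measure (time_weight e)"
proof (rule finite_measureI)
  have "(\<integral>\<^sup>+ t. ennreal (norm (fejer e t)) \<partial>lborel) < \<infinity>"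
    using integrable_fejer[OF assms] unfolding integrable_iff_bounded by (rule conjunct2)
  then have "(\<integral>\<^sup>+ t. ennreal (fejer e t) \<partial>lborel) < \<infinity>"
    by (simp only: real_norm_def abs_of_nonneg[OF fejer_nonneg])
  moreover have "emeasure (time_weight e) UNIV = (\<integral>\<^sup>+ t. ennreal (fejer e t) * indicator UNIV t \<partial>lborel)"
    unfolding time_weight_def by (rule emeasure_density) auto
  ultimately show "emeasure (time_weight e) (space (time_weight e)) \<noteq> \<infinity>" by simp
qed

lemma space_weighted_M[simp]: "space (weighted_M J e) = UNIV"
  by (simp add: weighted_M_def)

section \<open>The kernel of the bilinear form\<close>

lemma integral_time_weight_cis:
  assumes "0 < e"
  shows "(LINT t|time_weight e. cis (t * z)) = complex_of_real (2 * pi * tri e z)"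
proof -
  have "(LINT t|time_weight e. cis (t * z)) = (LINT t|lborel. fejer e t *\<^sub>R cis (t * z))"
    unfolding time_weight_def by (rule integral_density) (auto simp: fejer_nonneg)
  then show ?thesis using integral_fejer_cis[OF assms] by (simp add: scaleR_conv_of_real)
qed

lemma integral_weighted_M_cis:
  assumes "0 < e" "\<zeta> \<in> freq_space J"
  shows "(LINT x|weighted_M J e. cis (x \<bullet> \<zeta>)) = complex_of_real ((2 * pi) ^ 4 * freq_kernel J e \<zeta>)"
proof -
  have "(LINT x|weighted_M J e. cis (x \<bullet> \<zeta>)) = (LINT x|cell_measure J. complex_of_real (M_weight J e x) * cis (x \<bullet> \<zeta>))"
    by (rule integral_weighted_M) simp
  also have "\<dots> = complex_of_real ((2 * pi) ^ 4 * freq_kernel J e \<zeta>)"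
    using assms(2) by (intro M_weight_cis assms(1)) (auto simp: freq_space_def)
  finally show ?thesis .
qed

text \<open>The product of the phases of two plane waves at the same point
  \<open>z = (t, x)\<close>, so \<open>transf\<close> of a tensor product is, up to a constant, a
  product of two solutions.\<close>

abbreviation bilin_phase :: "real \<times> (real^4) \<Rightarrow> (real^4) \<times> (real^4) \<Rightarrow> complex" where
  "bilin_phase z p \<equiv> cis (snd z \<bullet> (fst p + snd p) - fst z * ((norm (fst p))\<^sup>2 + (norm (snd p))\<^sup>2))"

lemma bounded_phase_bilin:
  assumes "0 < e'" "0 < e"
  shows "bounded_phase (time_weight e' \<Otimes>\<^sub>M weighted_M J e) (freq_measure J \<Otimes>\<^sub>M freq_measure J) bilin_phase"
proof (rule bounded_phase.intro)
  interpret T: finite_measure "time_weight e'" by (rule finite_time_weight[OF assms(1)])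
  interpret W: finite_measure "weighted_M J e" by (rule finite_weighted_M[OF assms(2)])
  interpret NN: pair_sigma_finite "freq_measure J" "freq_measure J" ..
  show "finite_measure (time_weight e' \<Otimes>\<^sub>M weighted_M J e)"
  proof (rule finite_measureI)
    have "emeasure (time_weight e' \<Otimes>\<^sub>M weighted_M J e) (UNIV \<times> UNIV) = emeasure (time_weight e') UNIV * emeasure (weighted_M J e) UNIV"
      by (rule W.emeasure_pair_measure_Times) auto
    also have "\<dots> < \<infinity>"
    proof -
      have "emeasure (time_weight e') UNIV < top" "emeasure (weighted_M J e) UNIV < top"
        unfolding top.not_eq_extremum[symmetric] by simp_all
      then show ?thesis by (simp add: ennreal_mult_less_top)
    qed
    finally show "emeasure (time_weight e' \<Otimes>\<^sub>M weighted_M J e) (space (time_weight e' \<Otimes>\<^sub>M weighted_M J e)) \<noteq> \<infinity>"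
      by (simp add: space_pair_measure)
  qed
  show "sigma_finite_measure (freq_measure J \<Otimes>\<^sub>M freq_measure J)" by unfold_locales
qed simp_all

text \<open>The phase difference splits into a part in \<open>t\<close> and a part in
  \<open>x\<close>, so the kernel is a time kernel times a space kernel.\<close>

lemma ker_bilin:
  assumes "0 < e'" "0 < e" and "fst p \<in> freq_space J" "snd p \<in> freq_space J" "fst q \<in> freq_space J" "snd q \<in> freq_space J"
  shows "bounded_phase.ker (time_weight e' \<Otimes>\<^sub>M weighted_M J e) bilin_phase p q =
    complex_of_real (2 * pi * tri e' (((norm (fst q))\<^sup>2 + (norm (snd q))\<^sup>2) - ((norm (fst p))\<^sup>2 + (norm (snd p))\<^sup>2)) *
      ((2 * pi) ^ 4 * freq_kernel J e (fst p + snd p - (fst q + snd q))))"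
proof -
  interpret bounded_phase "time_weight e' \<Otimes>\<^sub>M weighted_M J e" "freq_measure J \<Otimes>\<^sub>M freq_measure J" bilin_phase
    by (rule bounded_phase_bilin[OF assms(1,2)])
  interpret T: finite_measure "time_weight e'" by (rule finite_time_weight[OF assms(1)])
  interpret W: finite_measure "weighted_M J e" by (rule finite_weighted_M[OF assms(2)])
  interpret TW: pair_sigma_finite "time_weight e'" "weighted_M J e" ..
  define \<tau> where "\<tau> = ((norm (fst q))\<^sup>2 + (norm (snd q))\<^sup>2) - ((norm (fst p))\<^sup>2 + (norm (snd p))\<^sup>2)"
  define s where "s = fst p + snd p - (fst q + snd q)"
  have s: "s \<in> freq_space J" unfolding s_def using assms by (auto simp: freq_space_def)
  have "ker p q = (LINT z|(time_weight e' \<Otimes>\<^sub>M weighted_M J e). cis (fst z * \<tau>) * cis (snd z \<bullet> s))"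
    unfolding ker_def
    by (intro Bochner_Integration.integral_cong refl)
      (simp add: cis_cnj cis_mult \<tau>_def s_def inner_diff_right inner_add_right algebra_simps)
  also have "\<dots> = (LINT t|time_weight e'. LINT x|weighted_M J e. cis (t * \<tau>) * cis (x \<bullet> s))"
  proof -
    have "integrable (time_weight e' \<Otimes>\<^sub>M weighted_M J e) (\<lambda>z. cis (fst z * \<tau>) * cis (snd z \<bullet> s))"
      by (rule \<rho>.integrable_const_bound[where B=1]) (auto simp: norm_mult)
    from TW.integral_fst'[OF this] show ?thesis by simp
  qed
  also have "\<dots> = (LINT t|time_weight e'. cis (t * \<tau>)) * (LINT x|weighted_M J e. cis (x \<bullet> s))"
    by (simp only: Bochner_Integration.integral_mult_right_zero Bochner_Integration.integral_mult_left_zero)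
  also have "\<dots> = complex_of_real (2 * pi * tri e' \<tau>) * complex_of_real ((2 * pi) ^ 4 * freq_kernel J e s)"
    unfolding integral_time_weight_cis[OF assms(1)] integral_weighted_M_cis[OF assms(2) s] ..
  finally show ?thesis unfolding \<tau>_def s_def by simp
qed

text \<open>Parallelogram identity: for two frequencies with sum \<open>s\<close>, the sum of the
  squared norms determines the distance from \<open>s / 2\<close>. This is how a sphere about the
  midpoint arises.\<close>

lemma norm_sum_squares_midpoint:
  fixes x s :: "'a :: real_inner"
  shows "(norm x)\<^sup>2 + (norm (s - x))\<^sup>2 = 2 * (norm (x - (1/2) *\<^sub>R s))\<^sup>2 + (norm s)\<^sup>2 / 2"
  by (simp add: power2_norm_eq_inner inner_diff_left inner_diff_right inner_commute)

text \<open>Only differences of points of \<open>R\<close> enter, so the position of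
  \<open>R\<close> cancels and the widths at most double. The tolerance
  \<open>2 * \<epsilon>\<close> is halved by \<open>norm_sum_squares_midpoint\<close>.\<close>

lemma slab_subset_shell:
  assumes R: "R = {\<xi> \<in> freq_space J. (\<forall>i. (\<xi> - \<xi>\<^sub>0) $ i \<in> {- lam..lam}) \<and> \<bar>a \<bullet> \<xi> - c\<bar> \<le> mu}"
    and \<xi>: "\<xi>1 \<in> R" "\<xi>2 \<in> R" "\<xi>3 \<in> R"
    and near: "\<bar>(norm \<xi>3)\<^sup>2 + (norm (\<xi>1 + \<xi>2 - \<xi>3))\<^sup>2 - T\<bar> \<le> 2 * \<epsilon>"
  shows "\<xi>3 \<in> shell ((1/2) *\<^sub>R (\<xi>1 + \<xi>2)) a ((T - (norm (\<xi>1 + \<xi>2))\<^sup>2 / 2) / 2) (2 * lam) (2 * mu) \<epsilon>"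
  unfolding shell_def
proof (intro CollectI conjI allI)
  fix m
  have "\<bar>\<xi> $ m - \<xi>\<^sub>0 $ m\<bar> \<le> lam" if "\<xi> \<in> R" for \<xi>
  proof -
    have "(\<xi> - \<xi>\<^sub>0) $ m \<in> {- lam..lam}" using that unfolding R by blast
    then show ?thesis by (simp add: abs_le_iff)
  qed
  from this[OF \<xi>(1)] this[OF \<xi>(2)] this[OF \<xi>(3)]
  show "\<bar>\<xi>3 $ m - ((1/2) *\<^sub>R (\<xi>1 + \<xi>2)) $ m\<bar> \<le> 2 * lam" by (simp add: abs_le_iff field_simps)
next
  have "\<bar>a \<bullet> \<xi> - c\<bar> \<le> mu" if "\<xi> \<in> R" for \<xi> using that unfolding R by auto
  from this[OF \<xi>(1)] this[OF \<xi>(2)] this[OF \<xi>(3)]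
  show "\<bar>a \<bullet> (\<xi>3 - (1/2) *\<^sub>R (\<xi>1 + \<xi>2))\<bar> \<le> 2 * mu"
    by (simp add: inner_diff_right inner_add_right abs_le_iff field_simps)
next
  show "\<bar>(norm (\<xi>3 - (1/2) *\<^sub>R (\<xi>1 + \<xi>2)))\<^sup>2 - (T - (norm (\<xi>1 + \<xi>2))\<^sup>2 / 2) / 2\<bar> \<le> \<epsilon>"
    using near unfolding norm_sum_squares_midpoint by (simp add: abs_le_iff field_simps)
qed

lemma slab_sets: "{\<xi> \<in> freq_space J. (\<forall>i. (\<xi> - \<xi>\<^sub>0) $ i \<in> {- lam..lam}) \<and> \<bar>a \<bullet> \<xi> - c\<bar> \<le> mu} \<in> sets borel"
proof -
  have "{\<xi> \<in> freq_space J. (\<forall>i. (\<xi> - \<xi>\<^sub>0) $ i \<in> {- lam..lam}) \<and> \<bar>a \<bullet> \<xi> - c\<bar> \<le> mu}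
    = freq_space J \<inter> {\<xi> \<in> space borel. (\<forall>i. \<xi> $ i - \<xi>\<^sub>0 $ i \<in> {- lam..lam}) \<and> \<bar>a \<bullet> \<xi> - c\<bar> \<le> mu}" by auto
  also have "\<dots> \<in> sets borel" by measurable
  finally show ?thesis .
qed

text \<open>The space kernel has mass 1 and forces \<open>\<xi>4\<close> to lie within
  \<open>4 * e\<close> of \<open>\<xi>1 + \<xi>2 - \<xi>3\<close>. Integrating over
  \<open>\<xi>4\<close> thus leaves \<open>\<xi>3\<close> in a shell about the midpoint, and the
  height \<open>1 / \<epsilon>\<close> of the time kernel cancels the factor
  \<open>\<epsilon>\<close> of \<open>shell_count\<close>.\<close>

lemma kernel_row_bound:
  assumes J: "0 \<notin> J" "1 \<notin> J" and mu: "1 \<le> mu" "mu \<le> lam" and a: "norm a = 1"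
    and R: "R = {\<xi> \<in> freq_space J. (\<forall>i. (\<xi> - \<xi>\<^sub>0) $ i \<in> {- lam..lam}) \<and> \<bar>a \<bullet> \<xi> - c\<bar> \<le> mu}"
    and B: "\<And>\<xi>. \<xi> \<in> R \<Longrightarrow> norm \<xi> \<le> B" "0 < B"
    and \<epsilon>: "0 < \<epsilon>" "\<epsilon> \<le> 1" and e: "0 < e" "16 * B * e \<le> \<epsilon>"
    and p: "\<xi>1 \<in> R" "\<xi>2 \<in> R"
  shows "(\<integral>\<^sup>+ q. ennreal (tri \<epsilon> (((norm (fst q))\<^sup>2 + (norm (snd q))\<^sup>2) - ((norm \<xi>1)\<^sup>2 + (norm \<xi>2)\<^sup>2)) * freq_kernel J e (\<xi>1 + \<xi>2 - (fst q + snd q)))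
      * indicator (R \<times> R) q \<partial>(freq_measure J \<Otimes>\<^sub>M freq_measure J)) \<le> ennreal (300000 * lam\<^sup>2 * (mu / lam) powr (1 / 6))"
    (is "?L \<le> _")
proof -
  define T where "T = (norm \<xi>1)\<^sup>2 + (norm \<xi>2)\<^sup>2"
  define S where "S = shell ((1/2) *\<^sub>R (\<xi>1 + \<xi>2)) a ((T - (norm (\<xi>1 + \<xi>2))\<^sup>2 / 2) / 2) (2 * lam) (2 * mu) \<epsilon>"
  have [measurable]: "S \<in> sets borel" by (simp add: S_def)
  have [measurable]: "R \<in> sets borel" unfolding R by (rule slab_sets)
  have freq: "\<xi> \<in> freq_space J" if "\<xi> \<in> R" for \<xi> using that unfolding R by auto
  have pointwise: "ennreal (tri \<epsilon> (((norm \<xi>3)\<^sup>2 + (norm \<xi>4)\<^sup>2) - T) * freq_kernel J e (\<xi>1 + \<xi>2 - (\<xi>3 + \<xi>4))) * indicator (R \<times> R) (\<xi>3, \<xi>4)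
    \<le> ennreal (1 / \<epsilon>) * (indicator (R \<inter> S) \<xi>3 * ennreal (freq_kernel J e ((\<xi>1 + \<xi>2 - \<xi>3) - \<xi>4)))" for \<xi>3 \<xi>4
  proof (cases "\<xi>3 \<in> R \<and> \<xi>4 \<in> R \<and> tri \<epsilon> (((norm \<xi>3)\<^sup>2 + (norm \<xi>4)\<^sup>2) - T) * freq_kernel J e (\<xi>1 + \<xi>2 - (\<xi>3 + \<xi>4)) \<noteq> 0")
    case True
    then have q: "\<xi>3 \<in> R" "\<xi>4 \<in> R" and t0: "tri \<epsilon> (((norm \<xi>3)\<^sup>2 + (norm \<xi>4)\<^sup>2) - T) \<noteq> 0" and k0: "freq_kernel J e (\<xi>1 + \<xi>2 - (\<xi>3 + \<xi>4)) \<noteq> 0"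
      by auto
    have t1: "\<bar>((norm \<xi>3)\<^sup>2 + (norm \<xi>4)\<^sup>2) - T\<bar> \<le> \<epsilon>" using t0 tri_eq_0[OF \<epsilon>(1)] by (meson less_le_not_le linear)
    define y where "y = \<xi>1 + \<xi>2 - \<xi>3"
    have "norm (y - \<xi>4) \<le> 4 * e"
    proof (rule norm_le_4)
      fix i
      have eq: "\<xi>1 + \<xi>2 - (\<xi>3 + \<xi>4) = y - \<xi>4" by (simp add: y_def)
      show "\<bar>(y - \<xi>4) $ i\<bar> \<le> e"
      proof (rule ccontr)
        assume "\<not> \<bar>(y - \<xi>4) $ i\<bar> \<le> e"
        then have "e \<le> \<bar>(y - \<xi>4) $ i\<bar>" by (rule less_imp_le[OF not_le_imp_less])
        from freq_kernel_eq_0[OF e(1) this] show False using k0 unfolding eq by simp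
      qed
    qed
    \<comment> \<open>By \<open>16 * B * e \<le> \<epsilon>\<close>, replacing \<open>\<xi>4\<close>
      by \<open>y\<close> changes the squared norm by at most \<open>\<epsilon>\<close>; the width
      of the time kernel adds another \<open>\<epsilon>\<close>.\<close>
    then have "\<bar>norm y - norm \<xi>4\<bar> \<le> 4 * e" using norm_triangle_ineq3[of y \<xi>4] by linarith
    moreover have "norm y + norm \<xi>4 \<le> 4 * B"
    proof -
      have "norm y \<le> norm \<xi>1 + norm \<xi>2 + norm \<xi>3"
        unfolding y_def using norm_triangle_ineq4[of "\<xi>1 + \<xi>2" \<xi>3] norm_triangle_ineq[of \<xi>1 \<xi>2] by linarith
      then show ?thesis using B(1)[OF p(1)] B(1)[OF p(2)] B(1)[OF q(1)] B(1)[OF q(2)] by linarith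
    qed
    ultimately have "\<bar>norm y - norm \<xi>4\<bar> * (norm y + norm \<xi>4) \<le> (4 * e) * (4 * B)"
      using e(1) by (intro mult_mono) auto
    also have "\<bar>norm y - norm \<xi>4\<bar> * (norm y + norm \<xi>4) = \<bar>(norm y)\<^sup>2 - (norm \<xi>4)\<^sup>2\<bar>"
      by (simp add: power2_eq_square square_diff_square_factored abs_mult mult.commute)
    also have "(4 * e) * (4 * B) \<le> \<epsilon>" using e(2) by (simp add: mult_ac)
    finally have y4: "\<bar>(norm y)\<^sup>2 - (norm \<xi>4)\<^sup>2\<bar> \<le> \<epsilon>" .
    have "\<xi>3 \<in> S"
      unfolding S_def
    proof (rule slab_subset_shell[OF R p q(1)])
      show "\<bar>(norm \<xi>3)\<^sup>2 + (norm (\<xi>1 + \<xi>2 - \<xi>3))\<^sup>2 - T\<bar> \<le> 2 * \<epsilon>"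
        using t1 y4 unfolding y_def by linarith
    qed
    then have ind: "indicator (R \<times> R) (\<xi>3, \<xi>4) = (1::ennreal)" "indicator (R \<inter> S) \<xi>3 = (1::ennreal)" using q by auto
    have le: "tri \<epsilon> (((norm \<xi>3)\<^sup>2 + (norm \<xi>4)\<^sup>2) - T) * freq_kernel J e (\<xi>1 + \<xi>2 - (\<xi>3 + \<xi>4)) \<le> 1 / \<epsilon> * freq_kernel J e ((\<xi>1 + \<xi>2 - \<xi>3) - \<xi>4)"
      unfolding diff_diff_eq by (intro mult_right_mono tri_le \<epsilon> freq_kernel_nonneg e)
    have "ennreal (1 / \<epsilon> * k) = ennreal (1 / \<epsilon>) * ennreal k" for k
      by (rule ennreal_mult') (use \<epsilon>(1) in simp)
    from ennreal_leI[OF le, unfolded this] show ?thesis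
      unfolding ind mult_1 mult_1_right .
  next
    case False
    then have zero: "ennreal (tri \<epsilon> (((norm \<xi>3)\<^sup>2 + (norm \<xi>4)\<^sup>2) - T) * freq_kernel J e (\<xi>1 + \<xi>2 - (\<xi>3 + \<xi>4))) * indicator (R \<times> R) (\<xi>3, \<xi>4) = 0"
      by (auto simp: indicator_def)
    show ?thesis unfolding zero by (rule zero_le)
  qed
  have "?L = (\<integral>\<^sup>+ \<xi>3. \<integral>\<^sup>+ \<xi>4. ennreal (tri \<epsilon> (((norm \<xi>3)\<^sup>2 + (norm \<xi>4)\<^sup>2) - T) * freq_kernel J e (\<xi>1 + \<xi>2 - (\<xi>3 + \<xi>4))) * indicator (R \<times> R) (\<xi>3, \<xi>4)
      \<partial>freq_measure J \<partial>freq_measure J)"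
    by (subst freq.nn_integral_fst[symmetric]) (auto simp: T_def)
  also have "\<dots> \<le> (\<integral>\<^sup>+ \<xi>3. \<integral>\<^sup>+ \<xi>4. ennreal (1 / \<epsilon>) * (indicator (R \<inter> S) \<xi>3 * ennreal (freq_kernel J e ((\<xi>1 + \<xi>2 - \<xi>3) - \<xi>4)))
      \<partial>freq_measure J \<partial>freq_measure J)"
    by (intro nn_integral_mono pointwise)
  also have "\<dots> = (\<integral>\<^sup>+ \<xi>3. ennreal (1 / \<epsilon>) * indicator (R \<inter> S) \<xi>3 \<partial>freq_measure J)"
  proof (rule nn_integral_cong)
    fix \<xi>3
    have "(\<integral>\<^sup>+ \<xi>4. ennreal (1 / \<epsilon>) * (indicator (R \<inter> S) \<xi>3 * ennreal (freq_kernel J e ((\<xi>1 + \<xi>2 - \<xi>3) - \<xi>4))) \<partial>freq_measure J)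
      = ennreal (1 / \<epsilon>) * (indicator (R \<inter> S) \<xi>3 * (\<integral>\<^sup>+ \<xi>4. ennreal (freq_kernel J e ((\<xi>1 + \<xi>2 - \<xi>3) - \<xi>4)) \<partial>freq_measure J))"
      by (simp add: nn_integral_cmult)
    also have "\<dots> = ennreal (1 / \<epsilon>) * indicator (R \<inter> S) \<xi>3"
    proof (cases "\<xi>3 \<in> R")
      case True
      then have "\<xi>1 + \<xi>2 - \<xi>3 \<in> freq_space J" using freq p by (auto simp: freq_space_def)
      from nn_integral_freq_kernel[OF e(1) this] show ?thesis by simp
    qed simp
    finally show "(\<integral>\<^sup>+ \<xi>4. ennreal (1 / \<epsilon>) * (indicator (R \<inter> S) \<xi>3 * ennreal (freq_kernel J e ((\<xi>1 + \<xi>2 - \<xi>3) - \<xi>4))) \<partial>freq_measure J)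
      = ennreal (1 / \<epsilon>) * indicator (R \<inter> S) \<xi>3" .
  qed
  also have "\<dots> = ennreal (1 / \<epsilon>) * emeasure (freq_measure J) (R \<inter> S)"
    by (rule nn_integral_cmult_indicator) simp
  also have "\<dots> \<le> ennreal (1 / \<epsilon>) * emeasure (freq_measure J) S"
    by (intro mult_left_mono emeasure_mono) auto
  also have "\<dots> \<le> ennreal (1 / \<epsilon>) * ennreal (300000 * \<epsilon> * lam\<^sup>2 * (mu / lam) powr (1 / 6))"
    unfolding S_def by (intro mult_left_mono shell_count J mu a \<epsilon>) simp
  also have "\<dots> = ennreal (300000 * lam\<^sup>2 * (mu / lam) powr (1 / 6))"
    using \<epsilon> by (subst ennreal_mult'[symmetric]) auto
  finally show ?thesis .
qed

section \<open>From Schur's test to the space-time estimate\<close>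

lemma nn_integral_time_weight_weighted_M:
  assumes "0 < e'" "0 < e" and [measurable]: "f \<in> borel_measurable (lborel \<Otimes>\<^sub>M cell_measure J)"
  shows "(\<integral>\<^sup>+ z. f z \<partial>(time_weight e' \<Otimes>\<^sub>M weighted_M J e))
    = (\<integral>\<^sup>+ z. ennreal (fejer e' (fst z)) * ennreal (M_weight J e (snd z)) * f z \<partial>(lborel \<Otimes>\<^sub>M cell_measure J))"
proof -
  interpret W: finite_measure "weighted_M J e" by (rule finite_weighted_M[OF assms(2)])
  have "sigma_finite_measure (density (cell_measure J) (\<lambda>x. ennreal (M_weight J e x)))"
    using W.sigma_finite_measure_axioms unfolding weighted_M_def .
  then have eq: "time_weight e' \<Otimes>\<^sub>M weighted_M J e =
      density (lborel \<Otimes>\<^sub>M cell_measure J) (\<lambda>(t, x). ennreal (fejer e' t) * ennreal (M_weight J e x))"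
    unfolding time_weight_def weighted_M_def
    by (intro pair_measure_density sigma_finite_cell_measure) auto
  show ?thesis
    unfolding eq by (subst nn_integral_density) (auto simp: case_prod_beta)
qed

lemma borel_measurable_propagate:
  assumes [measurable]: "g \<in> borel_measurable borel"
  shows "(\<lambda>z. propagate J (fst z) g (snd z)) \<in> borel_measurable (lborel \<Otimes>\<^sub>M (borel :: (real^4) measure))"
proof -
  have "(\<lambda>z. LINT \<xi>|freq_measure J. cis (snd z \<bullet> \<xi>) * (cis (- fst z * (norm \<xi>)\<^sup>2) * g \<xi>)) \<in> borel_measurable (lborel \<Otimes>\<^sub>M (borel :: (real^4) measure))"
    by measurable
  then show ?thesis unfolding propagate_def inv_fourier_def by measurable
qed

text \<open>Schur's test for the tensor square of \<open>g\<close>: its \<open>transf\<close> is a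
  multiple of the square of the solution, so the left side of the test is a fourth power
  integral.\<close>

lemma strichartz_weighted:
  assumes J: "0 \<notin> J" "1 \<notin> J" and mu: "1 \<le> mu" "mu \<le> lam" and a: "norm a = 1"
    and R: "R = {\<xi> \<in> freq_space J. (\<forall>i. (\<xi> - \<xi>\<^sub>0) $ i \<in> {- lam..lam}) \<and> \<bar>a \<bullet> \<xi> - c\<bar> \<le> mu}"
    and B: "\<And>\<xi>. \<xi> \<in> R \<Longrightarrow> norm \<xi> \<le> B" "0 < B"
    and \<epsilon>: "0 < \<epsilon>" "\<epsilon> \<le> 1" and e: "0 < e" "16 * B * e \<le> \<epsilon>"
    and g: "integrable (freq_measure J) g" and g0: "\<And>\<xi>. \<xi> \<notin> R \<Longrightarrow> g \<xi> = 0"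
  shows "(\<integral>\<^sup>+ z. ennreal ((norm (propagate J (fst z) g (snd z))) ^ 4) \<partial>(time_weight \<epsilon> \<Otimes>\<^sub>M weighted_M J e))
    \<le> ennreal (300000 * lam\<^sup>2 * (mu / lam) powr (1 / 6)) * (sqn (freq_measure J) g)\<^sup>2"
proof -
  have [measurable]: "g \<in> borel_measurable borel"
    using borel_measurable_integrable[OF g] borel_measurable_freq_measure by blast
  have [measurable]: "R \<in> sets borel" unfolding R by (rule slab_sets)
  have freq: "\<xi> \<in> freq_space J" if "\<xi> \<in> R" for \<xi> using that unfolding R by auto
  let ?N = "freq_measure J"
  interpret bounded_phase "time_weight \<epsilon> \<Otimes>\<^sub>M weighted_M J e" "?N \<Otimes>\<^sub>M ?N" bilin_phase
    by (rule bounded_phase_bilin[OF \<epsilon>(1) e(1)])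
  interpret NN: pair_sigma_finite ?N ?N ..
  define G where "G p = g (fst p) * g (snd p)" for p
  have int_prod: "integrable (?N \<Otimes>\<^sub>M ?N) (\<lambda>p. f (fst p) * h (snd p))"
    and integral_prod: "(LINT p|(?N \<Otimes>\<^sub>M ?N). f (fst p) * h (snd p)) = (LINT \<xi>|?N. f \<xi>) * (LINT \<xi>|?N. h \<xi>)"
    if f: "integrable ?N f" and h: "integrable ?N h" for f h :: "real^4 \<Rightarrow> complex"
  proof -
    have [measurable]: "f \<in> borel_measurable borel" "h \<in> borel_measurable borel"
      using borel_measurable_integrable[OF f] borel_measurable_integrable[OF h] borel_measurable_freq_measure by blast+
    show *: "integrable (?N \<Otimes>\<^sub>M ?N) (\<lambda>p. f (fst p) * h (snd p))"
      by (rule NN.Fubini_integrable) (use f h in \<open>auto simp: norm_mult\<close>)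
    from NN.integral_fst'[OF *] show "(LINT p|(?N \<Otimes>\<^sub>M ?N). f (fst p) * h (snd p)) = (LINT \<xi>|?N. f \<xi>) * (LINT \<xi>|?N. h \<xi>)"
      by simp
  qed
  have Gint: "integrable (?N \<Otimes>\<^sub>M ?N) G" unfolding G_def[abs_def] by (rule int_prod[OF g g])
  have tr: "transf G z = (2 * pi) ^ 4 * (propagate J (fst z) g (snd z))\<^sup>2" for z
  proof -
    define f where "f \<xi> = cis (snd z \<bullet> \<xi>) * (cis (- fst z * (norm \<xi>)\<^sup>2) * g \<xi>)" for \<xi>
    have [measurable]: "f \<in> borel_measurable borel" unfolding f_def[abs_def] by measurable
    have f: "integrable ?N f"
      by (rule Bochner_Integration.integrable_bound[OF g]) (auto simp: f_def norm_mult)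
    have "bilin_phase z p * G p = f (fst p) * f (snd p)" for p
    proof -
      have "bilin_phase z p = (cis (snd z \<bullet> fst p) * cis (- fst z * (norm (fst p))\<^sup>2)) * (cis (snd z \<bullet> snd p) * cis (- fst z * (norm (snd p))\<^sup>2))"
        by (simp add: cis_mult inner_add_right algebra_simps)
      then show ?thesis by (simp add: G_def f_def)
    qed
    then have "transf G z = (LINT \<xi>|?N. f \<xi>) * (LINT \<xi>|?N. f \<xi>)"
      unfolding transf_def using integral_prod[OF f f] by simp
    moreover have "propagate J (fst z) g (snd z) = (1 / (2 * pi)\<^sup>2) *\<^sub>R (LINT \<xi>|?N. f \<xi>)"
      by (simp add: propagate_def inv_fourier_def f_def)
    ultimately show ?thesis by (simp add: scaleR_conv_of_real power2_eq_square eval_nat_numeral)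
  qed
  let ?A = "ennreal (300000 * lam\<^sup>2 * (mu / lam) powr (1 / 6))"
  let ?c5 = "ennreal ((2 * pi) ^ 5)"
  define \<tau> where "\<tau> p q = ((norm (fst q))\<^sup>2 + (norm (snd q))\<^sup>2) - ((norm (fst p))\<^sup>2 + (norm (snd p))\<^sup>2)" for p q :: "(real^4) \<times> (real^4)"
  define s where "s p q = fst p + snd p - (fst q + snd q)" for p q :: "(real^4) \<times> (real^4)"
  \<comment> \<open>The constant \<open>(2 * pi) ^ 5\<close> consists of one factor
    \<open>2 * pi\<close> from time and four from space.\<close>
  define \<kappa> where "\<kappa> p q = ?c5 * ennreal (tri \<epsilon> (\<tau> p q) * freq_kernel J e (s p q))" for p q
  have schur: "(\<integral>\<^sup>+ z. ennreal ((norm (transf G z))\<^sup>2) \<partial>(time_weight \<epsilon> \<Otimes>\<^sub>M weighted_M J e))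
    \<le> (?c5 * ?A) * (\<integral>\<^sup>+ p. ennreal ((norm (G p))\<^sup>2) \<partial>(?N \<Otimes>\<^sub>M ?N))"
  proof (rule schur_bound[OF Gint, where S="R \<times> R" and \<kappa>=\<kappa>])
    show "G p = 0" if "p \<notin> R \<times> R" for p using that g0 by (cases p) (auto simp: G_def)
    show "ennreal (norm (ker p q)) \<le> \<kappa> p q" if "p \<in> R \<times> R" "q \<in> R \<times> R" for p q
    proof -
      have nn: "0 \<le> tri \<epsilon> (\<tau> p q)" "0 \<le> freq_kernel J e (s p q)" by (auto intro: tri_nonneg freq_kernel_nonneg \<epsilon> e)
      have "ker p q = complex_of_real (2 * pi * tri \<epsilon> (\<tau> p q) * ((2 * pi) ^ 4 * freq_kernel J e (s p q)))"
        unfolding \<tau>_def s_def by (rule ker_bilin[OF \<epsilon>(1) e(1)]) (use that freq in auto)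
      also have "2 * pi * tri \<epsilon> (\<tau> p q) * ((2 * pi) ^ 4 * freq_kernel J e (s p q)) = (2 * pi) ^ 5 * (tri \<epsilon> (\<tau> p q) * freq_kernel J e (s p q))"
        by (simp add: eval_nat_numeral)
      finally have "norm (ker p q) = (2 * pi) ^ 5 * (tri \<epsilon> (\<tau> p q) * freq_kernel J e (s p q))"
        using nn by (simp only: norm_of_real) (simp add: abs_mult)
      then show ?thesis unfolding \<kappa>_def using nn by (simp add: ennreal_mult)
    qed
    show "\<kappa> p q = \<kappa> q p" for p q
    proof -
      have "\<tau> q p = - \<tau> p q" "s q p = - s p q" by (simp_all add: \<tau>_def s_def)
      then show ?thesis by (simp add: \<kappa>_def tri_minus freq_kernel_minus)
    qed
    show "(\<integral>\<^sup>+ q. \<kappa> p q * indicator (R \<times> R) q \<partial>(?N \<Otimes>\<^sub>M ?N)) \<le> ?c5 * ?A" if "p \<in> R \<times> R" for p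
    proof -
      have p: "fst p \<in> R" "snd p \<in> R" using that by auto
      have "(\<integral>\<^sup>+ q. \<kappa> p q * indicator (R \<times> R) q \<partial>(?N \<Otimes>\<^sub>M ?N)) =
        (\<integral>\<^sup>+ q. ?c5 * (ennreal (tri \<epsilon> (\<tau> p q) * freq_kernel J e (s p q)) * indicator (R \<times> R) q) \<partial>(?N \<Otimes>\<^sub>M ?N))"
        by (simp add: \<kappa>_def mult.assoc)
      also have "\<dots> = ?c5 * (\<integral>\<^sup>+ q. ennreal (tri \<epsilon> (\<tau> p q) * freq_kernel J e (s p q)) * indicator (R \<times> R) q \<partial>(?N \<Otimes>\<^sub>M ?N))"
        unfolding \<tau>_def s_def by (rule nn_integral_cmult) measurable
      also have "\<dots> \<le> ?c5 * ?A"
        unfolding \<tau>_def s_def by (intro mult_left_mono kernel_row_bound[OF J mu a R B \<epsilon> e p]) auto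
      finally show ?thesis .
    qed
    show "(\<lambda>(p, q). \<kappa> p q) \<in> borel_measurable ((?N \<Otimes>\<^sub>M ?N) \<Otimes>\<^sub>M (?N \<Otimes>\<^sub>M ?N))"
      unfolding \<kappa>_def \<tau>_def s_def by measurable
  qed simp
  have GG: "(\<integral>\<^sup>+ p. ennreal ((norm (G p))\<^sup>2) \<partial>(?N \<Otimes>\<^sub>M ?N)) = (sqn ?N g)\<^sup>2"
  proof -
    have "(\<integral>\<^sup>+ p. ennreal ((norm (G p))\<^sup>2) \<partial>(?N \<Otimes>\<^sub>M ?N)) = (\<integral>\<^sup>+ \<xi>. \<integral>\<^sup>+ \<eta>. ennreal ((norm (g \<xi>))\<^sup>2) * ennreal ((norm (g \<eta>))\<^sup>2) \<partial>?N \<partial>?N)"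
      by (subst freq.nn_integral_fst[symmetric]) (auto simp: G_def norm_mult power_mult_distrib ennreal_mult)
    also have "\<dots> = (sqn ?N g)\<^sup>2"
      unfolding sqn_def by (simp add: nn_integral_cmult nn_integral_multc power2_eq_square)
    finally show ?thesis .
  qed
  let ?I = "\<integral>\<^sup>+ z. ennreal ((norm (propagate J (fst z) g (snd z))) ^ 4) \<partial>(time_weight \<epsilon> \<Otimes>\<^sub>M weighted_M J e)"
  have pm: "(\<lambda>z. propagate J (fst z) g (snd z)) \<in> borel_measurable (time_weight \<epsilon> \<Otimes>\<^sub>M weighted_M J e)"
    using borel_measurable_propagate[of g J] by (simp cong: measurable_cong_sets sets_pair_measure_cong)
  \<comment> \<open>Squaring the normalisation gives \<open>(2 * pi) ^ 8\<close>; the surplus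
    \<open>(2 * pi) ^ 3 \<ge> 1\<close> is dropped.\<close>
  have "?c5 * ?I \<le> ennreal ((2 * pi) ^ 8) * ?I"
  proof (intro mult_right_mono ennreal_leI power_increasing)
    show "1 \<le> 2 * pi" using pi_gt3 by linarith
  qed auto
  also have "\<dots> = (\<integral>\<^sup>+ z. ennreal ((2 * pi) ^ 8) * ennreal ((norm (propagate J (fst z) g (snd z))) ^ 4) \<partial>(time_weight \<epsilon> \<Otimes>\<^sub>M weighted_M J e))"
    by (rule nn_integral_cmult[symmetric]) (use pm in measurable)
  also have "\<dots> = (\<integral>\<^sup>+ z. ennreal ((norm (transf G z))\<^sup>2) \<partial>(time_weight \<epsilon> \<Otimes>\<^sub>M weighted_M J e))"
    unfolding tr
    by (intro nn_integral_cong) (simp add: norm_mult norm_power power_mult_distrib ennreal_mult[symmetric] power_mult[symmetric])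
  also have "\<dots> \<le> ?c5 * (?A * (sqn ?N g)\<^sup>2)" using schur unfolding GG by (simp add: mult.assoc)
  finally show ?thesis
    by (subst (asm) ennreal_mult_le_mult_iff) auto
qed

text \<open>Fatou for weights tending to 1. The parameters of \<open>strichartz_weighted\<close> are
  tied by \<open>e = \<epsilon> / (16 * B)\<close>, where \<open>B\<close> bounds the frequencies in
  \<open>R\<close>; the resulting bound is independent of \<open>B\<close>, hence of the position of
  \<open>R\<close>.\<close>

lemma strichartz_slab:
  assumes J: "0 \<notin> J" "1 \<notin> J" and mu: "1 \<le> mu" "mu \<le> lam" and a: "norm a = 1"
    and R: "R = {\<xi> \<in> freq_space J. (\<forall>i. (\<xi> - \<xi>\<^sub>0) $ i \<in> {- lam..lam}) \<and> \<bar>a \<bullet> \<xi> - c\<bar> \<le> mu}"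
    and g: "integrable (freq_measure J) g" and g0: "\<And>\<xi>. \<xi> \<notin> R \<Longrightarrow> g \<xi> = 0"
  shows "(\<integral>\<^sup>+ z. ennreal ((norm (propagate J (fst z) g (snd z))) ^ 4) \<partial>(lborel \<Otimes>\<^sub>M M_measure J))
    \<le> ennreal (300000 * lam\<^sup>2 * (mu / lam) powr (1 / 6)) * (sqn (freq_measure J) g)\<^sup>2"
proof -
  have gm[measurable]: "g \<in> borel_measurable borel"
    using borel_measurable_integrable[OF g] borel_measurable_freq_measure by blast
  define B where "B = norm \<xi>\<^sub>0 + 4 * lam"
  have B: "norm \<xi> \<le> B" if "\<xi> \<in> R" for \<xi>
  proof -
    have "norm (\<xi> - \<xi>\<^sub>0) \<le> 4 * lam"
    proof (rule norm_le_4)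
      fix i
      have "(\<xi> - \<xi>\<^sub>0) $ i \<in> {- lam..lam}" using that unfolding R by blast
      then show "\<bar>(\<xi> - \<xi>\<^sub>0) $ i\<bar> \<le> lam" by (simp add: abs_le_iff)
    qed
    then show ?thesis using norm_triangle_sub[of \<xi> \<xi>\<^sub>0] by (simp add: B_def)
  qed
  have B0: "0 < B" using mu by (simp add: B_def add_nonneg_pos)
  define u where "u z = ennreal ((norm (propagate J (fst z) g (snd z))) ^ 4)" for z
  define w where "w n z = ennreal (fejer (eps_seq n) (fst z)) * ennreal (M_weight J (eps_seq n / (16 * B)) (snd z))" for n and z :: "real \<times> (real^4)"
  have um0: "u \<in> borel_measurable (lborel \<Otimes>\<^sub>M borel)"
    using borel_measurable_propagate[OF gm, of J] unfolding u_def by measurable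
  have um[measurable]: "u \<in> borel_measurable (lborel \<Otimes>\<^sub>M cell_measure J)"
    using um0 by (simp cong: measurable_cong_sets sets_pair_measure_cong)
  have idM: "(\<lambda>x. x) \<in> measurable (M_measure J) borel"
    unfolding M_measure_eq by (rule measurable_restrict_space1) simp
  have umM: "u \<in> borel_measurable (lborel \<Otimes>\<^sub>M M_measure J)"
  proof -
    have "(\<lambda>z. (fst z, snd z)) \<in> measurable (lborel \<Otimes>\<^sub>M M_measure J) (lborel \<Otimes>\<^sub>M borel)"
      by (intro measurable_Pair measurable_fst measurable_compose[OF measurable_snd idM])
    from measurable_compose[OF this um0] show ?thesis by simp
  qed
  \<comment> \<open>\<open>M_measure J\<close> lives on the period cell and
    \<open>cell_measure J\<close> on the whole space, so the product measures are compared through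
    iterated integrals.\<close>
  have "(\<integral>\<^sup>+ z. u z \<partial>(lborel \<Otimes>\<^sub>M M_measure J)) = (\<integral>\<^sup>+ t. \<integral>\<^sup>+ x. u (t, x) \<partial>M_measure J \<partial>lborel)"
  proof -
    interpret sigma_finite_measure "M_measure J"
      unfolding M_measure_eq by (intro sigma_finite_measure_restrict_space sigma_finite_lborel) simp
    show ?thesis by (rule nn_integral_fst[symmetric, OF umM])
  qed
  also have "\<dots> = (\<integral>\<^sup>+ t. \<integral>\<^sup>+ x. u (t, x) \<partial>cell_measure J \<partial>lborel)"
    by (intro nn_integral_cong nn_integral_M_measure) (rule measurable_compose[OF measurable_Pair1' um0], simp)
  also have "\<dots> = (\<integral>\<^sup>+ z. u z \<partial>(lborel \<Otimes>\<^sub>M cell_measure J))"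
    by (rule cell.nn_integral_fst[OF um])
  also have "\<dots> = (\<integral>\<^sup>+ z. liminf (\<lambda>n. w n z * u z) \<partial>(lborel \<Otimes>\<^sub>M cell_measure J))"
  proof (rule nn_integral_cong)
    fix z :: "real \<times> (real^4)"
    have "filterlim eps_seq (at 0) sequentially"
      by (rule filterlim_atI[OF eps_seq_tendsto], rule always_eventually) (simp add: eps_seq_def)
    then have f: "(\<lambda>n. fejer (eps_seq n) (fst z)) \<longlonglongrightarrow> 1"
      by (rule filterlim_compose[OF fejer_tendsto])
    have "(\<lambda>n. eps_seq n / (16 * B)) \<longlonglongrightarrow> 0 / (16 * B)"
      by (intro tendsto_intros eps_seq_tendsto) (use B0 in auto)
    then have "filterlim (\<lambda>n. eps_seq n / (16 * B)) (at 0) sequentially"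
      using B0 by (intro filterlim_atI always_eventually) (auto simp: eps_seq_def)
    then have W: "(\<lambda>n. M_weight J (eps_seq n / (16 * B)) (snd z)) \<longlonglongrightarrow> 1"
      by (rule filterlim_compose[OF M_weight_tendsto])
    have "(\<lambda>n. ennreal (fejer (eps_seq n) (fst z) * M_weight J (eps_seq n / (16 * B)) (snd z) * (norm (propagate J (fst z) g (snd z))) ^ 4))
      \<longlonglongrightarrow> ennreal (1 * 1 * (norm (propagate J (fst z) g (snd z))) ^ 4)"
      by (intro tendsto_ennrealI tendsto_mult f W tendsto_const)
    then have "(\<lambda>n. w n z * u z) \<longlonglongrightarrow> u z"
      unfolding w_def u_def by (simp add: ennreal_mult fejer_nonneg M_weight_nonneg)
    from lim_imp_Liminf[OF sequentially_bot this] show "u z = liminf (\<lambda>n. w n z * u z)" by (rule sym)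
  qed
  also have "\<dots> \<le> liminf (\<lambda>n. \<integral>\<^sup>+ z. w n z * u z \<partial>(lborel \<Otimes>\<^sub>M cell_measure J))"
    unfolding w_def by (rule nn_integral_liminf) measurable
  also have "\<dots> \<le> liminf (\<lambda>n. ennreal (300000 * lam\<^sup>2 * (mu / lam) powr (1 / 6)) * (sqn (freq_measure J) g)\<^sup>2)"
  proof (intro Liminf_mono always_eventually allI)
    fix n
    have e: "0 < eps_seq n / (16 * B)" using eps_seq_pos B0 by simp
    have "(\<integral>\<^sup>+ z. w n z * u z \<partial>(lborel \<Otimes>\<^sub>M cell_measure J)) = (\<integral>\<^sup>+ z. u z \<partial>(time_weight (eps_seq n) \<Otimes>\<^sub>M weighted_M J (eps_seq n / (16 * B))))"
      unfolding w_def by (rule nn_integral_time_weight_weighted_M[OF eps_seq_pos e um, symmetric])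
    also have "\<dots> \<le> ennreal (300000 * lam\<^sup>2 * (mu / lam) powr (1 / 6)) * (sqn (freq_measure J) g)\<^sup>2"
      unfolding u_def
    proof (rule strichartz_weighted[OF J mu a R B B0 eps_seq_pos _ e _ g g0])
      show "eps_seq n \<le> 1" by (simp add: eps_seq_def field_simps)
      show "16 * B * (eps_seq n / (16 * B)) \<le> eps_seq n" using B0 by simp
    qed
    finally show "(\<integral>\<^sup>+ z. w n z * u z \<partial>(lborel \<Otimes>\<^sub>M cell_measure J)) \<le> ennreal (300000 * lam\<^sup>2 * (mu / lam) powr (1 / 6)) * (sqn (freq_measure J) g)\<^sup>2" .
  qed
  also have "\<dots> = ennreal (300000 * lam\<^sup>2 * (mu / lam) powr (1 / 6)) * (sqn (freq_measure J) g)\<^sup>2"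
    by (simp add: Liminf_const)
  finally show ?thesis unfolding u_def .
qed

theorem theorem1p2:
  fixes m n :: nat and J :: "4 set"
  assumes "m + n = 4" and "n \<le> 2"
    and "J = torus_coords m n"
  shows "\<exists>\<delta>::real. \<exists>C::real. \<delta> > 0 \<and>
    (\<forall>mu lam::real. 1 \<le> mu \<and> mu \<le> lam \<longrightarrow>
      (\<forall>R\<in>slabs J mu lam. \<forall>u\<^sub>0\<in>L2_M J.
        eLp_norm 4 (lborel \<Otimes>\<^sub>M M_measure J) (\<lambda>(t, x). P J R (schroedinger J t u\<^sub>0) x)
        \<le> ennreal (C * lam powr (1 / 2) * (mu / lam) powr \<delta>) * eLp_norm 2 (M_measure J) (P J R u\<^sub>0)))"
proof (intro exI conjI allI impI ballI)
  \<comment> \<open>A quarter of the exponent \<open>1 / 6\<close> in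
    \<open>strichartz_slab\<close>, because the norm takes a fourth root.\<close>
  show "0 < (1 / 24 :: real)" by simp
  \<comment> \<open>\<open>n \<le> 2\<close> keeps the coordinates 0 and 1 real.\<close>
  have "{m..<m + n} \<subseteq> {2, 3}" using assms(1,2) by auto
  then have "J \<subseteq> {2, 3}" unfolding assms(3) torus_coords_def by (auto simp: subset_eq)
  then have J: "0 \<notin> J" "1 \<notin> J" by auto
  fix mu lam :: real and R u\<^sub>0
  assume "1 \<le> mu \<and> mu \<le> lam" and RS: "R \<in> slabs J mu lam" and u0: "u\<^sub>0 \<in> L2_M J"
  then have mu: "1 \<le> mu" "mu \<le> lam" by auto
  obtain \<xi>\<^sub>0 a c where a: "norm a = 1"
    and R: "R = {\<xi> \<in> freq_space J. (\<forall>i. (\<xi> - \<xi>\<^sub>0) $ i \<in> {- lam..lam}) \<and> \<bar>a \<bullet> \<xi> - c\<bar> \<le> mu}"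
    using RS unfolding slabs_def by auto
  have [measurable]: "R \<in> sets borel" unfolding R by (rule slab_sets)
  have [measurable]: "fourier_L2 J u\<^sub>0 \<in> borel_measurable borel" by (rule fourier_L2_spec(1)) (use L2_M_D[OF u0] in auto)
  have Ffin: "sqn (freq_measure J) (fourier_L2 J u\<^sub>0) < \<infinity>" by (rule fourier_L2_spec(2)) (use L2_M_D[OF u0] in auto)
  define g where "g \<xi> = indicator R \<xi> * fourier_L2 J u\<^sub>0 \<xi>" for \<xi>
  have [measurable]: "g \<in> borel_measurable borel" unfolding g_def[abs_def] by measurable
  have g0: "g \<xi> = 0" if "\<xi> \<notin> R" for \<xi> using that by (simp add: g_def)
  have gfin: "sqn (freq_measure J) g < \<infinity>"
    unfolding g_def[abs_def] by (rule order.strict_trans1[OF sqn_indicator_le Ffin])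
  define b where "b = norm \<xi>\<^sub>0 + lam"
  have Rsub: "R \<subseteq> freq_cube b \<inter> freq_space J"
  proof
    fix \<xi> assume "\<xi> \<in> R"
    then have "\<bar>\<xi> $ i\<bar> \<le> b" for i
    proof -
      have "(\<xi> - \<xi>\<^sub>0) $ i \<in> {- lam..lam}" using \<open>\<xi> \<in> R\<close> unfolding R by blast
      then have "\<bar>\<xi> $ i - \<xi>\<^sub>0 $ i\<bar> \<le> lam" by (simp add: abs_le_iff)
      then show ?thesis using component_le_norm_cart[of \<xi>\<^sub>0 i] unfolding b_def by linarith
    qed
    then show "\<xi> \<in> freq_cube b \<inter> freq_space J" using \<open>\<xi> \<in> R\<close> unfolding R by (simp add: freq_cube_def)
  qed
  have gint: "integrable (freq_measure J) g"
    unfolding g_def[abs_def]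
  proof (rule integrable_indicator_mult_sqn[OF _ _ _ Ffin])
    have "emeasure (freq_measure J) R \<le> emeasure (freq_measure J) (freq_cube b)"
      using Rsub by (intro emeasure_mono) auto
    then show "emeasure (freq_measure J) R < \<infinity>" using emeasure_freq_cube order.strict_trans1 by blast
  qed auto
  have PR: "P J R u\<^sub>0 = inv_fourier J g" by (simp add: P_def g_def[abs_def])
  have [measurable]: "inv_fourier J g \<in> borel_measurable borel" by (rule borel_measurable_inv_fourier) simp
  define Q where "Q = sqn (M_measure J) (P J R u\<^sub>0)"
  have Qeq: "Q = sqn (cell_measure J) (inv_fourier J g)" unfolding Q_def PR by (rule sqn_M_measure) simp
  have "Q < \<infinity>" unfolding Qeq by (rule order.strict_trans1[OF sqn_inv_fourier_le[OF gint] gfin])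
  then obtain q where q: "0 \<le> q" "Q = ennreal q" by (cases Q) auto
  \<comment> \<open>Returns from the frequency side to the norm of \<open>P J R u\<^sub>0\<close> on
    M.\<close>
  have gQ: "sqn (freq_measure J) g \<le> 2 * Q"
    unfolding Qeq by (rule sqn_le_2_inv_fourier[OF _ gfin, where m=b]) (use g0 Rsub in auto)
  define I where "I = (\<integral>\<^sup>+ z. ennreal (norm (case z of (t, x) \<Rightarrow> P J R (schroedinger J t u\<^sub>0) x) powr 4) \<partial>(lborel \<Otimes>\<^sub>M M_measure J))"
  define k where "k = 300000 * lam\<^sup>2 * (mu / lam) powr (1 / 6)"
  have k0: "0 \<le> k" by (simp add: k_def)
  have "I = (\<integral>\<^sup>+ z. ennreal ((norm (propagate J (fst z) g (snd z))) ^ 4) \<partial>(lborel \<Otimes>\<^sub>M M_measure J))"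
    unfolding I_def by (simp add: case_prod_beta P_schroedinger[OF u0] g_def[abs_def] powr_numeral)
  also have "\<dots> \<le> ennreal k * (sqn (freq_measure J) g)\<^sup>2"
    unfolding k_def by (rule strichartz_slab[OF J mu a R gint g0])
  also have "\<dots> \<le> ennreal k * (2 * Q)\<^sup>2"
    by (intro mult_left_mono power_mono gQ) auto
  also have "\<dots> = ennreal (k * (2 * q)\<^sup>2)"
    using q(1) k0 by (simp add: q(2) ennreal_mult ennreal_power[symmetric])
  finally have I: "I \<le> ennreal (k * (2 * q)\<^sup>2)" .
  then obtain i where i: "0 \<le> i" "I = ennreal i" by (cases I) (auto simp: top_unique)
  have i_le: "i \<le> k * (2 * q)\<^sup>2" using I k0 q(1) unfolding i by (simp add: ennreal_le_iff)
  \<comment> \<open>\<open>40 ^ 4 = 2560000\<close> exceeds \<open>4 * 300000\<close>, where 4 is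
    the square of the factor 2 in \<open>gQ\<close>.\<close>
  define X where "X = 40 * lam powr (1 / 2) * (mu / lam) powr (1 / 24) * sqrt q"
  have X0: "0 \<le> X" using q(1) by (simp add: X_def)
  have "i \<le> X ^ 4"
  proof -
    have lam: "0 < lam" "0 < mu / lam" using mu by auto
    have powr4: "(x powr b) ^ 4 = x powr (b * 4)" if "0 < x" for x b :: real
    proof -
      have "(x powr b) ^ 4 = (x powr b) powr real 4"
        by (rule powr_realpow[symmetric]) (use that in simp)
      also have "\<dots> = x powr (b * real 4)" by (rule powr_powr)
      finally show ?thesis by simp
    qed
    have "(lam powr (1 / 2)) ^ 4 = lam\<^sup>2"
      unfolding powr4[OF lam(1)] using lam(1) by (simp add: powr_numeral)
    moreover have "((mu / lam) powr (1 / 24)) ^ 4 = (mu / lam) powr (1 / 6)"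
      unfolding powr4[OF lam(2)] by simp
    moreover have "(sqrt q) ^ 4 = q\<^sup>2"
    proof -
      have "(sqrt q) ^ 4 = ((sqrt q)\<^sup>2)\<^sup>2" by (simp flip: power_mult)
      then show ?thesis using q(1) by simp
    qed
    ultimately have "X ^ 4 = 2560000 * (lam\<^sup>2 * (mu / lam) powr (1 / 6) * q\<^sup>2)"
      by (simp add: X_def power_mult_distrib)
    moreover have "k * (2 * q)\<^sup>2 = 1200000 * (lam\<^sup>2 * (mu / lam) powr (1 / 6) * q\<^sup>2)"
      by (simp add: k_def power_mult_distrib)
    moreover have "0 \<le> lam\<^sup>2 * (mu / lam) powr (1 / 6) * q\<^sup>2" by simp
    ultimately show ?thesis using i_le by linarith
  qed
  then have "i powr (1 / 4) \<le> (X ^ 4) powr (1 / 4)"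
    using i(1) by (intro powr_mono2) auto
  also have "(X ^ 4) powr (1 / 4) = X"
  proof (cases "X = 0")
    case False
    then have X4: "X ^ 4 = X powr 4" using X0 by (simp add: powr_numeral)
    show ?thesis unfolding X4 powr_powr using X0 False by simp
  qed simp
  finally have iX: "i powr (1 / 4) \<le> X" .
  have "eLp_norm 4 (lborel \<Otimes>\<^sub>M M_measure J) (\<lambda>(t, x). P J R (schroedinger J t u\<^sub>0) x) = ennreal (i powr (1 / 4))"
    unfolding eLp_norm_def Let_def I_def[symmetric] i(2) using i(1) by simp
  also have "\<dots> \<le> ennreal X" by (rule ennreal_leI[OF iX])
  also have "\<dots> = ennreal (40 * lam powr (1 / 2) * (mu / lam) powr (1 / 24)) * ennreal (sqrt q)"
    unfolding X_def using q(1) by (subst ennreal_mult[symmetric]) auto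
  also have "ennreal (sqrt q) = eLp_norm 2 (M_measure J) (P J R u\<^sub>0)"
    unfolding eLp_norm_two Q_def[symmetric] q(2) using q(1) by simp
  finally show "eLp_norm 4 (lborel \<Otimes>\<^sub>M M_measure J) (\<lambda>(t, x). P J R (schroedinger J t u\<^sub>0) x)
    \<le> ennreal (40 * lam powr (1 / 2) * (mu / lam) powr (1 / 24)) * eLp_norm 2 (M_measure J) (P J R u\<^sub>0)" .
qed

end
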